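(* Let $G=G_1*\cdots*G_m$ be a free product of finite cyclic groups $G_1,\ldots,G_m$ with $G_i$ of order $r_i$. Assume that for every $i$, the characteristic of $\mathbb{K}$ does not divide $r_i$. Let $n$ be a positive integer, let $M$ be an $n$-dimensional representation of $G$ over $\mathbb{K}$, and let $d=d(M)$, that is, $d_0=n$ and $d_{ij}$ is the dimension of the $\rho_{ij}$-eigenspace of $M(a_i)$. (1) The dimension vector $d$ is $\theta$-stable if and only if one of the following holds: (a) $n=1$; (b) $d$ is special isotropic and indivisible (so $n=2$ and precisely $4$ entries in $d$ are equal to $1$); (c) $d$ is not special isotropic and $$\sum_{i=1}^m\max(d_{i1},\ldots,d_{ir_i})\le(m-1)n.$$ (2) If $M$ is simple, then $d$ is $\theta$-stable, hence satisfies one of the conditions (a), (b), (c) of (1). (3) If $d$ is $\theta$-stable, then the space of $n$-dimensional representations $M$ of $G$ with $F(M)$ having dimension vector $d$ has a Zariski-dense and open subset of simple representations.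
   Context: $\mathbb{K}$ is an algebraically closed field, $m\ge1$, and each $G_i$ is non-trivial ($r_i\ge2$). $a_i$ is a generator of $G_i$ and $\rho_{i1},\dots,\rho_{ir_i}$ are the $r_i$-th roots of unity in $\mathbb{K}$. An $n$-dimensional representation $M$ of $G$ is an $n$-dimensional vector space $V$ with endomorphisms $M_i=M(a_i)$ satisfying $M_i^{r_i}=I_n$ for all $i$; then $V=F_{i1}\oplus\cdots\oplus F_{ir_i}$, where $F_{ij}$ is the (possibly zero) $\rho_{ij}$-eigenspace of $M_i$. $\Gamma$ is the quiver with one sink $v_0$, a source $v_{ij}$ for each $1\le i\le m$, $1\le j\le r_i$, and exactly one arrow from each $v_{ij}$ to $v_0$. $F(M)$ is the representation of $\Gamma$ with $V$ at $v_0$, $F_{ij}$ at $v_{ij}$, and the inclusions $F_{ij}\hookrightarrow V$ on arrows. Its dimension vector is $d(M)=d\in\mathbb{Z}_{\ge0}^{\Gamma_0}$, with $d_0=n$ and $d_{ij}=\dim F_{ij}$. A dimension vector $d$ is balanced if $\sum_{j=1}^{r_i}d_{ij}=d_0$ for each $i$. $F$ is an equivalence from finite dimensional representations of $G$ to the category of representations $X$ of $\Gamma$ for which the map $\bigoplus_{j=1}^{r_i}X(v_{ij})\to X(v_0)$ is invertible for each $i$; those of dimension vector $d$ form a Zariski-open subset of the affine space $\mathrm{rep}(\Gamma,d)=\bigoplus_{\alpha:u\to v}\mathrm{Mat}_{d_v\times d_u}(\mathbb{K})$, which is identified with the space of $n$-dimensional representations $M$ of $G$ with $F(M)$ of dimension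 vector $d$. $\theta\in\mathbb{Z}^{\Gamma_0}$ has $\theta_{v_0}=-m$ and $\theta_{v_{ij}}=1$; $\theta(d)=\sum_v\theta_vd_v$. A nonzero representation $X$ of $\Gamma$ is $\theta$-stable if $\theta(\dim X)=0$ and $\theta(\dim X')<0$ for every proper nonzero subrepresentation $X'$. A dimension vector is $\theta$-stable if it is the dimension vector of some $\theta$-stable representation. A balanced dimension vector $d$ with $d_0=n\ge2$ is special isotropic if it has exactly $4$ entries $d_{ij}$ with $0<d_{ij}<n$, and these four entries are all equal to $n/2$. A dimension vector is divisible if its entries share a non-trivial common factor, and indivisible otherwise. *)

theory Defs
  imports
    "Jordan_Normal_Form.VS_Connect"
    "Graph_Theory.Digraph"
    "HOL-Analysis.Abstract_Topology"
    "HOL-Algebra.Generated_Groups"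
begin

section \<open>Free products of groups\<close>

text \<open>Elements of the free product are reduced words: lists of letters \<open>(i, g)\<close> with
  \<open>g\<close> a non-identity element of the \<open>i\<close>-th factor, consecutive letters coming from
  different factors.  The product of \<open>u\<close> and \<open>w\<close> multiplies the letters of \<open>u\<close> onto
  \<open>w\<close> from the left, reducing after each letter.\<close>

definition reduced_word :: "'i set \<Rightarrow> ('i \<Rightarrow> 'g monoid) \<Rightarrow> ('i \<times> 'g) list \<Rightarrow> bool" where
  "reduced_word I Gs w \<longleftrightarrow>
     (\<forall>(i, g) \<in> set w. i \<in> I \<and> g \<in> carrier (Gs i) \<and> g \<noteq> \<one>\<^bsub>Gs i\<^esub>) \<and> distinct_adj (map fst w)"

fun letter_mult :: "('i \<Rightarrow> 'g monoid) \<Rightarrow> 'i \<times> 'g \<Rightarrow> ('i \<times> 'g) list \<Rightarrow> ('i \<times> 'g) list" where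
  "letter_mult Gs (i, g) [] = (if g = \<one>\<^bsub>Gs i\<^esub> then [] else [(i, g)])"
| "letter_mult Gs (i, g) ((j, h) # w) =
     (if g = \<one>\<^bsub>Gs i\<^esub> then (j, h) # w
      else if i \<noteq> j then (i, g) # (j, h) # w
      else if g \<otimes>\<^bsub>Gs i\<^esub> h = \<one>\<^bsub>Gs i\<^esub> then w
      else (i, g \<otimes>\<^bsub>Gs i\<^esub> h) # w)"

definition free_product :: "'i set \<Rightarrow> ('i \<Rightarrow> 'g monoid) \<Rightarrow> ('i \<times> 'g) list monoid" where
  "free_product I Gs =
     \<lparr>carrier = {w. reduced_word I Gs w}, mult = (\<lambda>u w. foldr (letter_mult Gs) u w), one = []\<rparr>"

definition free_product_incl :: "('i \<Rightarrow> 'g monoid) \<Rightarrow> 'i \<Rightarrow> 'g \<Rightarrow> ('i \<times> 'g) list" where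
  "free_product_incl Gs i g = (if g = \<one>\<^bsub>Gs i\<^esub> then [] else [(i, g)])"

lemma reduced_word_Cons:
  "reduced_word I Gs ((i, g) # w) \<longleftrightarrow>
     i \<in> I \<and> g \<in> carrier (Gs i) \<and> g \<noteq> \<one>\<^bsub>Gs i\<^esub> \<and> reduced_word I Gs w \<and>
     (w = [] \<or> fst (hd w) \<noteq> i)"
  by (cases w) (auto simp: reduced_word_def)

lemma reduced_word_letter_mult:
  assumes "\<And>i. i \<in> I \<Longrightarrow> group (Gs i)"
    and "i \<in> I" "g \<in> carrier (Gs i)" "reduced_word I Gs w"
  shows "reduced_word I Gs (letter_mult Gs (i, g) w)"
proof -
  interpret group "Gs i" using assms by blast
  show ?thesis
  proof (cases w)
    case Nil
    then show ?thesis using assms by (auto simp: reduced_word_def)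
  next
    case (Cons x w')
    then show ?thesis using assms by (cases x) (auto simp: reduced_word_Cons)
  qed
qed

lemma letter_mult_letter_mult:
  assumes gr: "\<And>i. i \<in> I \<Longrightarrow> group (Gs i)"
    and i: "i \<in> I" and g: "g \<in> carrier (Gs i)" and h: "h \<in> carrier (Gs i)"
    and w: "reduced_word I Gs w"
  shows "letter_mult Gs (i, g) (letter_mult Gs (i, h) w) = letter_mult Gs (i, g \<otimes>\<^bsub>Gs i\<^esub> h) w"
proof -
  interpret group "Gs i" using assms by blast
  show ?thesis
  proof (cases w)
    case Nil
    then show ?thesis using g h by auto
  next
    case (Cons x w')
    obtain j k where x: "x = (j, k)" by (cases x)
    show ?thesis
    proof (cases "i = j")
      case False
      then show ?thesis using g h Cons x by auto
    next
      case True
      then have k: "k \<in> carrier (Gs i)" "k \<noteq> \<one>\<^bsub>Gs i\<^esub>" 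
        and w': "w' = [] \<or> fst (hd w') \<noteq> i"
        using w Cons x by (auto simp: reduced_word_Cons)
      have wk: "w = (i, k) # w'" using Cons x True by simp
      have head: "letter_mult Gs (i, y) w' = (i, y) # w'" if "y \<noteq> \<one>\<^bsub>Gs i\<^esub>" for y
        using w' that by (cases w') auto
      have one: "letter_mult Gs (i, \<one>\<^bsub>Gs i\<^esub>) w' = w'" by (cases w') auto
      show ?thesis
      proof (cases "h \<otimes>\<^bsub>Gs i\<^esub> k = \<one>\<^bsub>Gs i\<^esub>")
        case hk: True
        have "g \<otimes>\<^bsub>Gs i\<^esub> h \<otimes>\<^bsub>Gs i\<^esub> k = g" using g h k hk by (simp add: m_assoc)
        moreover have "h \<noteq> \<one>\<^bsub>Gs i\<^esub>" using hk k by auto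
        moreover have "k = g" if "g \<otimes>\<^bsub>Gs i\<^esub> h = \<one>\<^bsub>Gs i\<^esub>" 
          using that hk g h k by (metis inv_equality inv_inv)
        ultimately show ?thesis using g h k hk wk head one
          by (cases "g = \<one>\<^bsub>Gs i\<^esub>") auto
      next
        case hk: False
        have "g \<otimes>\<^bsub>Gs i\<^esub> h \<otimes>\<^bsub>Gs i\<^esub> k = g \<otimes>\<^bsub>Gs i\<^esub> (h \<otimes>\<^bsub>Gs i\<^esub> k)" using g h k by (simp add: m_assoc)
        moreover have "g \<otimes>\<^bsub>Gs i\<^esub> (h \<otimes>\<^bsub>Gs i\<^esub> k) = k" if "g \<otimes>\<^bsub>Gs i\<^esub> h = \<one>\<^bsub>Gs i\<^esub>"
          using that g h k by (metis l_one m_assoc)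
        ultimately show ?thesis using g h k hk wk
          by (cases "g = \<one>\<^bsub>Gs i\<^esub>"; cases "h = \<one>\<^bsub>Gs i\<^esub>") auto
      qed
    qed
  qed
qed

lemma reduced_word_foldr:
  assumes "\<And>i. i \<in> I \<Longrightarrow> group (Gs i)"
    and "\<forall>(i, g) \<in> set u. i \<in> I \<and> g \<in> carrier (Gs i)" "reduced_word I Gs w"
  shows "reduced_word I Gs (foldr (letter_mult Gs) u w)"
  using assms(2,3) by (induction u) (auto intro!: reduced_word_letter_mult assms(1))

lemma letter_mult_one: "letter_mult Gs (i, \<one>\<^bsub>Gs i\<^esub>) w = w"
  by (cases w) auto

lemma reduced_word_letters:
  "reduced_word I Gs u \<Longrightarrow> \<forall>(i, g) \<in> set u. i \<in> I \<and> g \<in> carrier (Gs i)"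
  by (auto simp: reduced_word_def)

lemma foldr_letter_mult:
  assumes gr: "\<And>i. i \<in> I \<Longrightarrow> group (Gs i)"
    and i: "i \<in> I" "g \<in> carrier (Gs i)" and v: "reduced_word I Gs v" and w: "reduced_word I Gs w"
  shows "foldr (letter_mult Gs) (letter_mult Gs (i, g) v) w =
         letter_mult Gs (i, g) (foldr (letter_mult Gs) v w)"
proof -
  interpret group "Gs i" using assms by blast
  show ?thesis
  proof (cases v)
    case Nil
    then show ?thesis by (simp add: letter_mult_one)
  next
    case (Cons x v')
    obtain j h where x: "x = (j, h)" by (cases x)
    have red: "reduced_word I Gs (foldr (letter_mult Gs) v' w)"
      using v Cons x reduced_word_letters[of I Gs v'] w
      by (intro reduced_word_foldr gr) (auto simp: reduced_word_Cons)
    have "letter_mult Gs (i, g) (letter_mult Gs (i, h) (foldr (letter_mult Gs) v' w)) =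
          letter_mult Gs (i, g \<otimes>\<^bsub>Gs i\<^esub> h) (foldr (letter_mult Gs) v' w)" if "i = j"
      using that v Cons x i red by (intro letter_mult_letter_mult gr) (auto simp: reduced_word_Cons)
    then show ?thesis using Cons x by (auto simp: letter_mult_one)
  qed
qed

lemma free_product_group:
  assumes gr: "\<And>i. i \<in> I \<Longrightarrow> group (Gs i)"
  shows "group (free_product I Gs)"
proof (rule groupI)
  fix u v assume "u \<in> carrier (free_product I Gs)" "v \<in> carrier (free_product I Gs)"
  then show "u \<otimes>\<^bsub>free_product I Gs\<^esub> v \<in> carrier (free_product I Gs)"
    by (auto simp: free_product_def intro!: reduced_word_foldr gr dest: reduced_word_letters)
next
  show "\<one>\<^bsub>free_product I Gs\<^esub> \<in> carrier (free_product I Gs)"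
    by (simp add: free_product_def reduced_word_def)
next
  fix u v w
  assume "u \<in> carrier (free_product I Gs)" "v \<in> carrier (free_product I Gs)"
    "w \<in> carrier (free_product I Gs)"
  then have u: "\<forall>(i, g) \<in> set u. i \<in> I \<and> g \<in> carrier (Gs i)" 
    and v: "reduced_word I Gs v" and w: "reduced_word I Gs w"
    by (auto simp: free_product_def dest: reduced_word_letters)
  have "foldr (letter_mult Gs) (foldr (letter_mult Gs) u v) w =
        foldr (letter_mult Gs) u (foldr (letter_mult Gs) v w)"
    using u
  proof (induction u)
    case (Cons x u)
    obtain i g where x: "x = (i, g)" by (cases x)
    have "reduced_word I Gs (foldr (letter_mult Gs) u v)"
      using Cons.prems v by (intro reduced_word_foldr gr) auto
    then show ?case
      using foldr_letter_mult[of I Gs i g, OF gr _ _ _ w] Cons x by auto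
  qed simp
  then show "u \<otimes>\<^bsub>free_product I Gs\<^esub> v \<otimes>\<^bsub>free_product I Gs\<^esub> w =
    u \<otimes>\<^bsub>free_product I Gs\<^esub> (v \<otimes>\<^bsub>free_product I Gs\<^esub> w)"
    by (simp add: free_product_def)
next
  fix u
  show "\<one>\<^bsub>free_product I Gs\<^esub> \<otimes>\<^bsub>free_product I Gs\<^esub> u = u" by (simp add: free_product_def)
next
  fix u assume "u \<in> carrier (free_product I Gs)"
  then have u: "reduced_word I Gs u" by (simp add: free_product_def)
  define iv where "iv = map (\<lambda>(i, g). (i, inv\<^bsub>Gs i\<^esub> g))"
  have inv_one: "inv\<^bsub>Gs i\<^esub> g \<noteq> \<one>\<^bsub>Gs i\<^esub>" if "i \<in> I" "g \<in> carrier (Gs i)" "g \<noteq> \<one>\<^bsub>Gs i\<^esub>" for i g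
    using that group.inv_eq_1_iff[OF gr] by blast
  have "distinct_adj (rev (map fst u))"
    using u by (simp add: reduced_word_def)
  moreover have "map fst (iv (rev u)) = rev (map fst u)"
    by (simp add: iv_def rev_map case_prod_beta comp_def)
  ultimately have "reduced_word I Gs (iv (rev u))"
    using u inv_one by (auto simp: reduced_word_def iv_def intro: group.inv_closed[OF gr])
  moreover have "foldr (letter_mult Gs) (iv (rev u)) u = []"
    using u
  proof (induction u)
    case (Cons x u)
    obtain i g where x: "x = (i, g)" by (cases x)
    then have i: "i \<in> I" "g \<in> carrier (Gs i)" "g \<noteq> \<one>\<^bsub>Gs i\<^esub>"
      using Cons.prems by (auto simp: reduced_word_Cons)
    then have "letter_mult Gs (i, inv\<^bsub>Gs i\<^esub> g) ((i, g) # u) = u"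
      using inv_one[OF i] group.l_inv[OF gr] by auto
    then show ?case using Cons x by (auto simp: iv_def reduced_word_Cons)
  qed (simp add: iv_def)
  ultimately show "\<exists>v\<in>carrier (free_product I Gs). v \<otimes>\<^bsub>free_product I Gs\<^esub> u = \<one>\<^bsub>free_product I Gs\<^esub>"
    by (auto simp: free_product_def)
qed

lemma free_product_incl_hom:
  assumes "i \<in> I" "group (Gs i)"
  shows "free_product_incl Gs i \<in> hom (Gs i) (free_product I Gs)"
proof -
  interpret group "Gs i" by fact
  show ?thesis
    using assms(1) by (auto simp: hom_def free_product_incl_def free_product_def reduced_word_def)
qed

section \<open>Matrix representations of groups\<close>

definition vec_subspace :: "nat \<Rightarrow> 'k::field vec set \<Rightarrow> bool" where
  "vec_subspace n W \<longleftrightarrow> VectorSpace.subspace class_ring W (module_vec TYPE('k) n)"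

definition vec_subspace_dim :: "nat \<Rightarrow> 'k::field vec set \<Rightarrow> nat" where
  "vec_subspace_dim n W =
     vectorspace.dim (class_ring :: 'k ring) (module_vec TYPE('k) n\<lparr>carrier := W\<rparr>)"

text \<open>The representation space is identified with the space of column vectors of length \<open>n\<close>;
  \<open>units_of (ring_mat TYPE('k) n ())\<close> is the general linear group.\<close>

definition group_rep :: "('g, 'b) monoid_scheme \<Rightarrow> nat \<Rightarrow> ('g \<Rightarrow> 'k::field mat) \<Rightarrow> bool" where
  "group_rep G n M \<longleftrightarrow> M \<in> hom G (units_of (ring_mat TYPE('k) n ()))"

definition simple_group_rep :: "('g, 'b) monoid_scheme \<Rightarrow> nat \<Rightarrow> ('g \<Rightarrow> 'k::field mat) \<Rightarrow> bool" where
  "simple_group_rep G n M \<longleftrightarrow> group_rep G n M \<and> n \<noteq> 0 \<and>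
     (\<forall>W. vec_subspace n W \<and> (\<forall>g\<in>carrier G. \<forall>v\<in>W. M g *\<^sub>v v \<in> W) \<longrightarrow>
        W = {0\<^sub>v n} \<or> W = carrier_vec n)"

definition eigen_space :: "nat \<Rightarrow> 'k::field mat \<Rightarrow> 'k \<Rightarrow> 'k vec set" where
  "eigen_space n A c = {v \<in> carrier_vec n. A *\<^sub>v v = c \<cdot>\<^sub>v v}"

definition gen_images ::
  "('i \<Rightarrow> 'g monoid) \<Rightarrow> ('i \<Rightarrow> 'g) \<Rightarrow> (('i \<times> 'g) list \<Rightarrow> 'k mat) \<Rightarrow> 'i \<Rightarrow> 'k mat" where
  "gen_images Gs a M i = M (free_product_incl Gs i (a i))"

section \<open>Representations of quivers\<close>

text \<open>A representation \<open>X\<close> of dimension vector \<open>d\<close> has the space \<open>carrier_vec (d v)\<close> at the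
  vertex \<open>v\<close>, so it is given by one matrix per arrow.  Values of \<open>d\<close> off \<open>verts Q\<close> play
  no role.\<close>

definition quiver_rep :: "('v, 'e) pre_digraph \<Rightarrow> ('v \<Rightarrow> nat) \<Rightarrow> ('e \<Rightarrow> 'k::field mat) set" where
  "quiver_rep Q d = (\<Pi>\<^sub>E \<alpha>\<in>arcs Q. carrier_mat (d (head Q \<alpha>)) (d (tail Q \<alpha>)))"

definition quiver_subrep ::
  "('v, 'e) pre_digraph \<Rightarrow> ('v \<Rightarrow> nat) \<Rightarrow> ('e \<Rightarrow> 'k::field mat) \<Rightarrow> ('v \<Rightarrow> 'k vec set) \<Rightarrow> bool" where
  "quiver_subrep Q d X U \<longleftrightarrow>
     (\<forall>v\<in>verts Q. vec_subspace (d v) (U v)) \<and>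
     (\<forall>\<alpha>\<in>arcs Q. \<forall>u\<in>U (tail Q \<alpha>). X \<alpha> *\<^sub>v u \<in> U (head Q \<alpha>))"

definition weight_sum :: "('v, 'e) pre_digraph \<Rightarrow> ('v \<Rightarrow> int) \<Rightarrow> ('v \<Rightarrow> nat) \<Rightarrow> int" where
  "weight_sum Q \<theta> d = (\<Sum>v\<in>verts Q. \<theta> v * int (d v))"

definition stable_rep ::
  "('v, 'e) pre_digraph \<Rightarrow> ('v \<Rightarrow> int) \<Rightarrow> ('v \<Rightarrow> nat) \<Rightarrow> ('e \<Rightarrow> 'k::field mat) \<Rightarrow> bool" where
  "stable_rep Q \<theta> d X \<longleftrightarrow>
     X \<in> quiver_rep Q d \<and> (\<exists>v\<in>verts Q. d v \<noteq> 0) \<and> weight_sum Q \<theta> d = 0 \<and>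
     (\<forall>U. quiver_subrep Q d X U \<and>
          (\<exists>v\<in>verts Q. U v \<noteq> {0\<^sub>v (d v)}) \<and> (\<exists>v\<in>verts Q. U v \<noteq> carrier_vec (d v)) \<longrightarrow>
        weight_sum Q \<theta> (\<lambda>v. vec_subspace_dim (d v) (U v)) < 0)"

definition stable_dim_vector ::
  "'k::field itself \<Rightarrow> ('v, 'e) pre_digraph \<Rightarrow> ('v \<Rightarrow> int) \<Rightarrow> ('v \<Rightarrow> nat) \<Rightarrow> bool" where
  "stable_dim_vector _ Q \<theta> d \<longleftrightarrow> (\<exists>X :: 'e \<Rightarrow> 'k mat. stable_rep Q \<theta> d X)"

definition divisible_dim_vector :: "('v, 'e) pre_digraph \<Rightarrow> ('v \<Rightarrow> nat) \<Rightarrow> bool" where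
  "divisible_dim_vector Q d \<longleftrightarrow> (\<exists>k\<ge>2. \<forall>v\<in>verts Q. k dvd d v)"

inductive_set rep_polys ::
  "('v, 'e) pre_digraph \<Rightarrow> ('v \<Rightarrow> nat) \<Rightarrow> (('e \<Rightarrow> 'k::field mat) \<Rightarrow> 'k) set"
  for Q d where
  const: "(\<lambda>X. c) \<in> rep_polys Q d"
| coord: "\<lbrakk>\<alpha> \<in> arcs Q; p < d (head Q \<alpha>); q < d (tail Q \<alpha>)\<rbrakk> \<Longrightarrow> (\<lambda>X. X \<alpha> $$ (p, q)) \<in> rep_polys Q d"
| add: "\<lbrakk>f \<in> rep_polys Q d; g \<in> rep_polys Q d\<rbrakk> \<Longrightarrow> (\<lambda>X. f X + g X) \<in> rep_polys Q d"
| mult: "\<lbrakk>f \<in> rep_polys Q d; g \<in> rep_polys Q d\<rbrakk> \<Longrightarrow> (\<lambda>X. f X * g X) \<in> rep_polys Q d"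

definition zariski :: "('v, 'e) pre_digraph \<Rightarrow> ('v \<Rightarrow> nat) \<Rightarrow> ('e \<Rightarrow> 'k::field mat) topology" where
  "zariski Q d =
     topology (\<lambda>U. \<exists>S \<subseteq> rep_polys Q d. U = {X \<in> quiver_rep Q d. \<exists>f\<in>S. f X \<noteq> 0})"

lemma openin_zariski:
  "openin (zariski Q d) U \<longleftrightarrow>
     (\<exists>S \<subseteq> rep_polys Q d. U = {X \<in> quiver_rep Q d. \<exists>f\<in>S. f X \<noteq> (0::'k::field)})"
proof -
  let ?D = "\<lambda>S. {X \<in> quiver_rep Q d. \<exists>f\<in>S. f X \<noteq> (0::'k)}"
  have "istopology (\<lambda>U. \<exists>S \<subseteq> rep_polys Q d. U = ?D S)"
    unfolding istopology_def
  proof (intro conjI allI impI)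
    fix U V assume "\<exists>S \<subseteq> rep_polys Q d. U = ?D S" "\<exists>S \<subseteq> rep_polys Q d. V = ?D S"
    then obtain S T where S: "S \<subseteq> rep_polys Q d" "U = ?D S" and T: "T \<subseteq> rep_polys Q d" "V = ?D T"
      by blast
    have "(\<lambda>(f, g) X. f X * g X) ` (S \<times> T) \<subseteq> rep_polys Q d"
      using S T by (auto intro: rep_polys.mult)
    moreover have "U \<inter> V = ?D ((\<lambda>(f, g) X. f X * g X) ` (S \<times> T))"
      using S T by auto
    ultimately show "\<exists>S \<subseteq> rep_polys Q d. U \<inter> V = ?D S" by blast
  next
    fix \<K> assume "\<forall>U\<in>\<K>. \<exists>S \<subseteq> rep_polys Q d. U = ?D S"
    then have K: "\<exists>S \<subseteq> rep_polys Q d. U = ?D S" if "U \<in> \<K>" for U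
      using that by blast
    define T where "T = {f \<in> rep_polys Q d. ?D {f} \<subseteq> \<Union>\<K>}"
    have "T \<subseteq> rep_polys Q d" by (simp add: T_def)
    moreover have "\<Union>\<K> = ?D T"
    proof
      show "\<Union>\<K> \<subseteq> ?D T"
      proof
        fix X assume "X \<in> \<Union>\<K>"
        then obtain U where U: "U \<in> \<K>" "X \<in> U" by blast
        obtain S where S: "S \<subseteq> rep_polys Q d" "U = ?D S" using K[OF U(1)] by blast
        then obtain f where f: "f \<in> S" "f X \<noteq> 0" "X \<in> quiver_rep Q d" using U(2) by blast
        have "?D {f} \<subseteq> ?D S" using f(1) by blast
        then have "f \<in> T" using S f(1) U(1) unfolding T_def by blast
        then show "X \<in> ?D T" using f by blast
      qed
      show "?D T \<subseteq> \<Union>\<K>" by (auto simp: T_def)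
    qed
    ultimately show "\<exists>S \<subseteq> rep_polys Q d. \<Union>\<K> = ?D S" by blast
  qed
  then show ?thesis by (simp add: zariski_def topology_inverse')
qed

lemma topspace_zariski: "topspace (zariski Q d) = (quiver_rep Q d :: ('e \<Rightarrow> 'k::field mat) set)"
proof (rule antisym)
  show "topspace (zariski Q d) \<subseteq> (quiver_rep Q d :: ('e \<Rightarrow> 'k mat) set)"
    by (auto simp: topspace_def openin_zariski)
  have "(quiver_rep Q d :: ('e \<Rightarrow> 'k mat) set) = {X \<in> quiver_rep Q d. \<exists>f\<in>{\<lambda>X. 1}. f X \<noteq> (0::'k)}" by simp
  then have "openin (zariski Q d) (quiver_rep Q d :: ('e \<Rightarrow> 'k mat) set)"
    unfolding openin_zariski by (intro exI[of _ "{\<lambda>X. 1 :: 'k}"]) (auto intro: rep_polys.const)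
  then show "(quiver_rep Q d :: ('e \<Rightarrow> 'k mat) set) \<subseteq> topspace (zariski Q d)" by (rule openin_subset)
qed

section \<open>The star quiver\<close>

datatype star_vertex = Sink | Source nat nat

text \<open>The unique arrow starting at \<open>Source i j\<close> is called \<open>(i, j)\<close>.\<close>

definition star_quiver :: "nat \<Rightarrow> (nat \<Rightarrow> nat) \<Rightarrow> (star_vertex, nat \<times> nat) pre_digraph" where
  "star_quiver m r =
     \<lparr>verts = insert Sink {Source i j | i j. i \<in> {1..m} \<and> j \<in> {1..r i}},
      arcs = (SIGMA i:{1..m}. {1..r i}),
      tail = (\<lambda>(i, j). Source i j),
      head = (\<lambda>_. Sink)\<rparr>"

definition star_weight :: "nat \<Rightarrow> star_vertex \<Rightarrow> int" where
  "star_weight m v = (case v of Sink \<Rightarrow> - int m | Source i j \<Rightarrow> 1)"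

definition balanced :: "nat \<Rightarrow> (nat \<Rightarrow> nat) \<Rightarrow> (star_vertex \<Rightarrow> nat) \<Rightarrow> bool" where
  "balanced m r d \<longleftrightarrow> (\<forall>i\<in>{1..m}. (\<Sum>j=1..r i. d (Source i j)) = d Sink)"

definition special_isotropic :: "nat \<Rightarrow> (nat \<Rightarrow> nat) \<Rightarrow> (star_vertex \<Rightarrow> nat) \<Rightarrow> bool" where
  "special_isotropic m r d \<longleftrightarrow>
     balanced m r d \<and> d Sink \<ge> 2 \<and>
     card {(i, j). i \<in> {1..m} \<and> j \<in> {1..r i} \<and> 0 < d (Source i j) \<and> d (Source i j) < d Sink} = 4 \<and>
     (\<forall>i\<in>{1..m}. \<forall>j\<in>{1..r i}. 0 < d (Source i j) \<and> d (Source i j) < d Sink \<longrightarrow>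
        2 * d (Source i j) = d Sink)"

text \<open>The dimension vector of the star quiver representation attached to the matrices \<open>A i\<close>.\<close>

definition eigen_dim_vector ::
  "nat \<Rightarrow> (nat \<Rightarrow> nat \<Rightarrow> 'k::field) \<Rightarrow> (nat \<Rightarrow> 'k mat) \<Rightarrow> star_vertex \<Rightarrow> nat" where
  "eigen_dim_vector n \<rho> A v =
     (case v of Sink \<Rightarrow> n | Source i j \<Rightarrow> vec_subspace_dim n (eigen_space n (A i) (\<rho> i j)))"

text \<open>The representations \<open>X\<close> for which the map from the direct sum of the spaces at the
  sources \<open>Source i 1, \<dots>, Source i (r i)\<close> to the space at the sink is invertible, for each
  \<open>i\<close>.\<close>

definition invertible_reps ::
  "nat \<Rightarrow> (nat \<Rightarrow> nat) \<Rightarrow> (star_vertex \<Rightarrow> nat) \<Rightarrow> (nat \<times> nat \<Rightarrow> 'k::field mat) set" where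
  "invertible_reps m r d =
     {X \<in> quiver_rep (star_quiver m r) d. \<forall>i\<in>{1..m}.
        bij_betw (\<lambda>x. finsum_vec TYPE('k) (d Sink) (\<lambda>j. X (i, j) *\<^sub>v x j) {1..r i})
          (\<Pi>\<^sub>E j\<in>{1..r i}. carrier_vec (d (Source i j))) (carrier_vec (d Sink))}"

text \<open>\<open>X\<close> is the system of eigenspaces of the \<open>A i\<close> with their inclusions, written in
  coordinates: multiplication by \<open>X (i, j)\<close> identifies the coordinate space at \<open>Source i j\<close>
  with the \<open>\<rho> i j\<close>-eigenspace of \<open>A i\<close>.  For \<open>X \<in> invertible_reps m r d\<close> this
  determines the matrices \<open>A i\<close>, which gives the identification of \<open>invertible_reps m r d\<close>
  with the space of representations of the free product having dimension vector \<open>d\<close>.\<close>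

definition eigenspace_rep ::
  "nat \<Rightarrow> (nat \<Rightarrow> nat) \<Rightarrow> (star_vertex \<Rightarrow> nat) \<Rightarrow> (nat \<Rightarrow> nat \<Rightarrow> 'k::field) \<Rightarrow>
   (nat \<Rightarrow> 'k mat) \<Rightarrow> (nat \<times> nat \<Rightarrow> 'k mat) \<Rightarrow> bool" where
  "eigenspace_rep m r d \<rho> A X \<longleftrightarrow>
     (\<forall>i\<in>{1..m}. \<forall>j\<in>{1..r i}.
        bij_betw (\<lambda>v. X (i, j) *\<^sub>v v) (carrier_vec (d (Source i j)))
          (eigen_space (d Sink) (A i) (\<rho> i j)))"

end

theory Submission
  imports Defs "Jordan_Normal_Form.Char_Poly" "HOL-Algebra.Multiplicative_Group"
begin

text \<open>
  A representation \<open>M\<close> of the free product is a space \<open>V\<close> with \<open>m\<close> direct sum decompositions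
  \<open>V = F\<^sub>i\<^sub>1 \<oplus> \<dots> \<oplus> F\<^sub>i\<^sub>r\<close>, one for each factor.  Since the order of \<open>G\<^sub>i\<close> is invertible in the field,
  the projections onto the summands are polynomials in \<open>M (a\<^sub>i)\<close>, so the subrepresentations of
  \<open>M\<close> are the subspaces \<open>W\<close> that are mapped into themselves by all these projections.  Call such
  a \<open>W\<close> invariant.

  \<^emph>\<open>Stability is irreducibility.\<close>  For a subrepresentation of the star quiver with space \<open>W\<close> at the
  sink, the dimensions at the sources of the \<open>i\<close>-th group sum up to at most \<open>dim W\<close>, and equality
  holds for all \<open>i\<close> only if \<open>W\<close> is invariant.  So the weight is at most zero, and it is zero only
  if \<open>W\<close> is invariant and the spaces at the sources are the full preimages of \<open>W\<close>.  Hence a representation with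
  invertible sum maps is stable if and only if it has no proper non-zero invariant subspace
  (\<open>irreducible_imp_stable\<close>, \<open>stable_imp_irreducible\<close>), that is, if and only if \<open>M\<close> is simple.
  This gives the second part of the theorem.

  \<^emph>\<open>Necessity.\<close>  Choose for each \<open>i\<close> a summand of maximal dimension.  If these dimensions add up to
  more than \<open>(m - 1) n\<close>, the \<open>m\<close> chosen subspaces have a common non-zero vector, and the line that
  it spans, with one copy at each chosen source, is a subrepresentation of weight zero; for
  \<open>n \<ge> 2\<close> this contradicts stability (\<open>stable_imp_sum_Max_le\<close>).  In the special isotropic case only
  two of the decompositions have more than one non-zero summand, and both split \<open>V\<close> into two
  halves.  Let \<open>E\<close> and \<open>E'\<close> be the projections onto one half of each.  If \<open>v\<close> in the image of \<open>E\<close> is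
  an eigenvector of \<open>E E'\<close>, then the span of \<open>v\<close> and \<open>E' v\<close> is invariant, so \<open>n = 2\<close>
  (\<open>stable_special_isotropic_dim_two\<close>).

  \<^emph>\<open>Sufficiency.\<close>  The representations that admit an invariant subspace of dimension \<open>k\<close> which meets
  the summands in dimensions \<open>e\<^sub>i\<^sub>j\<close> are parametrized polynomially by
  \<open>m n\<^sup>2 - ((m - 1) k (n - k) - \<Sum> e\<^sub>i\<^sub>j (d\<^sub>i\<^sub>j - e\<^sub>i\<^sub>j))\<close> variables, while the whole space of
  representations has dimension \<open>m n\<^sup>2\<close>.  A polynomial map from fewer variables has its image in a
  hypersurface (\<open>poly_map_from_fewer_variables_not_dominant\<close>).  So the strict inequality
  \<open>\<Sum> e\<^sub>i\<^sub>j (d\<^sub>i\<^sub>j - e\<^sub>i\<^sub>j) < (m - 1) k (n - k)\<close> for all such \<open>k\<close> and \<open>e\<close> yields a non-zero polynomial \<open>F\<close> with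
  \<open>F X \<noteq> 0\<close> only for irreducible \<open>X\<close> (\<open>generic_rep_irreducible\<close>).  The set where \<open>F\<close> does not vanish is
  open, and dense because a product of non-zero polynomials is non-zero; this is the third part
  of the theorem.

  The inequality itself comes from an identity.  Put \<open>l = n - k\<close> and, for one entry, write
  \<open>d = e + f\<close>.  Then
  \<open>(e + f) (l\<^sup>2 e + k\<^sup>2 f) = n\<^sup>2 e f + (l e - k f)\<^sup>2\<close>.  Bounding \<open>e + f\<close> by the maximum \<open>D\<^sub>i\<close> of the
  \<open>d\<^sub>i\<^sub>j\<close> and summing over \<open>j\<close> gives \<open>n \<Sum>\<^sub>j e\<^sub>i\<^sub>j f\<^sub>i\<^sub>j \<le> D\<^sub>i k l\<close>, and \<open>\<Sum> D\<^sub>i \<le> (m - 1) n\<close> gives the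
  inequality, not yet strict.  Equality forces all non-zero \<open>d\<^sub>i\<^sub>j\<close> to be equal to \<open>D\<^sub>i\<close> and
  \<open>\<Sum> (n - D\<^sub>i) = n\<close> with each non-zero term at least \<open>n / 2\<close>, which is the special isotropic shape;
  it also forces \<open>n e\<^sub>i\<^sub>j = k d\<^sub>i\<^sub>j\<close>, which is impossible if \<open>n = 2\<close> and \<open>d\<^sub>i\<^sub>j = 1\<close>
  (\<open>condition_imp_negative_euler_form\<close>).
\<close>

section \<open>Linear systems, subspaces and their dimensions\<close>

text \<open>Gaussian elimination: the unknown \<open>s0\<close> is eliminated with the equation \<open>t\<close>, and the remaining
  system is smaller by one equation and one unknown.\<close>

lemma linear_system_nontrivial_solution:
  fixes a :: "'t \<Rightarrow> 's \<Rightarrow> 'k::field"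
  assumes "finite T" "finite S" "card T < card S"
  shows "\<exists>c. (\<exists>s\<in>S. c s \<noteq> 0) \<and> (\<forall>t\<in>T. (\<Sum>s\<in>S. a t s * c s) = 0)"
  using assms
proof (induction T arbitrary: S a rule: finite_induct)
  case empty
  then obtain s where "s \<in> S" by fastforce
  then show ?case by (intro exI[of _ "\<lambda>_. 1"]) auto
next
  case (insert t T)
  show ?case
  proof (cases "\<forall>s\<in>S. a t s = 0")
    case True
    moreover obtain c where "\<exists>s\<in>S. c s \<noteq> 0" "\<forall>t\<in>T. (\<Sum>s\<in>S. a t s * c s) = 0"
      using insert.IH[of S a] insert.prems insert.hyps by auto
    ultimately show ?thesis by (intro exI[of _ c]) auto
  next
    case False
    then obtain s0 where s0: "s0 \<in> S" "a t s0 \<noteq> 0" by blast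
    define b where "b u s = a u s - a u s0 * a t s / a t s0" for u s
    have "card T < card (S - {s0})" using insert s0 by simp
    then obtain c where c: "\<exists>s\<in>S - {s0}. c s \<noteq> 0" "\<forall>u\<in>T. (\<Sum>s\<in>S - {s0}. b u s * c s) = 0"
      using insert.IH[of "S - {s0}" b] insert.prems by auto
    define c' where "c' = c(s0 := - (\<Sum>s\<in>S - {s0}. a t s * c s) / a t s0)"
    have split: "(\<Sum>s\<in>S. a u s * c' s) = a u s0 * c' s0 + (\<Sum>s\<in>S - {s0}. a u s * c s)" for u
      using insert.prems(1) s0(1) by (subst sum.remove[of _ s0]) (auto simp: c'_def intro!: sum.cong)
    have "(\<Sum>s\<in>S. a u s * c' s) = 0" if "u \<in> insert t T" for u
    proof (cases "u = t")
      case True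
      then show ?thesis unfolding split using s0 by (simp add: c'_def)
    next
      case False
      then have "0 = (\<Sum>s\<in>S - {s0}. b u s * c s)" using that c by auto
      also have "\<dots> = (\<Sum>s\<in>S - {s0}. a u s * c s) - a u s0 / a t s0 * (\<Sum>s\<in>S - {s0}. a t s * c s)"
        by (simp add: b_def left_diff_distrib sum_subtractf sum_distrib_left algebra_simps)
      finally show ?thesis unfolding split by (simp add: c'_def)
    qed
    moreover have "\<exists>s\<in>S. c' s \<noteq> 0" using c(1) by (auto simp: c'_def)
    ultimately show ?thesis by blast
  qed
qed

text \<open>Sums of vectors by coordinates.  Unlike \<^const>\<open>finsum_vec\<close> this is total, so that the coordinates
  of a sum can be computed without showing first that the summands have length \<open>n\<close>.\<close>

definition vsum :: "nat \<Rightarrow> ('s \<Rightarrow> 'k::field vec) \<Rightarrow> 's set \<Rightarrow> 'k vec" where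
  "vsum n f S = vec n (\<lambda>p. \<Sum>s\<in>S. f s $ p)"

lemma vsum_carrier [simp]: "vsum n f S \<in> carrier_vec n" "dim_vec (vsum n f S) = n"
  by (auto simp: vsum_def)

lemma vsum_index [simp]: "p < n \<Longrightarrow> vsum n f S $ p = (\<Sum>s\<in>S. f s $ p)"
  by (simp add: vsum_def)

lemma vsum_cong: "S = T \<Longrightarrow> (\<And>s. s \<in> T \<Longrightarrow> f s = g s) \<Longrightarrow> vsum n f S = vsum n g T"
  by (simp add: vsum_def)

lemma smult_vec_nth: "v \<in> carrier_vec n \<Longrightarrow> p < n \<Longrightarrow> (c \<cdot>\<^sub>v v) $ p = c * v $ p"
  by auto

lemma vsum_smult_index:
  assumes "\<And>s. s \<in> S \<Longrightarrow> v s \<in> carrier_vec n" "p < n"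
  shows "vsum n (\<lambda>s. c s \<cdot>\<^sub>v v s) S $ p = (\<Sum>s\<in>S. c s * v s $ p)"
  unfolding vsum_index[OF assms(2)] using assms by (intro sum.cong refl smult_vec_nth[of _ n]) auto

lemma finsum_vec_eq_vsum:
  fixes f :: "'s \<Rightarrow> 'k::field vec"
  assumes "finite S" "\<And>s. s \<in> S \<Longrightarrow> f s \<in> carrier_vec n"
  shows "finsum_vec TYPE('k) n f S = vsum n f S"
proof -
  have "finsum_vec TYPE('k) n f S \<in> carrier_vec n" using assms by (intro finsum_vec_closed) auto
  then show ?thesis using assms by (intro eq_vecI) (auto simp: index_finsum_vec)
qed

lemma mult_mat_vec_vsum:
  assumes "A \<in> carrier_mat l n" "\<And>s. s \<in> S \<Longrightarrow> f s \<in> carrier_vec n"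
  shows "A *\<^sub>v vsum n f S = vsum l (\<lambda>s. A *\<^sub>v f s) S"
proof (rule eq_vecI)
  fix p assume p: "p < dim_vec (vsum l (\<lambda>s. A *\<^sub>v f s) S)"
  then have "(A *\<^sub>v vsum n f S) $ p = (\<Sum>q<n. A $$ (p, q) * (\<Sum>s\<in>S. f s $ q))"
    using assms(1) by (simp add: scalar_prod_def atLeast0LessThan)
  also have "\<dots> = (\<Sum>s\<in>S. \<Sum>q<n. A $$ (p, q) * f s $ q)"
    unfolding sum_distrib_left by (rule sum.swap)
  also have "\<dots> = (\<Sum>s\<in>S. (A *\<^sub>v f s) $ p)"
  proof (rule sum.cong)
    fix s assume "s \<in> S"
    from assms(2)[OF this] show "(\<Sum>q<n. A $$ (p, q) * f s $ q) = (A *\<^sub>v f s) $ p"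
      using assms(1) p by (simp add: scalar_prod_def atLeast0LessThan)
  qed simp
  finally show "(A *\<^sub>v vsum n f S) $ p = vsum l (\<lambda>s. A *\<^sub>v f s) S $ p"
    using p by simp
qed (use assms in auto)

lemma vec_subspace_iff:
  fixes W :: "'k::field vec set"
  shows "vec_subspace n W \<longleftrightarrow> W \<subseteq> carrier_vec n \<and> 0\<^sub>v n \<in> W \<and>
    (\<forall>v\<in>W. \<forall>w\<in>W. v + w \<in> W) \<and> (\<forall>c. \<forall>v\<in>W. c \<cdot>\<^sub>v v \<in> W)"
proof -
  interpret vec_space "TYPE('k)" n .
  have m: "Module.module (class_ring :: 'k ring) V" and v: "vectorspace (class_ring :: 'k ring) V"
    by unfold_locales
  show ?thesis unfolding vec_subspace_def VectorSpace.subspace_def submodule_def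
    using m v by (auto simp: module_vec_simps)
qed

lemma vec_subspace_vsum:
  assumes W: "vec_subspace n W" and f: "\<And>s. s \<in> S \<Longrightarrow> f s \<in> W"
  shows "vsum n f S \<in> W"
proof -
  have z: "0\<^sub>v n \<in> W" and W': "W \<subseteq> carrier_vec n" and add: "\<And>v w. v \<in> W \<Longrightarrow> w \<in> W \<Longrightarrow> v + w \<in> W"
    using W by (auto simp: vec_subspace_iff)
  from f show ?thesis
  proof (induction S rule: infinite_finite_induct)
    case (infinite S)
    then have "vsum n f S = 0\<^sub>v n" by (intro eq_vecI) auto
    then show ?case using z by simp
  next
    case empty
    have "vsum n f {} = 0\<^sub>v n" by (intro eq_vecI) auto
    then show ?case using z by simp
  next
    case (insert s S)
    have "f s \<in> carrier_vec n" using insert.prems W' by blast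
    then have "vsum n f (insert s S) = f s + vsum n f S"
      using insert.hyps by (intro eq_vecI) auto
    then show ?case using insert add by auto
  qed
qed

lemma vec_subspace_smult: "vec_subspace n W \<Longrightarrow> w \<in> W \<Longrightarrow> c \<cdot>\<^sub>v w \<in> W"
  by (simp add: vec_subspace_iff)

text \<open>A reduced echelon basis of \<open>W\<close>: the vector \<open>u s\<close> has the entry \<open>1\<close> in the pivot position \<open>s\<close> and
  \<open>0\<close> in the other pivot positions, and the pivot entries determine the vectors of \<open>W\<close>.  The
  coefficients of \<open>w \<in> W\<close> in this basis are then just entries of \<open>w\<close>.\<close>

definition pivot_basis :: "nat \<Rightarrow> 'k::field vec set \<Rightarrow> nat set \<Rightarrow> (nat \<Rightarrow> 'k vec) \<Rightarrow> bool" where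
  "pivot_basis n W J u \<longleftrightarrow> J \<subseteq> {..<n} \<and> (\<forall>s\<in>J. u s \<in> W) \<and>
     (\<forall>s\<in>J. \<forall>t\<in>J. u s $ t = (if s = t then 1 else 0)) \<and>
     (\<forall>w\<in>W. (\<forall>s\<in>J. w $ s = 0) \<longrightarrow> w = 0\<^sub>v n)"

text \<open>Take a set \<open>J\<close> of positions that is minimal among those whose entries separate the vectors of \<open>W\<close>
  from zero.  By minimality each \<open>s \<in> J\<close> has a vector in \<open>W\<close> whose only non-zero entry on \<open>J\<close> is at \<open>s\<close>.\<close>

lemma pivot_basis_exists:
  assumes W: "vec_subspace n W"
  shows "\<exists>J u. pivot_basis n W J u"
proof -
  define P where "P J \<longleftrightarrow> J \<subseteq> {..<n} \<and> (\<forall>w\<in>W. (\<forall>s\<in>J. w $ s = 0) \<longrightarrow> w = 0\<^sub>v n)" for J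
  have "P {..<n}" using W unfolding P_def vec_subspace_iff by (auto intro!: eq_vecI)
  then obtain J where J: "P J" "\<And>J'. P J' \<Longrightarrow> card J \<le> card J'"
    by (metis ex_has_least_nat)
  have "finite J" using J(1) unfolding P_def by (meson finite_lessThan finite_subset)
  have "\<exists>v\<in>W. \<forall>t\<in>J. v $ t = (if s = t then 1 else 0)" if s: "s \<in> J" for s
  proof -
    have "card (J - {s}) < card J" using s \<open>finite J\<close> by (meson card_Diff1_less)
    then have "\<not> P (J - {s})" using J(2) leD by blast
    then obtain w where w: "w \<in> W" "\<forall>t\<in>J - {s}. w $ t = 0" "w \<noteq> 0\<^sub>v n"
      using J(1) unfolding P_def by auto
    then have "w $ s \<noteq> 0" using J(1) unfolding P_def by auto
    moreover have "dim_vec w = n" "s < n" "J \<subseteq> {..<n}"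
      using w W s J(1) by (auto simp: vec_subspace_iff P_def)
    ultimately have "\<forall>t\<in>J. (1 / (w $ s) \<cdot>\<^sub>v w) $ t = (if s = t then 1 else 0)"
      using w(2) by auto
    then show ?thesis using vec_subspace_smult[OF W w(1)] by blast
  qed
  then obtain u where "\<forall>s\<in>J. u s \<in> W \<and> (\<forall>t\<in>J. u s $ t = (if s = t then 1 else 0))"
    by metis
  then show ?thesis using J(1) unfolding P_def pivot_basis_def by blast
qed

lemma pivot_basis_finite: "pivot_basis n W J u \<Longrightarrow> finite J"
  unfolding pivot_basis_def by (meson finite_lessThan finite_subset)

lemma vec_subspace_carrier: "vec_subspace n W \<Longrightarrow> w \<in> W \<Longrightarrow> w \<in> carrier_vec n"
  by (auto simp: vec_subspace_iff)

lemma pivot_basis_coeff: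
  assumes p: "pivot_basis n W J u" and t: "t \<in> J" and W: "vec_subspace n W"
  shows "vsum n (\<lambda>s. c s \<cdot>\<^sub>v u s) J $ t = c t"
proof -
  have "vsum n (\<lambda>s. c s \<cdot>\<^sub>v u s) J $ t = (\<Sum>s\<in>J. (c s \<cdot>\<^sub>v u s) $ t)"
    using p t by (auto simp: pivot_basis_def)
  also have "\<dots> = (\<Sum>s\<in>J. if s = t then c t else 0)"
  proof (rule sum.cong)
    fix s assume s: "s \<in> J"
    then have "u s \<in> carrier_vec n" "t < n"
      using p t vec_subspace_carrier[OF W, of "u s"] by (auto simp: pivot_basis_def)
    moreover have "u s $ t = (if s = t then 1 else 0)" using p s t by (auto simp: pivot_basis_def)
    ultimately show "(c s \<cdot>\<^sub>v u s) $ t = (if s = t then c t else 0)" by auto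
  qed simp
  also have "\<dots> = c t" using t pivot_basis_finite[OF p] by simp
  finally show ?thesis .
qed

lemma vec_subspace_eqI:
  assumes "vec_subspace n W" "pivot_basis n W J u" "v \<in> W" "w \<in> W" "\<And>s. s \<in> J \<Longrightarrow> v $ s = w $ s"
  shows "v = w"
proof -
  have v: "v \<in> carrier_vec n" "w \<in> carrier_vec n" using assms vec_subspace_carrier by auto
  have "v + (-1) \<cdot>\<^sub>v w \<in> W" using assms by (auto simp: vec_subspace_iff)
  moreover have "\<forall>s\<in>J. (v + (-1) \<cdot>\<^sub>v w) $ s = 0"
    using assms(2,5) v by (auto simp: pivot_basis_def subset_iff)
  ultimately have "v + (-1) \<cdot>\<^sub>v w = 0\<^sub>v n" using assms(2) by (auto simp: pivot_basis_def)
  moreover have "v $ p = (v + (-1) \<cdot>\<^sub>v w) $ p + w $ p" if "p < n" for p using v that by simp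
  ultimately show ?thesis using v by (intro eq_vecI) auto
qed

lemma pivot_basis_expand:
  assumes W: "vec_subspace n W" and p: "pivot_basis n W J u" and w: "w \<in> W"
  shows "w = vsum n (\<lambda>s. w $ s \<cdot>\<^sub>v u s) J"
proof (rule vec_subspace_eqI[OF W p w])
  show "vsum n (\<lambda>s. w $ s \<cdot>\<^sub>v u s) J \<in> W"
    using W p by (intro vec_subspace_vsum vec_subspace_smult) (auto simp: pivot_basis_def)
qed (simp add: pivot_basis_coeff[OF p _ W])

text \<open>The reduced basis is a basis in the usual sense; all later dimension arguments count pivots.\<close>

lemma vec_subspace_dim_eq_card:
  fixes W :: "'k::field vec set"
  assumes W: "vec_subspace n W" and p: "pivot_basis n W J u"
  shows "vec_subspace_dim n W = card J"
proof -
  interpret vec_space "TYPE('k)" n .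
  have sub: "VectorSpace.subspace class_ring W V" using W by (simp add: vec_subspace_def)
  then have subm: "submodule class_ring W V" by (rule is_module)
  interpret W: vectorspace class_ring "V\<lparr>carrier := W\<rparr>" by (rule subspace_is_vs[OF sub])
  have fin: "finite J" by (rule pivot_basis_finite[OF p])
  have inj: "inj_on u J"
  proof (rule inj_onI)
    fix s t assume st: "s \<in> J" "t \<in> J" "u s = u t"
    have "\<forall>s\<in>J. \<forall>t\<in>J. u s $ t = (if s = t then 1 else 0)" using p by (simp add: pivot_basis_def)
    then have "u s $ t = (if s = t then 1 else 0)" "u t $ t = 1" using st(1,2) by auto
    then show "s = t" using st(3) by (simp split: if_splits)
  qed
  have uW: "u ` J \<subseteq> W" using p by (auto simp: pivot_basis_def)
  then have uC: "u ` J \<subseteq> carrier_vec n" using vec_subspace_carrier[OF W] by auto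
  have lc: "W.lincomb a (u ` J) = vsum n (\<lambda>s. a (u s) \<cdot>\<^sub>v u s) J" for a
  proof -
    have "W.lincomb a (u ` J) = lincomb a (u ` J)"
      using lincomb_not_depend[OF _ uW subm] fin by simp
    also have "\<dots> = vsum n (\<lambda>s. a (u s) \<cdot>\<^sub>v u s) J"
    proof (rule eq_vecI)
      fix q assume "q < dim_vec (vsum n (\<lambda>s. a (u s) \<cdot>\<^sub>v u s) J)"
      then have q: "q < n" by simp
      have "lincomb a (u ` J) $ q = (\<Sum>x\<in>u ` J. a x * x $ q)" by (rule lincomb_index[OF q uC])
      also have "\<dots> = (\<Sum>s\<in>J. a (u s) * u s $ q)" by (simp add: sum.reindex[OF inj])
      also have "\<dots> = vsum n (\<lambda>s. a (u s) \<cdot>\<^sub>v u s) J $ q" using q uC by (auto intro!: sum.cong)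
      finally show "lincomb a (u ` J) $ q = vsum n (\<lambda>s. a (u s) \<cdot>\<^sub>v u s) J $ q" .
    qed (use lincomb_dim[of "u ` J" a] fin uC in simp)
    finally show ?thesis .
  qed
  have "W.basis (u ` J)"
  proof (subst W.basis_criterion, safe)
    show "finite (u ` J)" using fin by simp
    show "u s \<in> carrier (V\<lparr>carrier := W\<rparr>)" if "s \<in> J" for s using uW that by auto
    fix v assume "v \<in> carrier (V\<lparr>carrier := W\<rparr>)"
    then have v: "v \<in> W" by simp
    define a where "a = restrict (\<lambda>x. v $ inv_into J u x) (u ` J)"
    have "W.lincomb a (u ` J) = vsum n (\<lambda>s. v $ s \<cdot>\<^sub>v u s) J"
      unfolding lc by (intro vsum_cong) (auto simp: a_def inj)
    then have "W.lincomb a (u ` J) = v" using pivot_basis_expand[OF W p v] by simp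
    then show "\<exists>a. a \<in> u ` J \<rightarrow>\<^sub>E carrier class_ring \<and> W.lincomb a (u ` J) = v"
      by (intro exI[of _ a]) (auto simp: a_def)
    fix b c
    assume b: "b \<in> u ` J \<rightarrow>\<^sub>E carrier class_ring" and c: "c \<in> u ` J \<rightarrow>\<^sub>E carrier class_ring"
      and e: "W.lincomb c (u ` J) = W.lincomb b (u ` J)"
    have "b (u s) = c (u s)" if "s \<in> J" for s
      using e pivot_basis_coeff[OF p that W, of "\<lambda>s. b (u s)"]
        pivot_basis_coeff[OF p that W, of "\<lambda>s. c (u s)"] unfolding lc by simp
    then show "b = c" using b c by (intro PiE_ext[OF b c]) auto
  qed
  then have "W.dim = card (u ` J)" using fin by (intro W.dim_basis) auto
  then show ?thesis using card_image[OF inj] by (simp add: vec_subspace_dim_def)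
qed

text \<open>With more vectors than pivots, some non-trivial combination has all pivot entries zero, hence is
  zero.\<close>

lemma card_independent_le_dim:
  assumes W: "vec_subspace n W" and S: "finite S" and v: "\<And>s. s \<in> S \<Longrightarrow> v s \<in> W"
    and ind: "\<And>c. vsum n (\<lambda>s. c s \<cdot>\<^sub>v v s) S = 0\<^sub>v n \<Longrightarrow> \<forall>s\<in>S. c s = 0"
  shows "card S \<le> vec_subspace_dim n W"
proof (rule ccontr)
  obtain J u where p: "pivot_basis n W J u" using pivot_basis_exists[OF W] by blast
  assume "\<not> ?thesis"
  then have "card J < card S" using vec_subspace_dim_eq_card[OF W p] by simp
  then obtain c where c: "\<exists>s\<in>S. c s \<noteq> 0" "\<forall>t\<in>J. (\<Sum>s\<in>S. v s $ t * c s) = 0"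
    using linear_system_nontrivial_solution[OF pivot_basis_finite[OF p] S, of "\<lambda>t s. v s $ t"] by blast
  let ?w = "vsum n (\<lambda>s. c s \<cdot>\<^sub>v v s) S"
  have "?w \<in> W" using W v by (intro vec_subspace_vsum vec_subspace_smult)
  moreover have "?w $ t = 0" if "t \<in> J" for t
  proof -
    have "t < n" using p that by (auto simp: pivot_basis_def)
    then have "?w $ t = (\<Sum>s\<in>S. v s $ t * c s)"
      using vec_subspace_carrier[OF W v] by (simp add: vsum_smult_index mult.commute del: vsum_index)
    then show ?thesis using c(2) that by simp
  qed
  ultimately have "?w = 0\<^sub>v n" using p by (auto simp: pivot_basis_def)
  then show False using ind c(1) by blast
qed

text \<open>If \<open>w\<close> were outside the span, then \<open>w\<close> together with the \<open>v s\<close> would be independent, and too many.\<close>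

lemma independent_card_eq_dim_spans:
  assumes W: "vec_subspace n W" and S: "finite S" and v: "\<And>s. s \<in> S \<Longrightarrow> v s \<in> W"
    and ind: "\<And>c. vsum n (\<lambda>s. c s \<cdot>\<^sub>v v s) S = 0\<^sub>v n \<Longrightarrow> \<forall>s\<in>S. c s = 0"
    and card: "card S = vec_subspace_dim n W" and w: "w \<in> W"
  shows "\<exists>c. w = vsum n (\<lambda>s. c s \<cdot>\<^sub>v v s) S"
proof (rule ccontr)
  assume no: "\<not> ?thesis"
  \<comment> \<open>The index \<open>None\<close> stands for the additional vector \<open>w\<close>.\<close>
  let ?S = "insert None (Some ` S)"
  define v' where "v' = case_option w v"
  have cS: "card ?S = Suc (card S)" using S by (simp add: card_image)
  have wn: "dim_vec w = n" "\<And>s. s \<in> S \<Longrightarrow> dim_vec (v s) = n"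
    using vec_subspace_carrier[OF W] w v by auto
  have "card ?S \<le> vec_subspace_dim n W"
  proof (rule card_independent_le_dim[OF W, where v = v'])
    show "finite ?S" using S by simp
    show "v' s \<in> W" if "s \<in> ?S" for s using that v w by (auto simp: v'_def)
    fix c assume "vsum n (\<lambda>s. c s \<cdot>\<^sub>v v' s) ?S = 0\<^sub>v n"
    then have "vsum n (\<lambda>s. c s \<cdot>\<^sub>v v' s) ?S $ p = 0" if "p < n" for p using that by simp
    then have e: "c None * w $ p + (\<Sum>s\<in>S. c (Some s) * v s $ p) = 0" if "p < n" for p
      using that S wn by (simp add: sum.insert sum.reindex v'_def)
    have c0: "c None = 0"
    proof (rule ccontr)
      assume c0: "c None \<noteq> 0"
      have "w = vsum n (\<lambda>s. (- c (Some s) / c None) \<cdot>\<^sub>v v s) S"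
      proof (rule eq_vecI)
        fix p assume "p < dim_vec (vsum n (\<lambda>s. (- c (Some s) / c None) \<cdot>\<^sub>v v s) S)"
        then have p: "p < n" by simp
        have "w $ p = - (\<Sum>s\<in>S. c (Some s) * v s $ p) / c None"
          using e[OF p] c0 by (simp add: field_simps eq_neg_iff_add_eq_0)
        also have "\<dots> = (\<Sum>s\<in>S. (- c (Some s) / c None) * v s $ p)"
          by (simp add: sum_divide_distrib sum_negf)
        finally show "w $ p = vsum n (\<lambda>s. (- c (Some s) / c None) \<cdot>\<^sub>v v s) S $ p"
          using p wn by simp
      qed (use wn in simp)
      then have "\<exists>c. w = vsum n (\<lambda>s. c s \<cdot>\<^sub>v v s) S"
        by (intro exI[of _ "\<lambda>s. - c (Some s) / c None"])
      then show False by (rule notE[OF no])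
    qed
    then have "vsum n (\<lambda>s. c (Some s) \<cdot>\<^sub>v v s) S = 0\<^sub>v n"
      using e wn by (intro eq_vecI) auto
    from ind[OF this] show "\<forall>s\<in>?S. c s = 0" using c0 by auto
  qed
  then show False using card cS by simp
qed

lemma dim_le_card_spanning:
  assumes W: "vec_subspace n W" and S: "finite S" and v: "\<And>s. s \<in> S \<Longrightarrow> v s \<in> carrier_vec n"
    and span: "\<And>w. w \<in> W \<Longrightarrow> \<exists>c. w = vsum n (\<lambda>s. c s \<cdot>\<^sub>v v s) S"
  shows "vec_subspace_dim n W \<le> card S"
proof (rule ccontr)
  obtain J u where p: "pivot_basis n W J u" using pivot_basis_exists[OF W] by blast
  have fJ: "finite J" by (rule pivot_basis_finite[OF p])
  have "\<forall>t\<in>J. \<exists>c. u t = vsum n (\<lambda>s. c s \<cdot>\<^sub>v v s) S" using span p by (auto simp: pivot_basis_def)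
  from bchoice[OF this] obtain a where a: "\<forall>t\<in>J. u t = vsum n (\<lambda>s. a t s \<cdot>\<^sub>v v s) S" ..
  assume "\<not> ?thesis"
  then have "card S < card J" using vec_subspace_dim_eq_card[OF W p] by simp
  then obtain c where c: "\<exists>t\<in>J. c t \<noteq> 0" "\<forall>s\<in>S. (\<Sum>t\<in>J. a t s * c t) = 0"
    using linear_system_nontrivial_solution[OF S fJ, of "\<lambda>s t. a t s"] by blast
  have "vsum n (\<lambda>t. c t \<cdot>\<^sub>v u t) J = 0\<^sub>v n"
  proof (rule eq_vecI)
    fix q assume "q < dim_vec (0\<^sub>v n)"
    then have q: "q < n" by simp
    have "vsum n (\<lambda>t. c t \<cdot>\<^sub>v u t) J $ q = (\<Sum>t\<in>J. c t * u t $ q)"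
      using a q by (intro vsum_smult_index) auto
    also have "\<dots> = (\<Sum>t\<in>J. c t * (\<Sum>s\<in>S. a t s * v s $ q))"
      using a q v by (intro sum.cong) (auto simp: vsum_smult_index simp del: vsum_index)
    also have "\<dots> = (\<Sum>t\<in>J. \<Sum>s\<in>S. a t s * c t * v s $ q)" by (simp add: sum_distrib_left mult_ac)
    also have "\<dots> = (\<Sum>s\<in>S. (\<Sum>t\<in>J. a t s * c t) * v s $ q)"
      unfolding sum_distrib_right by (rule sum.swap)
    also have "\<dots> = 0" using c(2) by simp
    finally show "vsum n (\<lambda>t. c t \<cdot>\<^sub>v u t) J $ q = 0\<^sub>v n $ q" using q by simp
  qed simp
  moreover obtain t where t: "t \<in> J" "c t \<noteq> 0" using c(1) by blast
  ultimately show False using pivot_basis_coeff[OF p t(1) W, of c] p by (auto simp: pivot_basis_def)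
qed

lemma vec_subspace_trivial: "vec_subspace n {0\<^sub>v n}" "vec_subspace n (carrier_vec n)"
  by (auto simp: vec_subspace_iff)

lemma dim_carrier_vec: "vec_subspace_dim n (carrier_vec n :: 'k::field vec set) = n"
proof -
  have "pivot_basis n (carrier_vec n :: 'k vec set) {..<n} (unit_vec n)"
    by (auto simp: pivot_basis_def intro: eq_vecI)
  from vec_subspace_dim_eq_card[OF vec_subspace_trivial(2) this] show ?thesis by simp
qed

lemma dim_zero_vec: "vec_subspace_dim n {0\<^sub>v n :: 'k::field vec} = 0"
proof -
  have "pivot_basis n {0\<^sub>v n :: 'k vec} {} (unit_vec n)" by (auto simp: pivot_basis_def)
  from vec_subspace_dim_eq_card[OF vec_subspace_trivial(1) this] show ?thesis by simp
qed

lemma vec_subspace_line: "v \<in> carrier_vec n \<Longrightarrow> vec_subspace n (range (\<lambda>c. c \<cdot>\<^sub>v v))"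
proof -
  assume v: "v \<in> carrier_vec n"
  have "0\<^sub>v n = 0 \<cdot>\<^sub>v v" using v by auto
  moreover have "a \<cdot>\<^sub>v v + b \<cdot>\<^sub>v v = (a + b) \<cdot>\<^sub>v v" "a \<cdot>\<^sub>v (b \<cdot>\<^sub>v v) = (a * b) \<cdot>\<^sub>v v" for a b
    using v by (auto simp: add_smult_distrib_vec smult_smult_assoc)
  ultimately show ?thesis using v unfolding vec_subspace_iff by (auto simp: image_iff)
qed

lemma dim_line:
  assumes v: "v \<in> carrier_vec n" "v \<noteq> 0\<^sub>v n"
  shows "vec_subspace_dim n (range (\<lambda>c. c \<cdot>\<^sub>v v)) = 1"
proof -
  obtain s where s: "s < n" "v $ s \<noteq> 0" using v by (metis carrier_vecD eq_vecI index_zero_vec)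
  have "pivot_basis n (range (\<lambda>c. c \<cdot>\<^sub>v v)) {s} (\<lambda>_. (1 / v $ s) \<cdot>\<^sub>v v)"
    using s v by (auto simp: pivot_basis_def)
  from vec_subspace_dim_eq_card[OF vec_subspace_line[OF v(1)] this] show ?thesis by simp
qed

lemma pivot_basis_independent:
  assumes W: "vec_subspace n W" and p: "pivot_basis n W J u" and "vsum n (\<lambda>s. c s \<cdot>\<^sub>v u s) J = 0\<^sub>v n"
  shows "\<forall>s\<in>J. c s = 0"
proof
  fix s assume s: "s \<in> J"
  then have "s < n" using p by (auto simp: pivot_basis_def)
  then show "c s = 0" using pivot_basis_coeff[OF p s W, of c] assms(3) by simp
qed

lemma dim_mono:
  assumes "vec_subspace n W" "vec_subspace n W'" "W \<subseteq> W'"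
  shows "vec_subspace_dim n W \<le> vec_subspace_dim n W'"
proof -
  obtain J u where p: "pivot_basis n W J u" using pivot_basis_exists assms by blast
  show ?thesis unfolding vec_subspace_dim_eq_card[OF assms(1) p]
    using p assms(3) pivot_basis_independent[OF assms(1) p]
    by (intro card_independent_le_dim[OF assms(2) pivot_basis_finite[OF p], of u]) (auto simp: pivot_basis_def)
qed

lemma dim_eq_imp_eq:
  assumes W: "vec_subspace n W" "vec_subspace n W'" "W \<subseteq> W'"
    and eq: "vec_subspace_dim n W = vec_subspace_dim n W'"
  shows "W = W'"
proof -
  obtain J u where p: "pivot_basis n W J u" using pivot_basis_exists W by blast
  have "w \<in> W" if w: "w \<in> W'" for w
  proof -
    have "\<exists>c. w = vsum n (\<lambda>s. c s \<cdot>\<^sub>v u s) J"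
      using p W(3) pivot_basis_independent[OF W(1) p] eq vec_subspace_dim_eq_card[OF W(1) p]
      by (intro independent_card_eq_dim_spans[OF W(2) pivot_basis_finite[OF p] _ _ _ w]) 
         (auto simp: pivot_basis_def)
    then show ?thesis using p by (auto simp: pivot_basis_def intro!: vec_subspace_vsum[OF W(1)] vec_subspace_smult[OF W(1)])
  qed
  then show ?thesis using W(3) by blast
qed

lemma dim_le: 
  assumes "vec_subspace n (W :: 'k::field vec set)" shows "vec_subspace_dim n W \<le> n"
proof -
  have "W \<subseteq> carrier_vec n" using assms by (simp add: vec_subspace_iff)
  from dim_mono[OF assms vec_subspace_trivial(2) this] show ?thesis by (simp add: dim_carrier_vec)
qed

lemma dim_eq_0_iff:
  assumes "vec_subspace n W" shows "vec_subspace_dim n W = 0 \<longleftrightarrow> W = {0\<^sub>v n}"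
proof
  assume "vec_subspace_dim n W = 0"
  moreover have "{0\<^sub>v n} \<subseteq> W" using assms by (simp add: vec_subspace_iff)
  ultimately show "W = {0\<^sub>v n}"
    using dim_eq_imp_eq[OF vec_subspace_trivial(1) assms] by (simp add: dim_zero_vec)
qed (simp add: dim_zero_vec)

lemma dim_eq_n_iff:
  assumes "vec_subspace n W" shows "vec_subspace_dim n W = n \<longleftrightarrow> W = carrier_vec n"
proof
  assume "vec_subspace_dim n W = n"
  moreover have "W \<subseteq> carrier_vec n" using assms by (simp add: vec_subspace_iff)
  ultimately show "W = carrier_vec n"
    using dim_eq_imp_eq[OF assms vec_subspace_trivial(2)] by (simp add: dim_carrier_vec)
qed (simp add: dim_carrier_vec)

section \<open>Direct sum decompositions\<close>

text \<open>\<open>V = F\<^sub>1 \<oplus> \<dots>\<close> in coordinates: \<open>X j\<close> embeds the \<open>j\<close>-th summand and \<open>R j\<close> is the corresponding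
  coordinate map, so that the \<open>X j * R j\<close> are the projections onto the summands.\<close>

definition splitting :: "nat \<Rightarrow> 'j set \<Rightarrow> ('j \<Rightarrow> nat) \<Rightarrow> ('j \<Rightarrow> 'k::field mat) \<Rightarrow> ('j \<Rightarrow> 'k mat) \<Rightarrow> bool" where
  "splitting n J d X R \<longleftrightarrow> finite J \<and>
     (\<forall>j\<in>J. X j \<in> carrier_mat n (d j) \<and> R j \<in> carrier_mat (d j) n) \<and>
     (\<forall>j\<in>J. \<forall>j'\<in>J. \<forall>y\<in>carrier_vec (d j').
        R j *\<^sub>v (X j' *\<^sub>v y) = (if j = j' then y else 0\<^sub>v (d j))) \<and>
     (\<forall>v\<in>carrier_vec n. vsum n (\<lambda>j. X j *\<^sub>v (R j *\<^sub>v v)) J = v)"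

lemma splittingD:
  assumes "splitting n J d X R"
  shows "finite J" "j \<in> J \<Longrightarrow> X j \<in> carrier_mat n (d j)" "j \<in> J \<Longrightarrow> R j \<in> carrier_mat (d j) n"
    "j \<in> J \<Longrightarrow> j' \<in> J \<Longrightarrow> y \<in> carrier_vec (d j') \<Longrightarrow>
       R j *\<^sub>v (X j' *\<^sub>v y) = (if j = j' then y else 0\<^sub>v (d j))"
    "v \<in> carrier_vec n \<Longrightarrow> vsum n (\<lambda>j. X j *\<^sub>v (R j *\<^sub>v v)) J = v"
  using assms by (auto simp: splitting_def)

lemma vec_expand_units:
  assumes "v \<in> carrier_vec n"
  shows "v = vsum n (\<lambda>p. v $ p \<cdot>\<^sub>v unit_vec n p) {..<n}"
proof (rule eq_vecI)
  fix q assume "q < dim_vec (vsum n (\<lambda>p. v $ p \<cdot>\<^sub>v unit_vec n p) {..<n})"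
  then have q: "q < n" by simp
  have "vsum n (\<lambda>p. v $ p \<cdot>\<^sub>v unit_vec n p) {..<n} $ q = (\<Sum>p<n. v $ p * unit_vec n p $ q)"
    using q by (intro vsum_smult_index) auto
  also have "\<dots> = (\<Sum>p<n. if p = q then v $ q else 0)" using q by (intro sum.cong) (auto simp: unit_vec_def)
  also have "\<dots> = v $ q" using q by simp
  finally show "v $ q = vsum n (\<lambda>p. v $ p \<cdot>\<^sub>v unit_vec n p) {..<n} $ q" by simp
qed (use assms in auto)

lemma mult_mat_vec_lincomb:
  assumes A: "A \<in> carrier_mat l n" and u: "\<And>s. s \<in> S \<Longrightarrow> u s \<in> carrier_vec n"
  shows "A *\<^sub>v vsum n (\<lambda>s. c s \<cdot>\<^sub>v u s) S = vsum l (\<lambda>s. c s \<cdot>\<^sub>v (A *\<^sub>v u s)) S"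
proof -
  have "A *\<^sub>v vsum n (\<lambda>s. c s \<cdot>\<^sub>v u s) S = vsum l (\<lambda>s. A *\<^sub>v (c s \<cdot>\<^sub>v u s)) S"
    using A u by (intro mult_mat_vec_vsum) auto
  also have "\<dots> = vsum l (\<lambda>s. c s \<cdot>\<^sub>v (A *\<^sub>v u s)) S"
    using A u by (intro vsum_cong) (auto simp: mult_mat_vec)
  finally show ?thesis .
qed

lemma vsum_swap:
  "vsum n (\<lambda>i. vsum n (\<lambda>j. f i j) B) A = vsum n (\<lambda>j. vsum n (\<lambda>i. f i j) A) B"
  by (intro eq_vecI) (auto intro: sum.swap)

lemma smult_vsum: "(\<And>s. s \<in> S \<Longrightarrow> f s \<in> carrier_vec n) \<Longrightarrow> c \<cdot>\<^sub>v vsum n f S = vsum n (\<lambda>s. c \<cdot>\<^sub>v f s) S"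
  by (intro eq_vecI) (auto simp: sum_distrib_left intro!: sum.cong smult_vec_nth[symmetric])

lemma mult_mat_vec_zero: "A \<in> carrier_mat l n \<Longrightarrow> A *\<^sub>v 0\<^sub>v n = 0\<^sub>v l"
  by (intro eq_vecI) auto

text \<open>The columns of \<open>R j\<close> are the \<open>j\<close>-th components of the unit vectors.\<close>

lemma splitting_exists:
  fixes X :: "'j \<Rightarrow> 'k::field mat"
  assumes fin: "finite J" and X: "\<And>j. j \<in> J \<Longrightarrow> X j \<in> carrier_mat n (d j)"
    and surj: "\<And>p. p < n \<Longrightarrow> \<exists>x. (\<forall>j\<in>J. x j \<in> carrier_vec (d j)) \<and> vsum n (\<lambda>j. X j *\<^sub>v x j) J = unit_vec n p"
    and inj: "\<And>x x' j. \<lbrakk>\<forall>j\<in>J. x j \<in> carrier_vec (d j); \<forall>j\<in>J. x' j \<in> carrier_vec (d j);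
      vsum n (\<lambda>j. X j *\<^sub>v x j) J = vsum n (\<lambda>j. X j *\<^sub>v x' j) J; j \<in> J\<rbrakk> \<Longrightarrow> x j = x' j"
  shows "\<exists>R. splitting n J d X R"
proof -
  have "\<forall>p\<in>{..<n}. \<exists>x. (\<forall>j\<in>J. x j \<in> carrier_vec (d j)) \<and> vsum n (\<lambda>j. X j *\<^sub>v x j) J = unit_vec n p"
    using surj by blast
  from bchoice[OF this] obtain x where x: "\<forall>p\<in>{..<n}. (\<forall>j\<in>J. x p j \<in> carrier_vec (d j)) \<and>
      vsum n (\<lambda>j. X j *\<^sub>v x p j) J = unit_vec n p" ..
  define R where "R j = mat (d j) n (\<lambda>(q, p). x p j $ q)" for j
  have R: "R j \<in> carrier_mat (d j) n" for j by (simp add: R_def)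
  have Ru: "R j *\<^sub>v unit_vec n p = x p j" if "j \<in> J" "p < n" for j p
  proof -
    have "dim_vec (x p j) = d j" using x that by auto
    then show ?thesis using that by (intro eq_vecI) (simp_all add: R_def)
  qed
  have sum: "vsum n (\<lambda>j. X j *\<^sub>v (R j *\<^sub>v v)) J = v" if v: "v \<in> carrier_vec n" for v
  proof -
    have "X j *\<^sub>v (R j *\<^sub>v v) = vsum n (\<lambda>p. v $ p \<cdot>\<^sub>v (X j *\<^sub>v x p j)) {..<n}" if j: "j \<in> J" for j
    proof -
      have "R j *\<^sub>v v = R j *\<^sub>v vsum n (\<lambda>p. v $ p \<cdot>\<^sub>v unit_vec n p) {..<n}"
        using vec_expand_units[OF v] by simp
      also have "\<dots> = vsum (d j) (\<lambda>p. v $ p \<cdot>\<^sub>v (R j *\<^sub>v unit_vec n p)) {..<n}"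
        by (rule mult_mat_vec_lincomb[OF R]) simp
      also have "\<dots> = vsum (d j) (\<lambda>p. v $ p \<cdot>\<^sub>v x p j) {..<n}"
        using Ru j by (intro vsum_cong) auto
      finally show ?thesis
        using mult_mat_vec_lincomb[OF X[OF j], of "{..<n}" "\<lambda>p. x p j" "\<lambda>p. v $ p"] x j by simp
    qed
    then have "vsum n (\<lambda>j. X j *\<^sub>v (R j *\<^sub>v v)) J
        = vsum n (\<lambda>j. vsum n (\<lambda>p. v $ p \<cdot>\<^sub>v (X j *\<^sub>v x p j)) {..<n}) J"
      by (intro vsum_cong) auto
    also have "\<dots> = vsum n (\<lambda>p. vsum n (\<lambda>j. v $ p \<cdot>\<^sub>v (X j *\<^sub>v x p j)) J) {..<n}"
      by (rule vsum_swap)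
    also have "\<dots> = vsum n (\<lambda>p. v $ p \<cdot>\<^sub>v unit_vec n p) {..<n}"
    proof (rule vsum_cong[OF refl])
      fix p assume p: "p \<in> {..<n}"
      then have "v $ p \<cdot>\<^sub>v vsum n (\<lambda>j. X j *\<^sub>v x p j) J = vsum n (\<lambda>j. v $ p \<cdot>\<^sub>v (X j *\<^sub>v x p j)) J"
        using x by (intro smult_vsum mult_mat_vec_carrier[OF X]) auto
      then show "vsum n (\<lambda>j. v $ p \<cdot>\<^sub>v (X j *\<^sub>v x p j)) J = v $ p \<cdot>\<^sub>v unit_vec n p" using x p by simp
    qed
    finally show ?thesis using vec_expand_units[OF v] by simp
  qed
  have "R j *\<^sub>v (X j' *\<^sub>v y) = (if j = j' then y else 0\<^sub>v (d j))"
    if j: "j \<in> J" "j' \<in> J" "y \<in> carrier_vec (d j')" for j j' y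
  proof (rule inj[OF _ _ _ j(1)])
    have v: "X j' *\<^sub>v y \<in> carrier_vec n" using X[OF j(2)] j(3) by auto
    show "\<forall>j\<in>J. R j *\<^sub>v (X j' *\<^sub>v y) \<in> carrier_vec (d j)" using R v mult_mat_vec_carrier by blast
    show "\<forall>j\<in>J. (if j = j' then y else 0\<^sub>v (d j)) \<in> carrier_vec (d j)" using j by auto
    have "vsum n (\<lambda>j. X j *\<^sub>v (if j = j' then y else 0\<^sub>v (d j))) J = X j' *\<^sub>v y"
    proof (rule eq_vecI)
      fix p assume "p < dim_vec (X j' *\<^sub>v y)"
      then have p: "p < n" using X[OF j(2)] by auto
      have "(\<Sum>j\<in>J. (X j *\<^sub>v (if j = j' then y else 0\<^sub>v (d j))) $ p) = (\<Sum>j\<in>J. if j = j' then (X j' *\<^sub>v y) $ p else 0)"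
        using mult_mat_vec_zero[OF X] p by (intro sum.cong refl) auto
      then show "vsum n (\<lambda>j. X j *\<^sub>v (if j = j' then y else 0\<^sub>v (d j))) J $ p = (X j' *\<^sub>v y) $ p"
        using p fin j(2) by simp
    qed (use X[OF j(2)] in auto)
    then show "vsum n (\<lambda>j. X j *\<^sub>v (R j *\<^sub>v (X j' *\<^sub>v y))) J = vsum n (\<lambda>j. X j *\<^sub>v (if j = j' then y else 0\<^sub>v (d j))) J"
      using sum[OF v] by simp
  qed
  then have "splitting n J d X R" unfolding splitting_def using fin X R sum by blast
  then show ?thesis by (intro exI[of _ R])
qed

lemma splitting_vsum:
  assumes s: "splitting n J d X R" and j: "j \<in> J" and x: "\<And>j. j \<in> J \<Longrightarrow> x j \<in> carrier_vec (d j)"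
  shows "R j *\<^sub>v vsum n (\<lambda>j. X j *\<^sub>v x j) J = x j"
proof -
  have "R j *\<^sub>v vsum n (\<lambda>j. X j *\<^sub>v x j) J = vsum (d j) (\<lambda>j'. R j *\<^sub>v (X j' *\<^sub>v x j')) J"
    using splittingD(2,3)[OF s] x j by (intro mult_mat_vec_vsum) (auto intro!: mult_mat_vec_carrier)
  also have "\<dots> = vsum (d j) (\<lambda>j'. if j = j' then x j' else 0\<^sub>v (d j)) J"
    using splittingD(4)[OF s j] x by (intro vsum_cong) auto
  also have "\<dots> = x j"
  proof (rule eq_vecI)
    fix q assume "q < dim_vec (x j)"
    then have q: "q < d j" using x[OF j] by auto
    have "(\<Sum>j'\<in>J. (if j = j' then x j' else 0\<^sub>v (d j)) $ q) = (\<Sum>j'\<in>J. if j' = j then x j $ q else 0)"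
      using q by (intro sum.cong) auto
    then show "vsum (d j) (\<lambda>j'. if j = j' then x j' else 0\<^sub>v (d j)) J $ q = x j $ q"
      using q j splittingD(1)[OF s] by simp
  qed (use x[OF j] in auto)
  finally show ?thesis .
qed

lemma vsum_supported:
  assumes "finite J" "K \<subseteq> J" "\<And>j. j \<in> J \<Longrightarrow> j \<notin> K \<Longrightarrow> f j = 0\<^sub>v n"
  shows "vsum n f J = vsum n f K"
proof (rule eq_vecI)
  fix p assume "p < dim_vec (vsum n f K)"
  then have p: "p < n" by simp
  have "(\<Sum>j\<in>J. f j $ p) = (\<Sum>j\<in>K. f j $ p)" using assms p by (intro sum.mono_neutral_right) auto
  then show "vsum n f J $ p = vsum n f K $ p" using p by simp
qed simp

lemma vsum_singleton: "f j \<in> carrier_vec n \<Longrightarrow> vsum n f {j} = f j"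
  by (intro eq_vecI) auto

lemma mult_mat_vec_empty:
  assumes "A \<in> carrier_mat n 0" "x \<in> carrier_vec 0"
  shows "A *\<^sub>v x = 0\<^sub>v n"
  using assms by (intro eq_vecI) (auto simp: scalar_prod_def)

lemma zero_dim_vec: "x \<in> carrier_vec 0 \<Longrightarrow> x = 0\<^sub>v 0"
  by auto

lemma bij_betw_iff_splitting:
  fixes X :: "'j \<Rightarrow> 'k::field mat"
  assumes fin: "finite J" and X: "\<And>j. j \<in> J \<Longrightarrow> X j \<in> carrier_mat n (d j)"
  shows "bij_betw (\<lambda>x. finsum_vec TYPE('k) n (\<lambda>j. X j *\<^sub>v x j) J)
      (\<Pi>\<^sub>E j\<in>J. carrier_vec (d j)) (carrier_vec n) \<longleftrightarrow> (\<exists>R. splitting n J d X R)"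
    (is "bij_betw ?f ?A ?B \<longleftrightarrow> _")
proof -
  have f: "?f x = vsum n (\<lambda>j. X j *\<^sub>v x j) J" if "\<forall>j\<in>J. x j \<in> carrier_vec (d j)" for x
    using that fin X by (intro finsum_vec_eq_vsum) (auto intro!: mult_mat_vec_carrier)
  have fA: "?f x = vsum n (\<lambda>j. X j *\<^sub>v x j) J" if "x \<in> ?A" for x
    using that by (intro f) (auto simp: PiE_iff)
  show ?thesis
  proof
    assume b: "bij_betw ?f ?A ?B"
    show "\<exists>R. splitting n J d X R"
    proof (rule splitting_exists[OF fin X])
      fix p assume "p < n"
      have "unit_vec n p \<in> ?f ` ?A" using b by (simp add: bij_betw_def)
      then obtain x where "x \<in> ?A" "?f x = unit_vec n p" by auto
      then show "\<exists>x. (\<forall>j\<in>J. x j \<in> carrier_vec (d j)) \<and> vsum n (\<lambda>j. X j *\<^sub>v x j) J = unit_vec n p"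
        using fA by (intro exI[of _ x]) (auto simp: PiE_iff)
    next
      fix x x' j
      assume x: "\<forall>j\<in>J. x j \<in> carrier_vec (d j)" "\<forall>j\<in>J. x' j \<in> carrier_vec (d j)"
        and e: "vsum n (\<lambda>j. X j *\<^sub>v x j) J = vsum n (\<lambda>j. X j *\<^sub>v x' j) J" and j: "j \<in> J"
      have A: "restrict x J \<in> ?A" "restrict x' J \<in> ?A" using x by auto
      have r: "vsum n (\<lambda>j. X j *\<^sub>v restrict y J j) J = vsum n (\<lambda>j. X j *\<^sub>v y j) J" for y :: "'j \<Rightarrow> 'k vec"
        by (intro vsum_cong) auto
      have "?f (restrict x J) = ?f (restrict x' J)" using fA[OF A(1)] fA[OF A(2)] r e by simp
      then have "restrict x J = restrict x' J" using b A by (auto simp: bij_betw_def inj_on_def)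
      then show "x j = x' j" using j by (metis restrict_apply')
    qed
  next
    assume "\<exists>R. splitting n J d X R"
    then obtain R where s: "splitting n J d X R" ..
    show "bij_betw ?f ?A ?B"
    proof (rule bij_betw_byWitness[where f' = "\<lambda>v. restrict (\<lambda>j. R j *\<^sub>v v) J"])
      show "\<forall>x\<in>?A. restrict (\<lambda>j. R j *\<^sub>v ?f x) J = x"
      proof
        fix x assume x: "x \<in> ?A"
        then have "R j *\<^sub>v vsum n (\<lambda>j. X j *\<^sub>v x j) J = x j" if "j \<in> J" for j
          using that by (intro splitting_vsum[OF s]) (auto simp: PiE_iff)
        then show "restrict (\<lambda>j. R j *\<^sub>v ?f x) J = x"
          using x unfolding fA[OF x] by (intro ext) (auto simp: PiE_iff extensional_def)
      qed
      have RA: "restrict (\<lambda>j. R j *\<^sub>v v) J \<in> ?A" if "v \<in> ?B" for v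
        using that splittingD(3)[OF s] by (auto intro!: mult_mat_vec_carrier)
      show "\<forall>v\<in>?B. ?f (restrict (\<lambda>j. R j *\<^sub>v v) J) = v"
      proof
        fix v :: "'k vec" assume v: "v \<in> ?B"
        have "?f (restrict (\<lambda>j. R j *\<^sub>v v) J) = vsum n (\<lambda>j. X j *\<^sub>v (R j *\<^sub>v v)) J"
          unfolding fA[OF RA[OF v]] by (intro vsum_cong) auto
        then show "?f (restrict (\<lambda>j. R j *\<^sub>v v) J) = v" using splittingD(5)[OF s v] by simp
      qed
      show "?f ` ?A \<subseteq> ?B" using fA by auto
      show "(\<lambda>v. restrict (\<lambda>j. R j *\<^sub>v v) J) ` ?B \<subseteq> ?A" using RA by blast
    qed
  qed
qed

lemma mult_mat_vec_cols:
  fixes A :: "'k::field mat"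
  assumes "A \<in> carrier_mat n l" "x \<in> carrier_vec l" "p < n"
  shows "(A *\<^sub>v x) $ p = (\<Sum>q<l. x $ q * A $$ (p, q))"
  using assms by (auto simp: scalar_prod_def atLeast0LessThan mult.commute intro!: sum.cong)

text \<open>The matrix with all columns of all \<open>X j\<close> is square, so independence of the columns suffices.\<close>

lemma splitting_of_independent_columns:
  fixes X :: "'j \<Rightarrow> 'k::field mat"
  assumes fin: "finite J" and X: "\<And>j. j \<in> J \<Longrightarrow> X j \<in> carrier_mat n (d j)" and dn: "(\<Sum>j\<in>J. d j) = n"
    and ind: "\<And>c. (\<And>p. p < n \<Longrightarrow> (\<Sum>j\<in>J. \<Sum>q<d j. c j q * X j $$ (p, q)) = 0) \<Longrightarrow>
        \<forall>j\<in>J. \<forall>q<d j. c j q = 0"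
  shows "\<exists>R. splitting n J d X R"
proof (rule splitting_exists[OF fin X])
  let ?S = "SIGMA j:J. {..<d j}"
  have fS: "finite ?S" using fin by auto
  have idx: "vsum n (\<lambda>j. X j *\<^sub>v x j) J $ p = (\<Sum>j\<in>J. \<Sum>q<d j. x j $ q * X j $$ (p, q))"
    if "\<forall>j\<in>J. x j \<in> carrier_vec (d j)" "p < n" for x p
    unfolding vsum_index[OF that(2)] using that by (intro sum.cong refl mult_mat_vec_cols[OF X]) auto
  have colc: "col (X j) q \<in> carrier_vec n" if "j \<in> J" for j q
    using X[OF that] by auto
  have cidx: "vsum n (\<lambda>s. c s \<cdot>\<^sub>v (case s of (j, q) \<Rightarrow> col (X j) q)) ?S $ p = (\<Sum>j\<in>J. \<Sum>q<d j. c (j, q) * X j $$ (p, q))"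
    if p: "p < n" for c p
  proof -
    have "(c (j, q) \<cdot>\<^sub>v col (X j) q) $ p = c (j, q) * X j $$ (p, q)" if "j \<in> J" "q < d j" for j q
      using X[OF that(1)] that(2) p by simp
    then have "vsum n (\<lambda>s. c s \<cdot>\<^sub>v (case s of (j, q) \<Rightarrow> col (X j) q)) ?S $ p = (\<Sum>(j, q)\<in>?S. c (j, q) * X j $$ (p, q))"
      unfolding vsum_index[OF p] by (intro sum.cong refl) auto
    then show ?thesis using fin by (simp add: sum.Sigma)
  qed
  show "\<exists>x. (\<forall>j\<in>J. x j \<in> carrier_vec (d j)) \<and> vsum n (\<lambda>j. X j *\<^sub>v x j) J = unit_vec n p" if "p < n" for p
  proof -
    have "\<exists>c. (unit_vec n p :: 'k vec) = vsum n (\<lambda>s. c s \<cdot>\<^sub>v (case s of (j, q) \<Rightarrow> col (X j) q)) ?S"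
    proof (rule independent_card_eq_dim_spans[OF vec_subspace_trivial(2) fS])
      show "(case s of (j, q) \<Rightarrow> col (X j) q) \<in> carrier_vec n" if "s \<in> ?S" for s using colc that by auto
      show "card ?S = vec_subspace_dim n (carrier_vec n :: 'k vec set)"
        using fin dn by (simp add: dim_carrier_vec)
      fix c assume z: "vsum n (\<lambda>s. c s \<cdot>\<^sub>v (case s of (j, q) \<Rightarrow> col (X j) q)) ?S = 0\<^sub>v n"
      have "(\<Sum>j\<in>J. \<Sum>q<d j. c (j, q) * X j $$ (p, q)) = 0" if "p < n" for p
        using cidx[OF that, of c] that unfolding z by simp
      then have "\<forall>j\<in>J. \<forall>q<d j. c (j, q) = 0" by (rule ind[of "\<lambda>j q. c (j, q)"])
      then show "\<forall>s\<in>?S. c s = 0" by auto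
    qed simp
    then obtain c where c: "(unit_vec n p :: 'k vec) = vsum n (\<lambda>s. c s \<cdot>\<^sub>v (case s of (j, q) \<Rightarrow> col (X j) q)) ?S" ..
    define x where "x j = vec (d j) (\<lambda>q. c (j, q))" for j
    have "vsum n (\<lambda>j. X j *\<^sub>v x j) J = unit_vec n p"
    proof (rule eq_vecI)
      fix p' assume "p' < dim_vec (unit_vec n p)"
      then have p': "p' < n" by simp
      show "vsum n (\<lambda>j. X j *\<^sub>v x j) J $ p' = unit_vec n p $ p'"
        unfolding c cidx[OF p'] using p' by (subst idx) (auto simp: x_def intro!: sum.cong)
    qed simp
    then show ?thesis by (intro exI[of _ x]) (simp add: x_def)
  qed
  fix x x' j
  assume x: "\<forall>j\<in>J. x j \<in> carrier_vec (d j)" "\<forall>j\<in>J. x' j \<in> carrier_vec (d j)"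
    and e: "vsum n (\<lambda>j. X j *\<^sub>v x j) J = vsum n (\<lambda>j. X j *\<^sub>v x' j) J" and j: "j \<in> J"
  have "(\<Sum>j\<in>J. \<Sum>q<d j. (x j $ q - x' j $ q) * X j $$ (p, q)) = 0" if p: "p < n" for p
    using idx[OF x(1) p] idx[OF x(2) p] e by (simp add: left_diff_distrib sum_subtractf)
  then have "\<forall>j\<in>J. \<forall>q<d j. x j $ q - x' j $ q = 0" by (rule ind[of "\<lambda>j q. x j $ q - x' j $ q"])
  then show "x j = x' j" using x j by (intro eq_vecI) auto
qed

lemma splitting_of_trivial_kernel:
  fixes X :: "'j \<Rightarrow> 'k::field mat"
  assumes fin: "finite J" and X: "\<And>j. j \<in> J \<Longrightarrow> X j \<in> carrier_mat n (d j)" and dn: "(\<Sum>j\<in>J. d j) = n"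
    and ker: "\<And>x. (\<And>j. j \<in> J \<Longrightarrow> x j \<in> carrier_vec (d j)) \<Longrightarrow> vsum n (\<lambda>j. X j *\<^sub>v x j) J = 0\<^sub>v n \<Longrightarrow>
        \<forall>j\<in>J. x j = 0\<^sub>v (d j)"
  shows "\<exists>R. splitting n J d X R"
proof (rule splitting_of_independent_columns[OF fin X dn])
  fix c assume c: "\<And>p. p < n \<Longrightarrow> (\<Sum>j\<in>J. \<Sum>q<d j. c j q * X j $$ (p, q)) = 0"
  define x where "x j = vec (d j) (c j)" for j
  have "vsum n (\<lambda>j. X j *\<^sub>v x j) J = 0\<^sub>v n"
  proof (rule eq_vecI)
    fix p assume "p < dim_vec (0\<^sub>v n)"
    then have p: "p < n" by simp
    have "vsum n (\<lambda>j. X j *\<^sub>v x j) J $ p = (\<Sum>j\<in>J. \<Sum>q<d j. x j $ q * X j $$ (p, q))"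
      unfolding vsum_index[OF p] using p by (intro sum.cong refl mult_mat_vec_cols[OF X]) (auto simp: x_def)
    also have "\<dots> = 0" using c[OF p] by (simp add: x_def)
    finally show "vsum n (\<lambda>j. X j *\<^sub>v x j) J $ p = 0\<^sub>v n $ p" using p by simp
  qed simp
  then have "\<forall>j\<in>J. x j = 0\<^sub>v (d j)" by (intro ker) (simp_all add: x_def)
  then have "\<forall>j\<in>J. \<forall>q<d j. x j $ q = 0" by auto
  then show "\<forall>j\<in>J. \<forall>q<d j. c j q = 0" by (simp add: x_def)
qed

lemma splitting_one_summand:
  assumes s: "splitting n J d X R" and j: "j \<in> J"
    and z: "\<And>j'. j' \<in> J \<Longrightarrow> j' \<noteq> j \<Longrightarrow> d j' = 0" and v: "v \<in> carrier_vec n"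
  shows "X j *\<^sub>v (R j *\<^sub>v v) = v"
proof -
  have c: "X j *\<^sub>v (R j *\<^sub>v v) \<in> carrier_vec n"
    using splittingD(2,3)[OF s j] v by auto
  have "X j' *\<^sub>v (R j' *\<^sub>v v) = 0\<^sub>v n" if "j' \<in> J" "j' \<notin> {j}" for j'
    using splittingD(2,3)[OF s that(1)] z[of j'] that v by (intro mult_mat_vec_empty) auto
  then have "vsum n (\<lambda>j. X j *\<^sub>v (R j *\<^sub>v v)) J = vsum n (\<lambda>j. X j *\<^sub>v (R j *\<^sub>v v)) {j}"
    using splittingD(1)[OF s] j by (intro vsum_supported) auto
  then have "v = vsum n (\<lambda>j. X j *\<^sub>v (R j *\<^sub>v v)) {j}" using splittingD(5)[OF s v] by simp
  also have "\<dots> = X j *\<^sub>v (R j *\<^sub>v v)" using c by (rule vsum_singleton)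
  finally show ?thesis by simp
qed

lemma splitting_two_summands:
  assumes s: "splitting n J d X R" and j: "j1 \<in> J" "j2 \<in> J" "j1 \<noteq> j2"
    and z: "\<And>j. j \<in> J \<Longrightarrow> j \<noteq> j1 \<Longrightarrow> j \<noteq> j2 \<Longrightarrow> d j = 0" and v: "v \<in> carrier_vec n"
  shows "X j2 *\<^sub>v (R j2 *\<^sub>v v) = v - X j1 *\<^sub>v (R j1 *\<^sub>v v)"
proof -
  have c: "X j *\<^sub>v (R j *\<^sub>v v) \<in> carrier_vec n" if "j \<in> J" for j
    using splittingD(2,3)[OF s that] v by auto
  have "X j *\<^sub>v (R j *\<^sub>v v) = 0\<^sub>v n" if "j \<in> J" "j \<notin> {j1, j2}" for j
    using splittingD(2,3)[OF s that(1)] z[of j] that v by (intro mult_mat_vec_empty) auto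
  then have "vsum n (\<lambda>j. X j *\<^sub>v (R j *\<^sub>v v)) J = vsum n (\<lambda>j. X j *\<^sub>v (R j *\<^sub>v v)) {j1, j2}"
    using splittingD(1)[OF s] j by (intro vsum_supported) auto
  then have e: "v = vsum n (\<lambda>j. X j *\<^sub>v (R j *\<^sub>v v)) {j1, j2}" using splittingD(5)[OF s v] by simp
  have "v $ p = (X j1 *\<^sub>v (R j1 *\<^sub>v v)) $ p + (X j2 *\<^sub>v (R j2 *\<^sub>v v)) $ p" if "p < n" for p
  proof -
    have "v $ p = (\<Sum>j\<in>{j1, j2}. (X j *\<^sub>v (R j *\<^sub>v v)) $ p)"
      using arg_cong[OF e, of "\<lambda>v. v $ p"] that by (simp only: vsum_index)
    then show ?thesis using j(3) by simp
  qed
  moreover have "y2 = v - y1" if "y1 \<in> carrier_vec n" "y2 \<in> carrier_vec n" "\<And>p. p < n \<Longrightarrow> v $ p = y1 $ p + y2 $ p" for y1 y2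
    using that v by (intro eq_vecI) auto
  ultimately show ?thesis using c[OF j(1)] c[OF j(2)] by blast
qed

lemma vec_subspace_preimage:
  assumes "X \<in> carrier_mat n l" "vec_subspace n W"
  shows "vec_subspace l {x \<in> carrier_vec l. X *\<^sub>v x \<in> W}"
  using assms unfolding vec_subspace_iff
  by (auto simp: mult_add_distrib_mat_vec mult_mat_vec mult_mat_vec_zero)

text \<open>Bases of the \<open>U j\<close> are mapped to independent vectors of \<open>W\<close>, since the \<open>R j\<close> recover their
  coefficients.  In case of equality these vectors span \<open>W\<close>, so that \<open>W\<close> is the sum of the
  images of the \<open>U j\<close>.\<close>

lemma sum_dim_le_dim_target:
  assumes s: "splitting n J d X R" and W: "vec_subspace n W"
    and U: "\<And>j. j \<in> J \<Longrightarrow> vec_subspace (d j) (U j)" and XU: "\<And>j x. j \<in> J \<Longrightarrow> x \<in> U j \<Longrightarrow> X j *\<^sub>v x \<in> W"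
  shows "(\<Sum>j\<in>J. vec_subspace_dim (d j) (U j)) \<le> vec_subspace_dim n W" (is ?le)
    and "(\<Sum>j\<in>J. vec_subspace_dim (d j) (U j)) = vec_subspace_dim n W \<Longrightarrow> j \<in> J \<Longrightarrow> w \<in> W \<Longrightarrow> R j *\<^sub>v w \<in> U j"
      (is "?eq \<Longrightarrow> _ \<Longrightarrow> _ \<Longrightarrow> _")
proof -
  have fin: "finite J" by (rule splittingD[OF s])
  have "\<forall>j\<in>J. \<exists>Q. pivot_basis (d j) (U j) (fst Q) (snd Q)" using pivot_basis_exists[OF U] by fastforce
  from bchoice[OF this] obtain Q where Q: "\<forall>j\<in>J. pivot_basis (d j) (U j) (fst (Q j)) (snd (Q j))" ..
  define K where "K j = fst (Q j)" for j
  define u where "u j = snd (Q j)" for j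
  have p: "pivot_basis (d j) (U j) (K j) (u j)" if "j \<in> J" for j using Q that by (simp add: K_def u_def)
  have fK: "finite (K j)" if "j \<in> J" for j by (rule pivot_basis_finite[OF p[OF that]])
  let ?S = "SIGMA j:J. K j"
  define v where "v = (\<lambda>(j, q). X j *\<^sub>v u j q)"
  have fS: "finite ?S" using fin fK by auto
  have card: "card ?S = (\<Sum>j\<in>J. vec_subspace_dim (d j) (U j))"
    using fin fK vec_subspace_dim_eq_card[OF U p] by simp
  have uU: "u j q \<in> U j" if "j \<in> J" "q \<in> K j" for j q using p that by (auto simp: pivot_basis_def)
  then have uc: "u j q \<in> carrier_vec (d j)" if "j \<in> J" "q \<in> K j" for j q
    using vec_subspace_carrier[OF U] that by blast
  have v: "v t \<in> W" if "t \<in> ?S" for t using that XU uU by (auto simp: v_def)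
  have vc: "v t \<in> carrier_vec n" if "t \<in> ?S" for t using vec_subspace_carrier[OF W v[OF that]] .
  have Rv: "R j *\<^sub>v vsum n (\<lambda>t. c t \<cdot>\<^sub>v v t) ?S = vsum (d j) (\<lambda>q. c (j, q) \<cdot>\<^sub>v u j q) (K j)"
    if j: "j \<in> J" for j c
  proof -
    have "R j *\<^sub>v vsum n (\<lambda>t. c t \<cdot>\<^sub>v v t) ?S = vsum (d j) (\<lambda>t. c t \<cdot>\<^sub>v (R j *\<^sub>v v t)) ?S"
      using vc by (intro mult_mat_vec_lincomb[OF splittingD(3)[OF s j]])
    also have "\<dots> = vsum (d j) (\<lambda>q. c (j, q) \<cdot>\<^sub>v u j q) (K j)"
    proof (rule eq_vecI)
      fix b assume "b < dim_vec (vsum (d j) (\<lambda>q. c (j, q) \<cdot>\<^sub>v u j q) (K j))"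
      then have b: "b < d j" by simp
      have "(\<Sum>t\<in>?S. (c t \<cdot>\<^sub>v (R j *\<^sub>v v t)) $ b) = (\<Sum>j'\<in>J. \<Sum>q\<in>K j'. (c (j', q) \<cdot>\<^sub>v (R j *\<^sub>v v (j', q))) $ b)"
        using fin fK by (simp add: sum.Sigma)
      also have "\<dots> = (\<Sum>j'\<in>J. if j' = j then \<Sum>q\<in>K j. (c (j, q) \<cdot>\<^sub>v u j q) $ b else 0)"
      proof (rule sum.cong)
        fix j' assume j': "j' \<in> J"
        have "R j *\<^sub>v v (j', q) = (if j = j' then u j' q else 0\<^sub>v (d j))" if "q \<in> K j'" for q
          using splittingD(4)[OF s j j' uc[OF j' that]] by (simp add: v_def)
        then show "(\<Sum>q\<in>K j'. (c (j', q) \<cdot>\<^sub>v (R j *\<^sub>v v (j', q))) $ b) =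
            (if j' = j then \<Sum>q\<in>K j. (c (j, q) \<cdot>\<^sub>v u j q) $ b else 0)"
          using b by (auto intro!: sum.cong)
      qed simp
      also have "\<dots> = (\<Sum>q\<in>K j. (c (j, q) \<cdot>\<^sub>v u j q) $ b)" using fin j by simp
      finally show "vsum (d j) (\<lambda>t. c t \<cdot>\<^sub>v (R j *\<^sub>v v t)) ?S $ b = vsum (d j) (\<lambda>q. c (j, q) \<cdot>\<^sub>v u j q) (K j) $ b"
        using b by simp
    qed simp
    finally show ?thesis .
  qed
  have ind: "\<forall>t\<in>?S. c t = 0" if z: "vsum n (\<lambda>t. c t \<cdot>\<^sub>v v t) ?S = 0\<^sub>v n" for c
  proof -
    have "c (j, q) = 0" if "j \<in> J" "q \<in> K j" for j q
    proof -
      have "R j *\<^sub>v 0\<^sub>v n = 0\<^sub>v (d j)" using splittingD(3)[OF s that(1)] by (intro eq_vecI) auto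
      then have "vsum (d j) (\<lambda>q. c (j, q) \<cdot>\<^sub>v u j q) (K j) = 0\<^sub>v (d j)"
        using Rv[OF that(1), of c] z by simp
      from pivot_basis_independent[OF U[OF that(1)] p[OF that(1)] this] show ?thesis using that(2) by simp
    qed
    then show ?thesis by auto
  qed
  show ?le unfolding card[symmetric] by (rule card_independent_le_dim[OF W fS v ind])
  assume ?eq and j: "j \<in> J" and w: "w \<in> W"
  then have "card ?S = vec_subspace_dim n W" using card by simp
  from independent_card_eq_dim_spans[OF W fS v ind this w]
  obtain c where "w = vsum n (\<lambda>t. c t \<cdot>\<^sub>v v t) ?S" ..
  then have "R j *\<^sub>v w = vsum (d j) (\<lambda>q. c (j, q) \<cdot>\<^sub>v u j q) (K j)" using Rv[OF j] by simp
  then show "R j *\<^sub>v w \<in> U j" using uU j by (auto intro!: vec_subspace_vsum[OF U] vec_subspace_smult[OF U])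
qed

text \<open>An invariant \<open>W\<close> is spanned by its components \<open>X j *\<^sub>v (R j *\<^sub>v w)\<close>, which lie in the images of the
  preimages of \<open>W\<close>.\<close>

lemma sum_dim_preimages_of_invariant:
  assumes s: "splitting n J d X R" and W: "vec_subspace n W"
    and inv: "\<And>j w. j \<in> J \<Longrightarrow> w \<in> W \<Longrightarrow> X j *\<^sub>v (R j *\<^sub>v w) \<in> W"
  shows "(\<Sum>j\<in>J. vec_subspace_dim (d j) {x \<in> carrier_vec (d j). X j *\<^sub>v x \<in> W}) = vec_subspace_dim n W"
proof (rule antisym)
  define U where "U j = {x \<in> carrier_vec (d j). X j *\<^sub>v x \<in> W}" for j
  have U: "vec_subspace (d j) (U j)" if "j \<in> J" for j
    unfolding U_def by (rule vec_subspace_preimage[OF splittingD(2)[OF s that] W])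
  have fin: "finite J" by (rule splittingD[OF s])
  show "(\<Sum>j\<in>J. vec_subspace_dim (d j) (U j)) \<le> vec_subspace_dim n W"
    by (rule sum_dim_le_dim_target(1)[OF s W U]) (auto simp: U_def)
  have "\<forall>j\<in>J. \<exists>Q. pivot_basis (d j) (U j) (fst Q) (snd Q)" using pivot_basis_exists[OF U] by fastforce
  from bchoice[OF this] obtain Q where Q: "\<forall>j\<in>J. pivot_basis (d j) (U j) (fst (Q j)) (snd (Q j))" ..
  define K where "K j = fst (Q j)" for j
  define u where "u j = snd (Q j)" for j
  have p: "pivot_basis (d j) (U j) (K j) (u j)" if "j \<in> J" for j using Q that by (simp add: K_def u_def)
  have fK: "finite (K j)" if "j \<in> J" for j by (rule pivot_basis_finite[OF p[OF that]])
  let ?S = "SIGMA j:J. K j"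
  define v where "v = (\<lambda>(j, q). X j *\<^sub>v u j q)"
  have fS: "finite ?S" using fin fK by auto
  have card: "card ?S = (\<Sum>j\<in>J. vec_subspace_dim (d j) (U j))"
    using fin fK vec_subspace_dim_eq_card[OF U p] by simp
  have uc: "u j q \<in> carrier_vec (d j)" if "j \<in> J" "q \<in> K j" for j q
    using vec_subspace_carrier[OF U] p that by (auto simp: pivot_basis_def)
  have vc: "v t \<in> carrier_vec n" if "t \<in> ?S" for t
    using that splittingD(2)[OF s] uc by (auto simp: v_def intro!: mult_mat_vec_carrier)
  show "vec_subspace_dim n W \<le> (\<Sum>j\<in>J. vec_subspace_dim (d j) (U j))"
    unfolding card[symmetric]
  proof (rule dim_le_card_spanning[OF W fS vc])
    fix w assume w: "w \<in> W"
    then have wc: "w \<in> carrier_vec n" using vec_subspace_carrier[OF W] by blast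
    have RU: "R j *\<^sub>v w \<in> U j" if "j \<in> J" for j
      using inv[OF that w] splittingD(3)[OF s that] wc by (auto simp: U_def intro!: mult_mat_vec_carrier)
    have "X j *\<^sub>v (R j *\<^sub>v w) = vsum n (\<lambda>q. (R j *\<^sub>v w) $ q \<cdot>\<^sub>v v (j, q)) (K j)" if j: "j \<in> J" for j
    proof -
      have "X j *\<^sub>v vsum (d j) (\<lambda>q. (R j *\<^sub>v w) $ q \<cdot>\<^sub>v u j q) (K j)
          = vsum n (\<lambda>q. (R j *\<^sub>v w) $ q \<cdot>\<^sub>v (X j *\<^sub>v u j q)) (K j)"
        by (rule mult_mat_vec_lincomb[OF splittingD(2)[OF s j] uc[OF j]])
      then show ?thesis using pivot_basis_expand[OF U[OF j] p[OF j] RU[OF j]] by (simp add: v_def)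
    qed
    then have "w = vsum n (\<lambda>j. vsum n (\<lambda>q. (R j *\<^sub>v w) $ q \<cdot>\<^sub>v v (j, q)) (K j)) J"
      using splittingD(5)[OF s wc] by (simp cong: vsum_cong)
    also have "\<dots> = vsum n (\<lambda>t. (R (fst t) *\<^sub>v w) $ snd t \<cdot>\<^sub>v v t) ?S"
      using fin fK by (intro eq_vecI) (simp_all add: sum.Sigma case_prod_unfold)
    finally show "\<exists>c. w = vsum n (\<lambda>t. c t \<cdot>\<^sub>v v t) ?S"
      by (intro exI[of _ "\<lambda>t. (R (fst t) *\<^sub>v w) $ snd t"])
  qed
qed

section \<open>Stability and irreducibility on the star quiver\<close>

lemma star_quiver_simps [simp]:
  "verts (star_quiver m r) = insert Sink {Source i j | i j. i \<in> {1..m} \<and> j \<in> {1..r i}}"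
  "arcs (star_quiver m r) = (SIGMA i:{1..m}. {1..r i})"
  "tail (star_quiver m r) (i, j) = Source i j"
  "head (star_quiver m r) \<alpha> = Sink"
  by (auto simp: star_quiver_def)

lemma quiver_rep_star_carrier:
  "X \<in> quiver_rep (star_quiver m r) d \<Longrightarrow> i \<in> {1..m} \<Longrightarrow> j \<in> {1..r i} \<Longrightarrow>
    X (i, j) \<in> carrier_mat (d Sink) (d (Source i j))"
  unfolding quiver_rep_def by (drule PiE_mem[of _ _ _ "(i, j)"]) auto

lemma weight_sum_star:
  "weight_sum (star_quiver m r) (star_weight m) f =
     (\<Sum>i=1..m. \<Sum>j=1..r i. int (f (Source i j))) - int m * int (f Sink)"
proof -
  let ?A = "SIGMA i:{1..m}. {1..r i}"
  have eq: "{Source i j | i j. i \<in> {1..m} \<and> j \<in> {1..r i}} = (\<lambda>(i, j). Source i j) ` ?A" by auto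
  have inj: "inj_on (\<lambda>(i, j). Source i j) ?A" by (auto simp: inj_on_def)
  have "weight_sum (star_quiver m r) (star_weight m) f =
      star_weight m Sink * int (f Sink) + (\<Sum>v\<in>(\<lambda>(i, j). Source i j) ` ?A. star_weight m v * int (f v))"
    unfolding weight_sum_def star_quiver_simps eq by (subst sum.insert) auto
  also have "(\<Sum>v\<in>(\<lambda>(i, j). Source i j) ` ?A. star_weight m v * int (f v)) = (\<Sum>(i, j)\<in>?A. int (f (Source i j)))"
    unfolding sum.reindex[OF inj] by (intro sum.cong) (auto simp: star_weight_def)
  also have "\<dots> = (\<Sum>i=1..m. \<Sum>j=1..r i. int (f (Source i j)))" by (simp add: sum.Sigma)
  moreover have "star_weight m Sink = - int m" by (simp add: star_weight_def)
  ultimately show ?thesis by simp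
qed

definition star_splitting ::
  "nat \<Rightarrow> (nat \<Rightarrow> nat) \<Rightarrow> (star_vertex \<Rightarrow> nat) \<Rightarrow> (nat \<times> nat \<Rightarrow> 'k::field mat) \<Rightarrow> (nat \<times> nat \<Rightarrow> 'k mat) \<Rightarrow> bool" where
  "star_splitting m r d X R \<longleftrightarrow> (\<forall>i\<in>{1..m}.
     splitting (d Sink) {1..r i} (\<lambda>j. d (Source i j)) (\<lambda>j. X (i, j)) (\<lambda>j. R (i, j)))"

lemma star_splittingD: "star_splitting m r d X R \<Longrightarrow> i \<in> {1..m} \<Longrightarrow>
   splitting (d Sink) {1..r i} (\<lambda>j. d (Source i j)) (\<lambda>j. X (i, j)) (\<lambda>j. R (i, j))"
  by (simp add: star_splitting_def)

lemma star_splitting_exists: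
  assumes "\<And>i. i \<in> {1..m} \<Longrightarrow> \<exists>R. splitting (d Sink) {1..r i} (\<lambda>j. d (Source i j)) (\<lambda>j. X (i, j)) R"
  shows "\<exists>R. star_splitting m r d X R"
proof -
  have "\<forall>i\<in>{1..m}. \<exists>R. splitting (d Sink) {1..r i} (\<lambda>j. d (Source i j)) (\<lambda>j. X (i, j)) R" using assms by blast
  from bchoice[OF this] obtain R where
    "\<forall>i\<in>{1..m}. splitting (d Sink) {1..r i} (\<lambda>j. d (Source i j)) (\<lambda>j. X (i, j)) (R i)" ..
  then have "star_splitting m r d X (\<lambda>(i, j). R i j)" by (simp add: star_splitting_def)
  then show ?thesis by (intro exI[of _ "\<lambda>(i, j). R i j"])
qed

text \<open>The whole space is invariant, so its dimension is the sum of the dimensions of the summands.\<close>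

lemma star_splitting_balanced:
  fixes X :: "nat \<times> nat \<Rightarrow> 'k::field mat"
  assumes s: "star_splitting m r d X R"
  shows "balanced m r d"
  unfolding balanced_def
proof
  fix i assume i: "i \<in> {1..m}"
  have sp: "splitting (d Sink) {1..r i} (\<lambda>j. d (Source i j)) (\<lambda>j. X (i, j)) (\<lambda>j. R (i, j))"
    by (rule star_splittingD[OF s i])
  let ?V = "carrier_vec (d Sink) :: 'k vec set"
  have "(\<Sum>j=1..r i. vec_subspace_dim (d (Source i j)) {x \<in> carrier_vec (d (Source i j)). X (i, j) *\<^sub>v x \<in> ?V})
      = vec_subspace_dim (d Sink) ?V"
  proof (rule sum_dim_preimages_of_invariant[OF sp vec_subspace_trivial(2)])
    fix j w assume "j \<in> {1..r i}"
    then show "X (i, j) *\<^sub>v (R (i, j) *\<^sub>v w) \<in> ?V" if "w \<in> ?V" 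
      using splittingD(2,3)[OF sp] that by (meson mult_mat_vec_carrier)
  qed
  moreover have "{x \<in> carrier_vec (d (Source i j)). X (i, j) *\<^sub>v x \<in> ?V} = carrier_vec (d (Source i j))"
    if "j \<in> {1..r i}" for j
    using splittingD(2)[OF sp that] by auto
  ultimately show "(\<Sum>j=1..r i. d (Source i j)) = d Sink" by (simp add: dim_carrier_vec)
qed

lemma invertible_reps_iff:
  fixes X :: "nat \<times> nat \<Rightarrow> 'k::field mat"
  shows "X \<in> invertible_reps m r d \<longleftrightarrow>
    X \<in> quiver_rep (star_quiver m r) d \<and> (\<exists>R. star_splitting m r d X R)"
proof -
  have "bij_betw (\<lambda>x. finsum_vec TYPE('k) (d Sink) (\<lambda>j. X (i, j) *\<^sub>v x j) {1..r i})
          (\<Pi>\<^sub>E j\<in>{1..r i}. carrier_vec (d (Source i j))) (carrier_vec (d Sink)) \<longleftrightarrow>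
     (\<exists>R. splitting (d Sink) {1..r i} (\<lambda>j. d (Source i j)) (\<lambda>j. X (i, j)) R)"
    if "X \<in> quiver_rep (star_quiver m r) d" "i \<in> {1..m}" for i
    using quiver_rep_star_carrier[OF that] by (intro bij_betw_iff_splitting) auto
  moreover have "(\<exists>R. star_splitting m r d X R) \<longleftrightarrow>
     (\<forall>i\<in>{1..m}. \<exists>R. splitting (d Sink) {1..r i} (\<lambda>j. d (Source i j)) (\<lambda>j. X (i, j)) R)"
    using star_splitting_exists[of m d r X] star_splittingD[of m r d X] by blast
  ultimately show ?thesis by (auto simp: invertible_reps_def)
qed

text \<open>The subspaces of the space at the sink that are compatible with all decompositions are those
  which are invariant under the projections \<open>X (i, j) * R (i, j)\<close>.\<close>

definition irreducible_star ::
  "nat \<Rightarrow> (nat \<Rightarrow> nat) \<Rightarrow> (star_vertex \<Rightarrow> nat) \<Rightarrow> (nat \<times> nat \<Rightarrow> 'k::field mat) \<Rightarrow> (nat \<times> nat \<Rightarrow> 'k mat) \<Rightarrow> bool" where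
  "irreducible_star m r d X R \<longleftrightarrow> (\<forall>W. vec_subspace (d Sink) W \<and>
     (\<forall>i\<in>{1..m}. \<forall>j\<in>{1..r i}. \<forall>w\<in>W. X (i, j) *\<^sub>v (R (i, j) *\<^sub>v w) \<in> W) \<longrightarrow>
       W = {0\<^sub>v (d Sink)} \<or> W = carrier_vec (d Sink))"

text \<open>The weight of a subrepresentation is the sum over \<open>i\<close> of
  \<open>\<Sum>\<^sub>j dim U (Source i j) - dim U Sink\<close>.  Each term is at most zero.  If all of them vanish, then
  \<open>U Sink\<close> is invariant, hence zero or everything, and then so are the spaces at the sources.\<close>

theorem irreducible_imp_stable:
  assumes X: "X \<in> quiver_rep (star_quiver m r) d" and s: "star_splitting m r d X R"
    and irr: "irreducible_star m r d X R" and bal: "balanced m r d" and n: "d Sink \<ge> 1"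
  shows "stable_rep (star_quiver m r) (star_weight m) d X"
  unfolding stable_rep_def
proof (intro conjI allI impI)
  show "\<exists>v\<in>verts (star_quiver m r). d v \<noteq> 0" using n by auto
  have dn: "(\<Sum>j=1..r i. int (d (Source i j))) = int (d Sink)" if "i \<in> {1..m}" for i
    using bal that unfolding balanced_def by (metis of_nat_sum)
  then show "weight_sum (star_quiver m r) (star_weight m) d = 0" by (simp add: weight_sum_star)
  fix U assume "quiver_subrep (star_quiver m r) d X U \<and> (\<exists>v\<in>verts (star_quiver m r). U v \<noteq> {0\<^sub>v (d v)}) \<and>
     (\<exists>v\<in>verts (star_quiver m r). U v \<noteq> carrier_vec (d v))"
  then have sub: "quiver_subrep (star_quiver m r) d X U"
    and nz: "\<exists>v\<in>verts (star_quiver m r). U v \<noteq> {0\<^sub>v (d v)}"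
    and pr: "\<exists>v\<in>verts (star_quiver m r). U v \<noteq> carrier_vec (d v)" by auto
  define f where "f v = vec_subspace_dim (d v) (U v)" for v
  have W: "vec_subspace (d Sink) (U Sink)" using sub by (auto simp: quiver_subrep_def)
  have Us: "vec_subspace (d (Source i j)) (U (Source i j))" if "i \<in> {1..m}" "j \<in> {1..r i}" for i j
    using sub that by (auto simp: quiver_subrep_def)
  have XU: "X (i, j) *\<^sub>v x \<in> U Sink" if "i \<in> {1..m}" "j \<in> {1..r i}" "x \<in> U (Source i j)" for i j x
    using sub that unfolding quiver_subrep_def by force
  have le: "(\<Sum>j=1..r i. f (Source i j)) \<le> f Sink" if "i \<in> {1..m}" for i
    unfolding f_def using that by (intro sum_dim_le_dim_target(1)[OF star_splittingD[OF s] W] Us XU)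
  have mul: "int m * int (f Sink) = (\<Sum>i=1..m. int (f Sink))" by simp
  have lei: "(\<Sum>j=1..r i. int (f (Source i j))) \<le> int (f Sink)" if "i \<in> {1..m}" for i
    using le[OF that] by (metis of_nat_le_iff of_nat_sum)
  show "weight_sum (star_quiver m r) (star_weight m) (\<lambda>v. vec_subspace_dim (d v) (U v)) < 0"
  proof (rule ccontr)
    assume "\<not> ?thesis"
    then have ge: "(\<Sum>i=1..m. int (f Sink)) \<le> (\<Sum>i=1..m. \<Sum>j=1..r i. int (f (Source i j)))"
      using mul unfolding weight_sum_star f_def by linarith
    have eqi: "(\<Sum>j=1..r i. int (f (Source i j))) = int (f Sink)" if i: "i \<in> {1..m}" for i
    proof (rule ccontr)
      assume "\<not> ?thesis"
      then have "(\<Sum>j=1..r i. int (f (Source i j))) < int (f Sink)" using lei[OF i] by linarith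
      then have "(\<Sum>i=1..m. \<Sum>j=1..r i. int (f (Source i j))) < (\<Sum>i=1..m. int (f Sink))"
        using lei i by (intro sum_strict_mono_ex1) auto
      then show False using ge by linarith
    qed
    then have eq: "(\<Sum>j=1..r i. f (Source i j)) = f Sink" if "i \<in> {1..m}" for i
      using that by (metis of_nat_eq_iff of_nat_sum)
    have RW: "R (i, j) *\<^sub>v w \<in> U (Source i j)" if ij: "i \<in> {1..m}" "j \<in> {1..r i}" and w: "w \<in> U Sink" for i j w
      using sum_dim_le_dim_target(2)[OF star_splittingD[OF s ij(1)] W Us[OF ij(1)] XU[OF ij(1)] eq[OF ij(1), unfolded f_def] ij(2) w] .
    have "U Sink = {0\<^sub>v (d Sink)} \<or> U Sink = carrier_vec (d Sink)"
      using irr W XU RW unfolding irreducible_star_def by blast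
    then show False
    proof
      assume "U Sink = {0\<^sub>v (d Sink)}"
      then have f0: "f Sink = 0" by (simp add: f_def dim_zero_vec)
      have "U (Source i j) = {0\<^sub>v (d (Source i j))}" if ij: "i \<in> {1..m}" "j \<in> {1..r i}" for i j
      proof -
        have "f (Source i j) = 0" using eq[OF ij(1)] f0 ij(2) by simp
        then show ?thesis using dim_eq_0_iff[OF Us[OF ij]] by (simp add: f_def)
      qed
      then show False using nz \<open>U Sink = {0\<^sub>v (d Sink)}\<close> by auto
    next
      assume full: "U Sink = carrier_vec (d Sink)"
      then have f1: "f Sink = d Sink" by (simp add: f_def dim_carrier_vec)
      have "U (Source i j) = carrier_vec (d (Source i j))" if ij: "i \<in> {1..m}" "j \<in> {1..r i}" for i j
      proof -
        have "f (Source i j) = d (Source i j)"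
        proof (rule ccontr)
          have fd: "f (Source i j) \<le> d (Source i j)" if "j \<in> {1..r i}" for j
            unfolding f_def by (rule dim_le[OF Us[OF ij(1) that]])
          assume "f (Source i j) \<noteq> d (Source i j)"
          then have "f (Source i j) < d (Source i j)" using fd[OF ij(2)] by simp
          then have "(\<Sum>j=1..r i. f (Source i j)) < (\<Sum>j=1..r i. d (Source i j))"
            using fd ij(2) by (intro sum_strict_mono_ex1) auto
          then show False using eq[OF ij(1)] f1 bal ij(1) by (simp add: balanced_def)
        qed
        then show ?thesis using dim_eq_n_iff[OF Us[OF ij]] by (simp add: f_def)
      qed
      then show False using pr full by auto
    qed
  qed
qed (use X in simp)

text \<open>The form in which stability is used: it is enough to give a proper subspace at the sink and
  subspaces at the sources.\<close>

lemma stable_sum_dim_less: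
  assumes st: "stable_rep (star_quiver m r) (star_weight m) d X"
    and W: "vec_subspace (d Sink) W" "W \<noteq> carrier_vec (d Sink)"
    and U: "\<And>i j. i \<in> {1..m} \<Longrightarrow> j \<in> {1..r i} \<Longrightarrow> vec_subspace (d (Source i j)) (U i j)"
    and XU: "\<And>i j x. i \<in> {1..m} \<Longrightarrow> j \<in> {1..r i} \<Longrightarrow> x \<in> U i j \<Longrightarrow> X (i, j) *\<^sub>v x \<in> W"
    and nz: "W \<noteq> {0\<^sub>v (d Sink)} \<or> (\<exists>i\<in>{1..m}. \<exists>j\<in>{1..r i}. U i j \<noteq> {0\<^sub>v (d (Source i j))})"
  shows "(\<Sum>i=1..m. \<Sum>j=1..r i. vec_subspace_dim (d (Source i j)) (U i j)) < m * vec_subspace_dim (d Sink) W"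
proof -
  define U' where "U' v = (case v of Sink \<Rightarrow> W | Source i j \<Rightarrow> U i j)" for v
  have "quiver_subrep (star_quiver m r) d X U'"
    using W(1) U XU by (auto simp: quiver_subrep_def U'_def)
  moreover have "\<exists>v\<in>verts (star_quiver m r). U' v \<noteq> {0\<^sub>v (d v)}" 
  proof (cases "W = {0\<^sub>v (d Sink)}")
    case True
    then obtain i j where "i \<in> {1..m}" "j \<in> {1..r i}" "U i j \<noteq> {0\<^sub>v (d (Source i j))}" using nz by blast
    then show ?thesis by (intro bexI[of _ "Source i j"]) (auto simp: U'_def)
  qed (auto simp: U'_def)
  moreover have "\<exists>v\<in>verts (star_quiver m r). U' v \<noteq> carrier_vec (d v)"
    using W(2) by (auto simp: U'_def)
  ultimately have "weight_sum (star_quiver m r) (star_weight m) (\<lambda>v. vec_subspace_dim (d v) (U' v)) < 0"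
    using st unfolding stable_rep_def by blast
  then have "int (\<Sum>i=1..m. \<Sum>j=1..r i. vec_subspace_dim (d (Source i j)) (U i j)) <
      int (m * vec_subspace_dim (d Sink) W)"
    by (simp add: weight_sum_star U'_def)
  then show ?thesis by (simp only: of_nat_less_iff)
qed

text \<open>An invariant subspace and its preimages at the sources form a subrepresentation of weight zero.\<close>

lemma stable_imp_irreducible:
  assumes st: "stable_rep (star_quiver m r) (star_weight m) d X" and s: "star_splitting m r d X R"
  shows "irreducible_star m r d X R"
  unfolding irreducible_star_def
proof (intro allI impI)
  fix W assume a: "vec_subspace (d Sink) W \<and>
     (\<forall>i\<in>{1..m}. \<forall>j\<in>{1..r i}. \<forall>w\<in>W. X (i, j) *\<^sub>v (R (i, j) *\<^sub>v w) \<in> W)"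
  show "W = {0\<^sub>v (d Sink)} \<or> W = carrier_vec (d Sink)"
  proof (rule ccontr)
    assume no: "\<not> ?thesis"
    define U where "U i j = {x \<in> carrier_vec (d (Source i j)). X (i, j) *\<^sub>v x \<in> W}" for i j
    have X: "X (i, j) \<in> carrier_mat (d Sink) (d (Source i j))" if "i \<in> {1..m}" "j \<in> {1..r i}" for i j
      using splittingD(2)[OF star_splittingD[OF s that(1)] that(2)] .
    have "(\<Sum>i=1..m. \<Sum>j=1..r i. vec_subspace_dim (d (Source i j)) (U i j)) < m * vec_subspace_dim (d Sink) W"
      using a no X by (intro stable_sum_dim_less[OF st]) (auto simp: U_def intro!: vec_subspace_preimage)
    moreover have "(\<Sum>j=1..r i. vec_subspace_dim (d (Source i j)) (U i j)) = vec_subspace_dim (d Sink) W"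
      if "i \<in> {1..m}" for i
      unfolding U_def using a that by (intro sum_dim_preimages_of_invariant[OF star_splittingD[OF s]]) auto
    ultimately show False by simp
  qed
qed

section \<open>The largest eigenspaces of a stable representation\<close>

text \<open>A line in the kernel of \<open>X (i, j)\<close>, with zero at all other vertices, has weight \<open>1\<close>.\<close>

lemma stable_injective:
  fixes X :: "nat \<times> nat \<Rightarrow> 'k::field mat"
  assumes st: "stable_rep (star_quiver m r) (star_weight m) d X" and n: "d Sink \<ge> 1"
    and ij: "i \<in> {1..m}" "j \<in> {1..r i}" and x: "x \<in> carrier_vec (d (Source i j))"
    and z: "X (i, j) *\<^sub>v x = 0\<^sub>v (d Sink)"
  shows "x = 0\<^sub>v (d (Source i j))"
proof (rule ccontr)
  assume no: "\<not> ?thesis"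
  have X: "X (i, j) \<in> carrier_mat (d Sink) (d (Source i j))" if "i \<in> {1..m}" "j \<in> {1..r i}" for i j
    using st that by (auto simp: stable_rep_def intro: quiver_rep_star_carrier)
  define U where "U a b = (if (a, b) = (i, j) then range (\<lambda>c. c \<cdot>\<^sub>v x) else {0\<^sub>v (d (Source a b))})" for a b
  let ?W = "{0\<^sub>v (d Sink) :: 'k vec}"
  have "(\<Sum>a=1..m. \<Sum>b=1..r a. vec_subspace_dim (d (Source a b)) (U a b)) < m * vec_subspace_dim (d Sink) ?W"
  proof (rule stable_sum_dim_less[OF st vec_subspace_trivial(1)])
    have "unit_vec (d Sink) 0 \<noteq> 0\<^sub>v (d Sink)" using n by simp
    then show "?W \<noteq> carrier_vec (d Sink)" using unit_vec_carrier by blast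
    show "vec_subspace (d (Source a b)) (U a b)" for a b
      using vec_subspace_line[OF x] vec_subspace_trivial by (auto simp: U_def)
    show "X (a, b) *\<^sub>v y \<in> ?W" if "a \<in> {1..m}" "b \<in> {1..r a}" "y \<in> U a b" for a b y
      using that mult_mat_vec_zero[OF X[OF that(1,2)]] z mult_mat_vec[OF X[OF ij] x]
      by (auto simp: U_def split: if_splits)
    have "x = 1 \<cdot>\<^sub>v x" by simp
    then have "x \<in> range (\<lambda>c. c \<cdot>\<^sub>v x)" by (rule range_eqI)
    then have "x \<in> U i j" by (simp add: U_def)
    then have "U i j \<noteq> {0\<^sub>v (d (Source i j))}" using no by auto
    then show "?W \<noteq> ?W \<or> (\<exists>i\<in>{1..m}. \<exists>j\<in>{1..r i}. U i j \<noteq> {0\<^sub>v (d (Source i j))})"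
      using ij by blast
  qed
  then show False by (simp add: dim_zero_vec)
qed

text \<open>A line in the space at the sink together with one line over it at each source in \<open>P\<close> has weight
  \<open>card P - m\<close>.\<close>

lemma stable_common_vector:
  fixes X :: "nat \<times> nat \<Rightarrow> 'k::field mat"
  assumes st: "stable_rep (star_quiver m r) (star_weight m) d X" and n: "d Sink \<ge> 2"
    and u: "u \<in> carrier_vec (d Sink)" "u \<noteq> 0\<^sub>v (d Sink)"
    and P: "P \<subseteq> (SIGMA i:{1..m}. {1..r i})"
    and x: "\<And>i j. (i, j) \<in> P \<Longrightarrow> x i j \<in> carrier_vec (d (Source i j)) \<and> X (i, j) *\<^sub>v x i j = u"
  shows "card P < m"
proof -
  have X: "X (i, j) \<in> carrier_mat (d Sink) (d (Source i j))" if "i \<in> {1..m}" "j \<in> {1..r i}" for i j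
    using st that by (auto simp: stable_rep_def intro: quiver_rep_star_carrier)
  define U where "U a b = (if (a, b) \<in> P then range (\<lambda>c. c \<cdot>\<^sub>v x a b) else {0\<^sub>v (d (Source a b))})" for a b
  let ?W = "range (\<lambda>c. c \<cdot>\<^sub>v u)"
  have W1: "vec_subspace_dim (d Sink) ?W = 1" by (rule dim_line[OF u])
  have "(\<Sum>a=1..m. \<Sum>b=1..r a. vec_subspace_dim (d (Source a b)) (U a b)) < m * vec_subspace_dim (d Sink) ?W"
  proof (rule stable_sum_dim_less[OF st vec_subspace_line[OF u(1)]])
    have "vec_subspace_dim (d Sink) (carrier_vec (d Sink) :: 'k vec set) = d Sink" by (rule dim_carrier_vec)
    then show "?W \<noteq> carrier_vec (d Sink)" using W1 n by auto
    show "vec_subspace (d (Source a b)) (U a b)" for a b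
      using vec_subspace_line x vec_subspace_trivial by (auto simp: U_def)
    show "X (a, b) *\<^sub>v y \<in> ?W" if "a \<in> {1..m}" "b \<in> {1..r a}" "y \<in> U a b" for a b y
    proof (cases "(a, b) \<in> P")
      case True
      then have "y \<in> range (\<lambda>c. c \<cdot>\<^sub>v x a b)" using that(3) by (simp only: U_def if_True)
      then obtain c where c: "y = c \<cdot>\<^sub>v x a b" by (rule rangeE)
      then have "X (a, b) *\<^sub>v y = c \<cdot>\<^sub>v u" using mult_mat_vec[OF X[OF that(1,2)]] x[OF True] by auto
      then show ?thesis by blast
    next
      case False
      then have "X (a, b) *\<^sub>v y = 0\<^sub>v (d Sink)" using that mult_mat_vec_zero[OF X[OF that(1,2)]] by (auto simp: U_def)
      moreover have "0\<^sub>v (d Sink) = 0 \<cdot>\<^sub>v u" using u by auto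
      ultimately show ?thesis by (metis rangeI)
    qed
    have "?W \<noteq> {0\<^sub>v (d Sink)}" using W1 dim_zero_vec by (metis zero_neq_one)
    then show "?W \<noteq> {0\<^sub>v (d Sink)} \<or> (\<exists>i\<in>{1..m}. \<exists>j\<in>{1..r i}. U i j \<noteq> {0\<^sub>v (d (Source i j))})" by blast
  qed
  moreover have "vec_subspace_dim (d (Source a b)) (U a b) = (if (a, b) \<in> P then 1 else 0)"
    if "a \<in> {1..m}" "b \<in> {1..r a}" for a b
  proof (cases "(a, b) \<in> P")
    case True
    have "x a b \<noteq> 0\<^sub>v (d (Source a b))"
      using x[OF True] u(2) mult_mat_vec_zero[OF X[OF that]] by metis
    then show ?thesis using True x[OF True] dim_line by (auto simp: U_def)
  qed (simp add: U_def dim_zero_vec)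
  then have "(\<Sum>a=1..m. \<Sum>b=1..r a. vec_subspace_dim (d (Source a b)) (U a b))
      = (\<Sum>a=1..m. \<Sum>b=1..r a. if (a, b) \<in> P then 1 else 0)"
    by (intro sum.cong) auto
  moreover have "\<dots> = (\<Sum>t\<in>(SIGMA i:{1..m}. {1..r i}). if t \<in> P then 1 else 0)"
    by (simp add: sum.Sigma case_prod_unfold)
  moreover have "\<dots> = card P" using P by (simp add: sum.If_cases Int_absorb1)
  ultimately show ?thesis using W1 by simp
qed

text \<open>If the sum is larger, then the homogeneous system
  \<open>X (i, c i) *\<^sub>v x i = X (1, c 1) *\<^sub>v x 1\<close> for \<open>i = 2, \<dots>, m\<close> has more unknowns than equations, and a
  non-trivial solution is a common vector of \<open>m\<close> images.\<close>

lemma stable_sum_of_chosen_le: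
  assumes st: "stable_rep (star_quiver m r) (star_weight m) d X" and n: "d Sink \<ge> 2" and m: "m \<ge> 1"
    and c: "\<And>i. i \<in> {1..m} \<Longrightarrow> c i \<in> {1..r i}"
  shows "(\<Sum>i=1..m. d (Source i (c i))) \<le> (m - 1) * d Sink"
proof (rule ccontr)
  assume no: "\<not> ?thesis"
  have X: "X (i, c i) \<in> carrier_mat (d Sink) (d (Source i (c i)))" if "i \<in> {1..m}" for i
    using st that c by (auto simp: stable_rep_def intro: quiver_rep_star_carrier)
  \<comment> \<open>The unknowns are the coordinates of all \<open>x i\<close>; the equations are the coordinates of
    \<open>X (1, c 1) *\<^sub>v x 1 - X (i, c i) *\<^sub>v x i = 0\<close> for \<open>i \<ge> 2\<close>.\<close>
  let ?S = "SIGMA i:{1..m}. {..<d (Source i (c i))}" and ?T = "{2..m} \<times> {..<d Sink}"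
  define a where "a = (\<lambda>(i, p) (i', q). if i' = 1 then X (1, c 1) $$ (p, q)
     else if i' = i then - X (i, c i) $$ (p, q) else 0)"
  have "card ?T < card ?S" using no by simp
  then obtain y where y: "\<exists>t\<in>?S. y t \<noteq> 0" "\<forall>t\<in>?T. (\<Sum>s\<in>?S. a t s * y s) = 0"
    using linear_system_nontrivial_solution[of ?T ?S a] by auto
  define x where "x i = vec (d (Source i (c i))) (\<lambda>q. y (i, q))" for i
  have Xx: "(X (i, c i) *\<^sub>v x i) $ p = (\<Sum>q<d (Source i (c i)). X (i, c i) $$ (p, q) * y (i, q))"
    if "i \<in> {1..m}" "p < d Sink" for i p
    using mult_mat_vec_cols[OF X[OF that(1)], of "x i" p] that(2) by (simp add: x_def mult.commute)
  have eq: "X (i, c i) *\<^sub>v x i = X (1, c 1) *\<^sub>v x 1" if i: "i \<in> {1..m}" for i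
  proof (cases "i = 1")
    case False
    show ?thesis
    proof (rule eq_vecI)
      fix p assume "p < dim_vec (X (1, c 1) *\<^sub>v x 1)"
      then have p: "p < d Sink" using X[of 1] m by auto
      have "0 = (\<Sum>s\<in>?S. a (i, p) s * y s)" using y(2) i False p by auto
      also have "\<dots> = (\<Sum>i'=1..m. \<Sum>q<d (Source i' (c i')). a (i, p) (i', q) * y (i', q))"
        by (simp add: sum.Sigma)
      also have "\<dots> = (\<Sum>i'=1..m. (if i' = 1 then (X (1, c 1) *\<^sub>v x 1) $ p else 0) -
           (if i' = i then (X (i, c i) *\<^sub>v x i) $ p else 0))"
        using False Xx[OF _ p] by (intro sum.cong) (auto simp: a_def sum_negf)
      also have "\<dots> = (X (1, c 1) *\<^sub>v x 1) $ p - (X (i, c i) *\<^sub>v x i) $ p"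
        using i m by (simp add: sum_subtractf)
      finally show "(X (i, c i) *\<^sub>v x i) $ p = (X (1, c 1) *\<^sub>v x 1) $ p" by simp
    qed (use X[of 1] X[OF i] m in auto)
  qed simp
  let ?u = "X (1, c 1) *\<^sub>v x 1"
  obtain i q where iq: "i \<in> {1..m}" "q < d (Source i (c i))" "y (i, q) \<noteq> 0" using y(1) by auto
  have "x i $ q \<noteq> 0" using iq by (simp add: x_def)
  \<comment> \<open>The common vector is non-zero because the \<open>X (i, c i)\<close> are injective.\<close>
  then have "x i \<noteq> 0\<^sub>v (d (Source i (c i)))" using iq by auto
  then have "X (i, c i) *\<^sub>v x i \<noteq> 0\<^sub>v (d Sink)"
    using stable_injective[OF st _ iq(1) c[OF iq(1)], of "x i"] n by (auto simp: x_def)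
  then have u: "?u \<noteq> 0\<^sub>v (d Sink)" using eq[OF iq(1)] by simp
  have "card ((\<lambda>i. (i, c i)) ` {1..m}) < m"
  proof (rule stable_common_vector[OF st n, where u = ?u and x = "\<lambda>i j. x i"])
    show "?u \<in> carrier_vec (d Sink)" using X[of 1] m by (intro mult_mat_vec_carrier[OF X]) (auto simp: x_def)
    show "?u \<noteq> 0\<^sub>v (d Sink)" by (rule u)
    show "(\<lambda>i. (i, c i)) ` {1..m} \<subseteq> (SIGMA i:{1..m}. {1..r i})" using c by auto
    fix i j assume "(i, j) \<in> (\<lambda>i. (i, c i)) ` {1..m}"
    then have i: "i \<in> {1..m}" "j = c i" by auto
    have "x i \<in> carrier_vec (d (Source i (c i)))" by (simp add: x_def)
    then show "x i \<in> carrier_vec (d (Source i j)) \<and> X (i, j) *\<^sub>v x i = ?u"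
      unfolding i(2) using eq[OF i(1)] by blast
  qed
  moreover have "card ((\<lambda>i. (i, c i)) ` {1..m}) = m" by (subst card_image) (auto simp: inj_on_def)
  ultimately show False by simp
qed

corollary stable_imp_sum_Max_le:
  assumes st: "stable_rep (star_quiver m r) (star_weight m) d X" and n: "d Sink \<ge> 2" and m: "m \<ge> 1"
    and r: "\<And>i. i \<in> {1..m} \<Longrightarrow> r i \<ge> 1"
  shows "(\<Sum>i=1..m. Max ((\<lambda>j. d (Source i j)) ` {1..r i})) \<le> (m - 1) * d Sink"
proof -
  have "\<forall>i\<in>{1..m}. \<exists>j\<in>{1..r i}. d (Source i j) = Max ((\<lambda>j. d (Source i j)) ` {1..r i})"
  proof
    fix i assume "i \<in> {1..m}"
    then have "(\<lambda>j. d (Source i j)) ` {1..r i} \<noteq> {}" using r by auto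
    then have "Max ((\<lambda>j. d (Source i j)) ` {1..r i}) \<in> (\<lambda>j. d (Source i j)) ` {1..r i}" by (intro Max_in) auto
    then show "\<exists>j\<in>{1..r i}. d (Source i j) = Max ((\<lambda>j. d (Source i j)) ` {1..r i})" by auto
  qed
  from bchoice[OF this[unfolded Bex_def]] obtain c where c: "\<forall>i\<in>{1..m}. c i \<in> {1..r i} \<and>
      d (Source i (c i)) = Max ((\<lambda>j. d (Source i j)) ` {1..r i})" ..
  then have "(\<Sum>i=1..m. Max ((\<lambda>j. d (Source i j)) ` {1..r i})) = (\<Sum>i=1..m. d (Source i (c i)))"
    by (intro sum.cong) auto
  then show ?thesis using stable_sum_of_chosen_le[OF st n m, of c] c by simp
qed

section \<open>The numerical condition and the Euler form\<close>

text \<open>The sum over \<open>j\<close> of the identity \<open>(e + f) (l\<^sup>2 e + k\<^sup>2 f) = (k + l)\<^sup>2 e f + (l e - k f)\<^sup>2\<close>.  The number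
  \<open>D\<close> is an upper bound of the \<open>e + f\<close> in the application; then the second sum on the left is
  non-negative, which bounds \<open>\<Sum> e f\<close>.\<close>

lemma weighted_sum_identity:
  fixes e f :: "'j \<Rightarrow> int" and D k l :: int
  assumes "finite J" "(\<Sum>j\<in>J. e j) = k" "(\<Sum>j\<in>J. f j) = l"
  shows "(k + l)\<^sup>2 * (\<Sum>j\<in>J. e j * f j)
    + (\<Sum>j\<in>J. (l * e j - k * f j)\<^sup>2 + (D - (e j + f j)) * (l\<^sup>2 * e j + k\<^sup>2 * f j))
    = D * k * l * (k + l)"
proof -
  have "(k + l)\<^sup>2 * (e j * f j) + ((l * e j - k * f j)\<^sup>2 + (D - (e j + f j)) * (l\<^sup>2 * e j + k\<^sup>2 * f j))
      = D * l\<^sup>2 * e j + D * k\<^sup>2 * f j" for j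
    by (simp add: power2_eq_square algebra_simps)
  then have "(k + l)\<^sup>2 * (\<Sum>j\<in>J. e j * f j)
    + (\<Sum>j\<in>J. (l * e j - k * f j)\<^sup>2 + (D - (e j + f j)) * (l\<^sup>2 * e j + k\<^sup>2 * f j))
    = (\<Sum>j\<in>J. D * l\<^sup>2 * e j + D * k\<^sup>2 * f j)"
    by (simp only: sum_distrib_left sum.distrib[symmetric])
  also have "\<dots> = D * l\<^sup>2 * k + D * k\<^sup>2 * l"
    using assms by (simp add: sum.distrib sum_distrib_left[symmetric])
  also have "\<dots> = D * k * l * (k + l)" by (simp add: power2_eq_square algebra_simps)
  finally show ?thesis .
qed

text \<open>Adding up the identities of all \<open>i\<close> shows that the assumption \<open>big\<close> can only hold with equality, and
  then every non-negative term \<open>(l e - k f)\<^sup>2\<close> and \<open>(D - d) (l\<^sup>2 e + k\<^sup>2 f)\<close> vanishes.\<close>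

lemma euler_form_extremal:
  fixes d e :: "nat \<Rightarrow> nat \<Rightarrow> nat"
  assumes k: "0 < k" "k < n"
    and d: "\<And>i. i \<in> {1..m} \<Longrightarrow> (\<Sum>j=1..r i. d i j) = n"
    and e: "\<And>i. i \<in> {1..m} \<Longrightarrow> (\<Sum>j=1..r i. e i j) = k"
    and ed: "\<And>i j. i \<in> {1..m} \<Longrightarrow> j \<in> {1..r i} \<Longrightarrow> e i j \<le> d i j"
    and max: "(\<Sum>i=1..m. Max (d i ` {1..r i})) \<le> (m - 1) * n"
    and big: "(m - 1) * (k * (n - k)) \<le> (\<Sum>i=1..m. \<Sum>j=1..r i. e i j * (d i j - e i j))"
  shows "(\<Sum>i=1..m. Max (d i ` {1..r i})) = (m - 1) * n"
    "\<And>i j. i \<in> {1..m} \<Longrightarrow> j \<in> {1..r i} \<Longrightarrow> n * e i j = k * d i j"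
    "\<And>i j. i \<in> {1..m} \<Longrightarrow> j \<in> {1..r i} \<Longrightarrow> d i j = 0 \<or> d i j = Max (d i ` {1..r i})"
proof -
  define D where "D i = Max (d i ` {1..r i})" for i
  define l where "l = n - k"
  have l: "0 < l" "n = k + l" using k by (auto simp: l_def)
  define f where "f i j = d i j - e i j" for i j
  have def: "d i j = e i j + f i j" if "i \<in> {1..m}" "j \<in> {1..r i}" for i j
    using ed that by (simp add: f_def)
  have f: "(\<Sum>j=1..r i. f i j) = l" if "i \<in> {1..m}" for i
  proof -
    have "(\<Sum>j=1..r i. d i j) = (\<Sum>j=1..r i. e i j) + (\<Sum>j=1..r i. f i j)"
      unfolding sum.distrib[symmetric] using def that by (intro sum.cong) auto
    then show ?thesis using d e that l by simp
  qed
  have D: "d i j \<le> D i" if "i \<in> {1..m}" "j \<in> {1..r i}" for i j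
    using that unfolding D_def by (intro Max_ge) auto
  define Q where "Q i j = (int l * int (e i j) - int k * int (f i j))\<^sup>2 +
      (int (D i) - (int (e i j) + int (f i j))) * ((int l)\<^sup>2 * int (e i j) + (int k)\<^sup>2 * int (f i j))" for i j
  have Q0: "0 \<le> Q i j" if "i \<in> {1..m}" "j \<in> {1..r i}" for i j
    unfolding Q_def using D[OF that] def[OF that] by (intro add_nonneg_nonneg mult_nonneg_nonneg) auto
  have "(int n)\<^sup>2 * (\<Sum>j=1..r i. int (e i j) * int (f i j)) + (\<Sum>j=1..r i. Q i j)
      = int (D i) * (int k * int l * int n)" if "i \<in> {1..m}" for i
  proof -
    have "(\<Sum>j=1..r i. int (e i j)) = int k" "(\<Sum>j=1..r i. int (f i j)) = int l"
      using e[OF that] f[OF that] by (metis of_nat_sum)+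
    from weighted_sum_identity[OF _ this] show ?thesis
      by (simp add: Q_def l(2) mult_ac)
  qed
  then have "(\<Sum>i=1..m. (int n)\<^sup>2 * (\<Sum>j=1..r i. int (e i j) * int (f i j)) + (\<Sum>j=1..r i. Q i j))
      = (\<Sum>i=1..m. int (D i) * (int k * int l * int n))"
    by (intro sum.cong) auto
  then have eq: "(int n)\<^sup>2 * (\<Sum>i=1..m. \<Sum>j=1..r i. int (e i j) * int (f i j)) + (\<Sum>i=1..m. \<Sum>j=1..r i. Q i j)
      = (\<Sum>i=1..m. int (D i)) * (int k * int l * int n)"
    by (simp add: sum.distrib sum_distrib_left sum_distrib_right)
  have "int ((m - 1) * (k * l)) \<le> int (\<Sum>i=1..m. \<Sum>j=1..r i. e i j * f i j)"
    using big unfolding l_def f_def by (simp only: of_nat_le_iff)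
  then have big': "int (m - 1) * (int k * int l) \<le> (\<Sum>i=1..m. \<Sum>j=1..r i. int (e i j) * int (f i j))"
    by simp
  have "int (\<Sum>i=1..m. D i) \<le> int ((m - 1) * n)" using max unfolding D_def by (simp only: of_nat_le_iff)
  then have max': "(\<Sum>i=1..m. int (D i)) \<le> int (m - 1) * int n" by simp
  have pos: "0 < int k * int l * int n" using k l by simp
  have SQ: "0 \<le> (\<Sum>i=1..m. \<Sum>j=1..r i. Q i j)" using Q0 by (intro sum_nonneg) auto
  have a1: "(int n)\<^sup>2 * (int (m - 1) * (int k * int l)) \<le> (int n)\<^sup>2 * (\<Sum>i=1..m. \<Sum>j=1..r i. int (e i j) * int (f i j))"
    using big' by (intro mult_left_mono) auto
  have a2: "(\<Sum>i=1..m. int (D i)) * (int k * int l * int n) \<le> int (m - 1) * int n * (int k * int l * int n)"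
    using max' pos by (intro mult_right_mono) auto
  have a3: "(int n)\<^sup>2 * (int (m - 1) * (int k * int l)) = int (m - 1) * int n * (int k * int l * int n)"
    by (simp add: power2_eq_square)
  \<comment> \<open>\<open>a1\<close>, \<open>a2\<close> and \<open>a3\<close> bound \<open>n\<^sup>2 * \<Sum> e f\<close> from below by the right-hand side of \<open>eq\<close>, so nothing is
    left for the sum of the \<open>Q i j\<close>.\<close>
  have SQ0: "(\<Sum>i=1..m. \<Sum>j=1..r i. Q i j) = 0"
    and eqD: "(\<Sum>i=1..m. int (D i)) * (int k * int l * int n) = int (m - 1) * int n * (int k * int l * int n)"
    using SQ a1 a2 a3 eq by linarith+
  have Qi: "(\<Sum>j=1..r i. Q i j) = 0" if "i \<in> {1..m}" for i
  proof (rule sum_nonneg_0[OF _ _ SQ0 that])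
    show "0 \<le> (\<Sum>j=1..r i. Q i j)" if "i \<in> {1..m}" for i
      using Q0[OF that] by (rule sum_nonneg)
  qed simp
  have Q: "Q i j = 0" if "i \<in> {1..m}" "j \<in> {1..r i}" for i j
    by (rule sum_nonneg_0[OF _ Q0[OF that(1)] Qi[OF that(1)] that(2)]) simp
  have "(\<Sum>i=1..m. int (D i)) = int (m - 1) * int n" 
  proof -
    have "int k * int l * int n \<noteq> 0" using pos by linarith
    from iffD1[OF mult_right_cancel[OF this] eqD] show ?thesis .
  qed
  then have "int (\<Sum>i=1..m. D i) = int ((m - 1) * n)" by simp
  then show "(\<Sum>i=1..m. Max (d i ` {1..r i})) = (m - 1) * n" unfolding D_def by (simp only: of_nat_eq_iff)
  fix i j assume ij: "i \<in> {1..m}" "j \<in> {1..r i}"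
  let ?a = "(int l * int (e i j) - int k * int (f i j))\<^sup>2"
    and ?b = "(int (D i) - (int (e i j) + int (f i j))) * ((int l)\<^sup>2 * int (e i j) + (int k)\<^sup>2 * int (f i j))"
  have "0 \<le> ?a" "0 \<le> ?b" using D[OF ij] def[OF ij] by auto
  moreover have "?a + ?b = 0" using Q[OF ij] by (simp add: Q_def)
  ultimately have ab: "?a = 0" "?b = 0" by linarith+
  have "int (l * e i j) = int (k * f i j)" using ab(1) by simp
  then have "l * e i j = k * f i j" by (simp only: of_nat_eq_iff)
  then show "n * e i j = k * d i j" using def[OF ij] l by (simp add: algebra_simps)
  show "d i j = 0 \<or> d i j = Max (d i ` {1..r i})"
  proof (cases "int (D i) = int (e i j) + int (f i j)")
    case True
    then have "int (D i) = int (d i j)" using def[OF ij] by simp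
    then show ?thesis by (simp add: D_def)
  next
    case False
    then have "(int l)\<^sup>2 * int (e i j) + (int k)\<^sup>2 * int (f i j) = 0" using ab(2) by auto
    moreover have "0 \<le> (int l)\<^sup>2 * int (e i j)" "0 \<le> (int k)\<^sup>2 * int (f i j)" by auto
    ultimately have "(int l)\<^sup>2 * int (e i j) = 0" "(int k)\<^sup>2 * int (f i j) = 0" by linarith+
    then have "e i j = 0" "f i j = 0" using l k by auto
    then show ?thesis using def[OF ij] by simp
  qed
qed

text \<open>If the \<open>i\<close>-th group has \<open>s\<close> non-zero entries, all equal to \<open>D i\<close>, then \<open>D i = n / s\<close>.  So \<open>n - D i\<close> is
  zero, or at least \<open>n / 2\<close> and less than \<open>n\<close>.  Since these numbers add up to \<open>n\<close>, exactly two of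
  them are non-zero, and both are \<open>n / 2\<close>.\<close>

lemma uniform_extremal_imp_special_isotropic:
  assumes n: "n \<ge> 2" "d Sink = n" and bal: "balanced m r d" and m: "m \<ge> 1"
    and sum: "(\<Sum>i=1..m. Max ((\<lambda>j. d (Source i j)) ` {1..r i})) = (m - 1) * n"
    and unif: "\<And>i j. i \<in> {1..m} \<Longrightarrow> j \<in> {1..r i} \<Longrightarrow>
      d (Source i j) = 0 \<or> d (Source i j) = Max ((\<lambda>j. d (Source i j)) ` {1..r i})"
  shows "special_isotropic m r d"
proof -
  define D where "D i = Max ((\<lambda>j. d (Source i j)) ` {1..r i})" for i
  define S where "S i = {j \<in> {1..r i}. d (Source i j) \<noteq> 0}" for i
  have dS: "d (Source i j) = D i" if "i \<in> {1..m}" "j \<in> S i" for i j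
    using unif[of i j] that by (auto simp: S_def D_def)
  have S: "card (S i) * D i = n" if "i \<in> {1..m}" for i
  proof -
    have "n = (\<Sum>j=1..r i. d (Source i j))" using bal that n by (simp add: balanced_def)
    also have "\<dots> = (\<Sum>j\<in>S i. d (Source i j))"
      by (rule sum.mono_neutral_right) (auto simp: S_def)
    also have "\<dots> = (\<Sum>j\<in>S i. D i)" using dS that by (intro sum.cong) auto
    finally show ?thesis by simp
  qed
  have fS: "finite (S i)" for i by (simp add: S_def)
  have D: "D i \<le> n" "0 < D i" "card (S i) \<noteq> 0" if "i \<in> {1..m}" for i
  proof -
    show "card (S i) \<noteq> 0" "0 < D i" using S[OF that] n by (auto intro: gr0I)
    then have "1 * D i \<le> card (S i) * D i" by (intro mult_right_mono) auto
    then show "D i \<le> n" using S[OF that] by simp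
  qed
  \<comment> \<open>The groups with more than one non-zero entry.\<close>
  define I where "I = {i \<in> {1..m}. D i \<noteq> n}"
  have half: "2 * D i \<le> n" if "i \<in> I" for i
  proof -
    have i: "i \<in> {1..m}" "D i \<noteq> n" using that by (auto simp: I_def)
    then have "card (S i) \<noteq> 1" using S by fastforce
    then have "2 \<le> card (S i)" using D(3)[OF i(1)] by linarith
    then have "2 * D i \<le> card (S i) * D i" by (rule mult_right_mono) simp
    then show ?thesis using S[OF i(1)] by simp
  qed
  have "(\<Sum>i=1..m. D i) + (\<Sum>i=1..m. n - D i) = (\<Sum>i=1..m. n)"
    unfolding sum.distrib[symmetric] using D by (intro sum.cong) auto
  also have "\<dots> = (m - 1) * n + n" using m by (cases m) auto
  finally have "(\<Sum>i=1..m. n - D i) = n" using sum by (simp add: D_def)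
  moreover have "(\<Sum>i=1..m. n - D i) = (\<Sum>i\<in>I. n - D i)"
    by (rule sum.mono_neutral_right) (auto simp: I_def)
  ultimately have sI: "(\<Sum>i\<in>I. n - D i) = n" by simp
  have fI: "finite I" by (simp add: I_def)
  have "n * card I = (\<Sum>i\<in>I. n)" by simp
  also have "\<dots> \<le> (\<Sum>i\<in>I. 2 * (n - D i))"
  proof (intro sum_mono)
    fix i assume "i \<in> I"
    then show "n \<le> 2 * (n - D i)" using half[of i] by linarith
  qed
  also have "\<dots> = 2 * n" using sI by (simp add: sum_distrib_left[symmetric])
  finally have "card I \<le> 2" using n by simp
  moreover have "card I \<noteq> 0" using sI n fI by auto
  moreover have "card I \<noteq> 1"
  proof
    assume "card I = 1"
    then obtain i where i: "I = {i}" by (auto simp: card_1_singleton_iff)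
    then have "i \<in> {1..m}" by (auto simp: I_def)
    then show False using sI i D(2)[of i] n by auto
  qed
  ultimately have "card I = 2" by linarith
  then obtain i1 i2 where I: "I = {i1, i2}" "i1 \<noteq> i2" by (auto simp: card_2_iff)
  then have i12: "2 * D i1 = n" "2 * D i2 = n"
    using sI half[of i1] half[of i2] by auto
  then have Dh: "2 * D i = n" if "i \<in> I" for i using that I by auto
  have cS: "card (S i) = 2" if "i \<in> I" for i
  proof -
    have i: "i \<in> {1..m}" using that by (auto simp: I_def)
    have "card (S i) * D i = 2 * D i" using S[OF i] Dh[OF that] by simp
    then show ?thesis using D(2)[OF i] by simp
  qed
  have "{(i, j). i \<in> {1..m} \<and> j \<in> {1..r i} \<and> 0 < d (Source i j) \<and> d (Source i j) < d Sink} = (SIGMA i:I. S i)"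
  proof -
    have *: "d (Source i j) < n \<longleftrightarrow> i \<in> I" if "i \<in> {1..m}" "j \<in> S i" for i j
      using dS[OF that] D[OF that(1)] that by (auto simp: I_def)
    have "i \<in> {1..m} \<and> j \<in> {1..r i} \<and> 0 < d (Source i j) \<and> d (Source i j) < d Sink \<longleftrightarrow> i \<in> I \<and> j \<in> S i" for i j
      using *[of i j] n by (auto simp: S_def I_def)
    then show ?thesis by auto
  qed
  moreover have "card (SIGMA i:I. S i) = 4" using fI fS cS I by (simp add: card_SigmaI)
  moreover have "2 * d (Source i j) = d Sink"
    if "i \<in> {1..m}" "j \<in> {1..r i}" "0 < d (Source i j)" "d (Source i j) < d Sink" for i j
  proof -
    have "j \<in> S i" using that by (auto simp: S_def)
    then have "d (Source i j) = D i" using dS that by blast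
    moreover have "i \<in> I" using that calculation n by (auto simp: I_def)
    ultimately show ?thesis using Dh n by simp
  qed
  ultimately show ?thesis unfolding special_isotropic_def using bal n by simp
qed

lemma sum_eq_imp_others_zero:
  fixes f :: "'a \<Rightarrow> nat"
  assumes "finite A" "a \<in> A" "sum f A = f a" "b \<in> A" "b \<noteq> a"
  shows "f b = 0"
proof -
  have "sum f A = f a + sum f (A - {a})" using assms by (subst sum.remove[of _ a]) auto
  then have "sum f (A - {a}) = 0" using assms by simp
  then show ?thesis using assms by auto
qed

text \<open>A group without an entry \<open>n\<close> has exactly two non-zero entries, since all of them are \<open>n / 2\<close>.  The
  four entries \<open>n / 2\<close> therefore come from two groups, \<open>a\<close> and \<open>b\<close>.\<close>

lemma special_isotropic_shape:
  assumes sp: "special_isotropic m r d"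
  obtains a a1 a2 b b1 b2 where
    "a \<in> {1..m}" "b \<in> {1..m}" "a \<noteq> b" 
    "a1 \<in> {1..r a}" "a2 \<in> {1..r a}" "a1 \<noteq> a2" "b1 \<in> {1..r b}" "b2 \<in> {1..r b}" "b1 \<noteq> b2"
    "2 * d (Source a a1) = d Sink" "2 * d (Source b b1) = d Sink"
    "\<And>j. j \<in> {1..r a} \<Longrightarrow> j \<noteq> a1 \<Longrightarrow> j \<noteq> a2 \<Longrightarrow> d (Source a j) = 0"
    "\<And>j. j \<in> {1..r b} \<Longrightarrow> j \<noteq> b1 \<Longrightarrow> j \<noteq> b2 \<Longrightarrow> d (Source b j) = 0"
    "\<And>i. i \<in> {1..m} \<Longrightarrow> i \<noteq> a \<Longrightarrow> i \<noteq> b \<Longrightarrow> \<exists>j\<in>{1..r i}. d (Source i j) = d Sink \<and>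
        (\<forall>j'\<in>{1..r i}. j' \<noteq> j \<longrightarrow> d (Source i j') = 0)"
proof -
  define n where "n = d Sink"
  have n: "n \<ge> 2" using sp by (simp add: special_isotropic_def n_def)
  define S where "S i = {j \<in> {1..r i}. 0 < d (Source i j) \<and> d (Source i j) < n}" for i
  have fS: "finite (S i)" for i by (simp add: S_def)
  have sum: "(\<Sum>j=1..r i. d (Source i j)) = n" if "i \<in> {1..m}" for i
    using sp that by (simp add: special_isotropic_def balanced_def n_def)
  have half: "2 * d (Source i j) = n" if "i \<in> {1..m}" "j \<in> S i" for i j
    using sp that by (auto simp: special_isotropic_def n_def S_def)
  have zero: "d (Source i j') = 0" if "i \<in> {1..m}" "j \<in> {1..r i}" "d (Source i j) = n" "j' \<in> {1..r i}" "j' \<noteq> j" for i j j'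
    using sum_eq_imp_others_zero[of "{1..r i}" j "\<lambda>j. d (Source i j)" j'] sum that by auto
  have two: "card (S i) = 2 \<and> (\<forall>j\<in>{1..r i}. j \<notin> S i \<longrightarrow> d (Source i j) = 0)"
    if i: "i \<in> {1..m}" and no: "\<not> (\<exists>j\<in>{1..r i}. d (Source i j) = n)" for i
  proof -
    have z: "\<forall>j\<in>{1..r i}. j \<notin> S i \<longrightarrow> d (Source i j) = 0"
    proof (intro ballI impI)
      fix j assume j: "j \<in> {1..r i}" "j \<notin> S i"
      have "d (Source i j) \<le> (\<Sum>j=1..r i. d (Source i j))" using j(1) by (intro member_le_sum) auto
      then show "d (Source i j) = 0" using sum[OF i] no j by (auto simp: S_def)
    qed
    have "n = (\<Sum>j\<in>S i. d (Source i j))"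
      unfolding sum[OF i, symmetric] using z by (intro sum.mono_neutral_right) (auto simp: S_def)
    then have "2 * n = (\<Sum>j\<in>S i. 2 * d (Source i j))" by (simp add: sum_distrib_left)
    also have "\<dots> = card (S i) * n" using half[OF i] by simp
    finally show ?thesis using n z by simp
  qed
  define I where "I = {i \<in> {1..m}. \<not> (\<exists>j\<in>{1..r i}. d (Source i j) = n)}"
  have empty: "S i = {}" if "i \<in> {1..m}" "i \<notin> I" for i
  proof -
    have "\<exists>j\<in>{1..r i}. d (Source i j) = n" using that by (auto simp: I_def)
    then obtain j where j: "j \<in> {1..r i}" "d (Source i j) = n" by blast
    have "j' \<notin> S i" if "j' \<in> {1..r i}" for j'
      using zero[OF \<open>i \<in> {1..m}\<close> j that] j(2) by (cases "j' = j") (auto simp: S_def)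
    then show ?thesis by (auto simp: S_def)
  qed
  have "{(i, j). i \<in> {1..m} \<and> j \<in> {1..r i} \<and> 0 < d (Source i j) \<and> d (Source i j) < d Sink} = (SIGMA i:{1..m}. S i)"
    by (auto simp: S_def n_def)
  then have "4 = (\<Sum>i=1..m. card (S i))" using sp fS by (simp add: special_isotropic_def)
  also have "\<dots> = (\<Sum>i\<in>I. card (S i))" using empty by (intro sum.mono_neutral_right) (auto simp: I_def)
  also have "\<dots> = (\<Sum>i\<in>I. 2)" using two by (intro sum.cong) (auto simp: I_def)
  finally have "card I = 2" by simp
  then obtain a b where ab: "I = {a, b}" "a \<noteq> b" by (auto simp: card_2_iff)
  then have abm: "a \<in> {1..m}" "b \<in> {1..m}" and I: "a \<in> I" "b \<in> I" by (auto simp: I_def)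
  have ta: "card (S a) = 2" "\<forall>j\<in>{1..r a}. j \<notin> S a \<longrightarrow> d (Source a j) = 0"
    and tb: "card (S b) = 2" "\<forall>j\<in>{1..r b}. j \<notin> S b \<longrightarrow> d (Source b j) = 0"
    using two I unfolding I_def by auto
  obtain a1 a2 where a12: "S a = {a1, a2}" "a1 \<noteq> a2" using ta by (auto simp: card_2_iff)
  obtain b1 b2 where b12: "S b = {b1, b2}" "b1 \<noteq> b2" using tb by (auto simp: card_2_iff)
  show thesis
  proof (rule that[of a b a1 a2 b1 b2])
    show "a1 \<in> {1..r a}" "a2 \<in> {1..r a}" "b1 \<in> {1..r b}" "b2 \<in> {1..r b}"
      using a12 b12 unfolding S_def by blast+
    show "2 * d (Source a a1) = d Sink" "2 * d (Source b b1) = d Sink"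
      using half abm a12 b12 by (auto simp: n_def)
    show "d (Source a j) = 0" if "j \<in> {1..r a}" "j \<noteq> a1" "j \<noteq> a2" for j using ta(2) a12 that by auto
    show "d (Source b j) = 0" if "j \<in> {1..r b}" "j \<noteq> b1" "j \<noteq> b2" for j using tb(2) b12 that by auto
    show "\<exists>j\<in>{1..r i}. d (Source i j) = d Sink \<and> (\<forall>j'\<in>{1..r i}. j' \<noteq> j \<longrightarrow> d (Source i j') = 0)"
      if "i \<in> {1..m}" "i \<noteq> a" "i \<noteq> b" for i
    proof -
      have "i \<notin> I" using that ab by auto
      then have "\<exists>j\<in>{1..r i}. d (Source i j) = n" using that(1) by (auto simp: I_def)
      then obtain j where j: "j \<in> {1..r i}" "d (Source i j) = n" by blast
      have "\<forall>j'\<in>{1..r i}. j' \<noteq> j \<longrightarrow> d (Source i j') = 0" using zero[OF that(1) j] by blast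
      then show ?thesis using j unfolding n_def by blast
    qed
  qed (use ab abm a12 b12 in auto)
qed

text \<open>All entries are \<open>0\<close>, \<open>n / 2\<close> or \<open>n\<close>, so \<open>n / 2\<close> is their greatest common divisor.\<close>

lemma special_isotropic_indivisible_iff:
  assumes sp: "special_isotropic m r d"
  shows "\<not> divisible_dim_vector (star_quiver m r) d \<longleftrightarrow> d Sink = 2"
proof -
  let ?n = "d Sink"
  have n: "?n \<ge> 2" and bal: "balanced m r d" using sp by (auto simp: special_isotropic_def)
  let ?S = "{(i, j). i \<in> {1..m} \<and> j \<in> {1..r i} \<and> 0 < d (Source i j) \<and> d (Source i j) < ?n}"
  have half: "2 * d (Source i j) = ?n" if "i \<in> {1..m}" "j \<in> {1..r i}" "0 < d (Source i j)" "d (Source i j) < ?n" for i j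
    using sp that by (auto simp: special_isotropic_def)
  have "card ?S = 4" using sp by (simp add: special_isotropic_def)
  then have "?S \<noteq> {}" by (metis card.empty zero_neq_numeral)
  then obtain i j where ij: "i \<in> {1..m}" "j \<in> {1..r i}" "0 < d (Source i j)" "d (Source i j) < ?n" by auto
  define k where "k = d (Source i j)"
  have k: "2 * k = ?n" using half[OF ij] by (simp add: k_def)
  have all: "k dvd d v" if v: "v \<in> verts (star_quiver m r)" for v
  proof (cases v)
    case Sink
    then show ?thesis using k by (metis dvd_triv_right)
  next
    case (Source i' j')
    then have ij': "i' \<in> {1..m}" "j' \<in> {1..r i'}" using v by auto
    have "d (Source i' j') \<le> (\<Sum>j=1..r i'. d (Source i' j))" using ij'(2) by (intro member_le_sum) auto
    then have "d (Source i' j') \<le> ?n" using bal ij'(1) by (simp add: balanced_def)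
    then consider "d (Source i' j') = 0" | "d (Source i' j') = ?n" | "2 * d (Source i' j') = ?n"
      using half[OF ij'] by linarith
    then show ?thesis
    proof cases
      case 2
      then show ?thesis using k Source by (metis dvd_triv_right)
    next
      case 3
      then have "d (Source i' j') = k" using k by simp
      then show ?thesis using Source by simp
    qed (use Source in simp)
  qed
  show ?thesis
  proof
    assume "\<not> divisible_dim_vector (star_quiver m r) d"
    then have "\<not> k \<ge> 2" using all unfolding divisible_dim_vector_def by blast
    then show "?n = 2" using k n by linarith
  next
    assume "?n = 2"
    then have "d (Source i j) = 1" using k by (simp add: k_def)
    moreover have "Source i j \<in> verts (star_quiver m r)" using ij by simp
    ultimately have "k' = 1" if "\<forall>v\<in>verts (star_quiver m r). k' dvd d v" for k'
      using that by (metis nat_dvd_1_iff_1)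
    then show "\<not> divisible_dim_vector (star_quiver m r) d"
      unfolding divisible_dim_vector_def by (metis Suc_1 Suc_n_not_le_n)
  qed
qed

lemma special_isotropic_sum_Max_le:
  assumes sp: "special_isotropic m r d"
  shows "(\<Sum>i=1..m. Max ((\<lambda>j. d (Source i j)) ` {1..r i})) \<le> (m - 1) * d Sink"
proof (rule special_isotropic_shape[OF sp])
  fix a a1 a2 b b1 b2
  assume ab: "a \<in> {1..m}" "b \<in> {1..m}" "a \<noteq> b"
    and a12: "a1 \<in> {1..r a}" "a2 \<in> {1..r a}" "a1 \<noteq> a2" and b12: "b1 \<in> {1..r b}" "b2 \<in> {1..r b}" "b1 \<noteq> b2"
    and h: "2 * d (Source a a1) = d Sink" "2 * d (Source b b1) = d Sink"
    and full: "\<And>i. i \<in> {1..m} \<Longrightarrow> i \<noteq> a \<Longrightarrow> i \<noteq> b \<Longrightarrow> \<exists>j\<in>{1..r i}. d (Source i j) = d Sink \<and>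
        (\<forall>j'\<in>{1..r i}. j' \<noteq> j \<longrightarrow> d (Source i j') = 0)"
  have bal: "(\<Sum>j=1..r i. d (Source i j)) = d Sink" if "i \<in> {1..m}" for i
    using sp that by (simp add: special_isotropic_def balanced_def)
  have n: "d Sink \<ge> 2" using sp by (simp add: special_isotropic_def)
  let ?M = "\<lambda>i. Max ((\<lambda>j. d (Source i j)) ` {1..r i})"
  have le: "?M i \<le> c" if "{1..r i} \<noteq> {}" "\<And>j. j \<in> {1..r i} \<Longrightarrow> d (Source i j) \<le> c" for i c
    using that by (subst Max_le_iff) auto
  have half: "2 * ?M i \<le> d Sink" if i: "i \<in> {1..m}" and j: "j1 \<in> {1..r i}" "2 * d (Source i j1) = d Sink" for i j1
  proof -
    have "d (Source i j) \<le> d (Source i j1)" if "j \<in> {1..r i}" for j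
    proof (cases "j = j1")
      case False
      have "(\<Sum>j\<in>{j, j1}. d (Source i j)) \<le> (\<Sum>j=1..r i. d (Source i j))" using that j by (intro sum_mono2) auto
      then show ?thesis using False bal[OF i] j(2) by simp
    qed simp
    then have "?M i \<le> d (Source i j1)" using j(1) by (intro le) auto
    then show ?thesis using j(2) by simp
  qed
  have "?M i \<le> d Sink" if i: "i \<in> {1..m} - {a, b}" for i
  proof (rule le)
    show "{1..r i} \<noteq> {}" using full[of i] i by auto
    show "d (Source i j) \<le> d Sink" if "j \<in> {1..r i}" for j
      using member_le_sum[OF that, of "\<lambda>j. d (Source i j)"] bal[of i] i by auto
  qed
  then have "(\<Sum>i\<in>{1..m} - {a, b}. ?M i) \<le> (\<Sum>i\<in>{1..m} - {a, b}. d Sink)" by (intro sum_mono) auto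
  also have "\<dots> = (m - 2) * d Sink" using ab by (simp add: card_Diff_subset numeral_2_eq_2)
  finally have rest: "(\<Sum>i\<in>{1..m} - {a, b}. ?M i) \<le> (m - 2) * d Sink" .
  have "(\<Sum>i=1..m. ?M i) = (\<Sum>i\<in>{1..m} - {a, b}. ?M i) + (\<Sum>i\<in>{a, b}. ?M i)"
    using ab by (intro sum.subset_diff) auto
  also have "(\<Sum>i\<in>{a, b}. ?M i) = ?M a + ?M b" using ab(3) by simp
  also have "(\<Sum>i\<in>{1..m} - {a, b}. ?M i) + (?M a + ?M b) \<le> (m - 2) * d Sink + d Sink"
    using rest half[OF ab(1) a12(1) h(1)] half[OF ab(2) b12(1) h(2)] by linarith
  also have "m \<ge> 2" using card_mono[of "{1..m}" "{a, b}"] ab by simp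
  then have "(m - 2) * d Sink + d Sink = (m - 1) * d Sink"
    by (metis Suc_diff_le add.commute diff_Suc_Suc mult_Suc numeral_2_eq_2 One_nat_def)
  finally show ?thesis .
qed

text \<open>If \<open>d Sink = 1\<close> there is no \<open>k\<close> in question.  Where the bound on the maxima is not
  part of the case, it follows from the special isotropic shape; equality in the conclusion is
  excluded by the shape itself or, for \<open>n = 2\<close>, by parity.\<close>

lemma condition_imp_negative_euler_form:
  assumes bal: "balanced m r d" and m: "m \<ge> 1"
    and cond: "d Sink = 1 \<or> special_isotropic m r d \<and> d Sink = 2 \<or>
      \<not> special_isotropic m r d \<and> (\<Sum>i=1..m. Max ((\<lambda>j. d (Source i j)) ` {1..r i})) \<le> (m - 1) * d Sink"
    and k: "0 < k" "k < d Sink" and e: "\<And>i. i \<in> {1..m} \<Longrightarrow> (\<Sum>j=1..r i. e i j) = k"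
    and ed: "\<And>i j. i \<in> {1..m} \<Longrightarrow> j \<in> {1..r i} \<Longrightarrow> e i j \<le> d (Source i j)"
  shows "(\<Sum>i=1..m. \<Sum>j=1..r i. e i j * (d (Source i j) - e i j)) < (m - 1) * (k * (d Sink - k))"
proof (rule ccontr)
  assume "\<not> ?thesis"
  then have big: "(m - 1) * (k * (d Sink - k)) \<le> (\<Sum>i=1..m. \<Sum>j=1..r i. e i j * (d (Source i j) - e i j))" by simp
  have max: "(\<Sum>i=1..m. Max ((\<lambda>j. d (Source i j)) ` {1..r i})) \<le> (m - 1) * d Sink"
    using cond k special_isotropic_sum_Max_le by auto
  have b: "(\<Sum>j=1..r i. d (Source i j)) = d Sink" if "i \<in> {1..m}" for i using bal that by (simp add: balanced_def)
  let ?M = "\<lambda>i. Max ((\<lambda>j. d (Source i j)) ` {1..r i})"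
  have ext1: "(\<Sum>i=1..m. ?M i) = (m - 1) * d Sink"
    by (rule euler_form_extremal(1)[OF k b e ed max big])
  have ext2: "d Sink * e i j = k * d (Source i j)" if "i \<in> {1..m}" "j \<in> {1..r i}" for i j
    by (rule euler_form_extremal(2)[OF k b e ed max big that])
  have ext3: "d (Source i j) = 0 \<or> d (Source i j) = ?M i" if "i \<in> {1..m}" "j \<in> {1..r i}" for i j
    by (rule euler_form_extremal(3)[OF k b e ed max big that])
  show False
  proof (cases "special_isotropic m r d")
    case False
    moreover have "special_isotropic m r d"
      by (rule uniform_extremal_imp_special_isotropic[OF _ refl bal m ext1 ext3]) (use k in auto)
    ultimately show False by blast
  next
    case True
    then have n: "d Sink = 2" using cond k by auto
    then have "k = 1" using k by simp
    have "card {(i, j). i \<in> {1..m} \<and> j \<in> {1..r i} \<and> 0 < d (Source i j) \<and> d (Source i j) < d Sink} = 4"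
      using True by (simp add: special_isotropic_def)
    then have "{(i, j). i \<in> {1..m} \<and> j \<in> {1..r i} \<and> 0 < d (Source i j) \<and> d (Source i j) < d Sink} \<noteq> {}"
      by (metis card.empty zero_neq_numeral)
    then obtain i j where ij: "i \<in> {1..m}" "j \<in> {1..r i}" "0 < d (Source i j)" "d (Source i j) < d Sink" by auto
    have "2 * e i j = d (Source i j)" using ext2[OF ij(1,2)] n \<open>k = 1\<close> by simp
    then show False using ij n by presburger
  qed
qed

section \<open>Stable representations of special isotropic dimension\<close>

lemma eigenvector_exists:
  fixes A :: "'k::alg_closed_field mat"
  assumes A: "A \<in> carrier_mat k k" and k: "k \<ge> 1"
  shows "\<exists>x c. x \<in> carrier_vec k \<and> x \<noteq> 0\<^sub>v k \<and> A *\<^sub>v x = c \<cdot>\<^sub>v x"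
proof -
  have "degree (char_poly A) > 0" using degree_monic_char_poly[OF A] k by simp
  then obtain c where "poly (char_poly A) c = 0" using alg_closed_imp_poly_has_root by blast
  then have "eigenvalue A c" using eigenvalue_root_char_poly[OF A] by simp
  then show ?thesis using A by (auto simp: eigenvalue_def eigenvector_def)
qed

text \<open>First, \<open>X\<close> has invertible sum maps: if two halves of the same decomposition had a common vector
  \<open>u\<close>, then \<open>u\<close> would lie in two images for this group and in one image for each of the \<open>m - 2\<close> groups
  with an entry \<open>n\<close>, contrary to \<open>stable_common_vector\<close>.  So \<open>X\<close> is irreducible.  Let \<open>E\<close> and
  \<open>E'\<close> be the projections onto the images of \<open>X (a, a1)\<close> and \<open>X (b, b1)\<close>.  For \<open>v\<close> in the
  image of \<open>E\<close> with \<open>E E' v = \<mu> v\<close> and \<open>w = E' v\<close>, the span of \<open>v\<close> and \<open>w\<close> is mapped into itself by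
  \<open>E\<close> and \<open>E'\<close>, hence by the complementary projections.\<close>

theorem stable_special_isotropic_dim_two:
  fixes X :: "nat \<times> nat \<Rightarrow> 'k::alg_closed_field mat"
  assumes st: "stable_rep (star_quiver m r) (star_weight m) d X" and sp: "special_isotropic m r d"
  shows "d Sink = 2"
proof (rule special_isotropic_shape[OF sp])
  fix a a1 a2 b b1 b2
  assume ab: "a \<in> {1..m}" "b \<in> {1..m}" "a \<noteq> b" and
    a: "a1 \<in> {1..r a}" "a2 \<in> {1..r a}" "a1 \<noteq> a2" and b: "b1 \<in> {1..r b}" "b2 \<in> {1..r b}" "b1 \<noteq> b2" and
    half: "2 * d (Source a a1) = d Sink" "2 * d (Source b b1) = d Sink" and
    za: "\<And>j. j \<in> {1..r a} \<Longrightarrow> j \<noteq> a1 \<Longrightarrow> j \<noteq> a2 \<Longrightarrow> d (Source a j) = 0" and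
    zb: "\<And>j. j \<in> {1..r b} \<Longrightarrow> j \<noteq> b1 \<Longrightarrow> j \<noteq> b2 \<Longrightarrow> d (Source b j) = 0" and
    full: "\<And>i. i \<in> {1..m} \<Longrightarrow> i \<noteq> a \<Longrightarrow> i \<noteq> b \<Longrightarrow> \<exists>j\<in>{1..r i}. d (Source i j) = d Sink \<and>
        (\<forall>j'\<in>{1..r i}. j' \<noteq> j \<longrightarrow> d (Source i j') = 0)"
  define n where "n = d Sink"
  have n: "n \<ge> 2" using sp by (simp add: special_isotropic_def n_def)
  have bal: "(\<Sum>j=1..r i. d (Source i j)) = n" if "i \<in> {1..m}" for i
    using sp that by (simp add: special_isotropic_def balanced_def n_def)
  have X: "X (i, j) \<in> carrier_mat n (d (Source i j))" if "i \<in> {1..m}" "j \<in> {1..r i}" for i j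
    using st that by (auto simp: stable_rep_def n_def intro: quiver_rep_star_carrier)
  have inj: "x = 0\<^sub>v (d (Source i j))" if "i \<in> {1..m}" "j \<in> {1..r i}" "x \<in> carrier_vec (d (Source i j))"
    "X (i, j) *\<^sub>v x = 0\<^sub>v n" for i j x
    using stable_injective[OF st _ that(1-3)] that(4) n by (simp add: n_def)
  have "\<forall>i\<in>{1..m} - {a, b}. \<exists>j. j \<in> {1..r i} \<and> d (Source i j) = n \<and>
        (\<forall>j'\<in>{1..r i}. j' \<noteq> j \<longrightarrow> d (Source i j') = 0)"
  proof
    fix i assume "i \<in> {1..m} - {a, b}"
    then have "i \<in> {1..m}" "i \<noteq> a" "i \<noteq> b" by auto
    from full[OF this] show "\<exists>j. j \<in> {1..r i} \<and> d (Source i j) = n \<and>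
        (\<forall>j'\<in>{1..r i}. j' \<noteq> j \<longrightarrow> d (Source i j') = 0)"
      unfolding n_def by blast
  qed
  from bchoice[OF this] obtain c where c: "\<forall>i\<in>{1..m} - {a, b}. c i \<in> {1..r i} \<and> d (Source i (c i)) = n \<and>
        (\<forall>j'\<in>{1..r i}. j' \<noteq> c i \<longrightarrow> d (Source i j') = 0)" ..
  have split1: "\<exists>R. splitting n {1..r i} (\<lambda>j. d (Source i j)) (\<lambda>j. X (i, j)) R"
    if i: "i \<in> {1..m} - {a, b}" for i
  proof (rule splitting_of_trivial_kernel)
    fix x assume x: "\<And>j. j \<in> {1..r i} \<Longrightarrow> x j \<in> carrier_vec (d (Source i j))"
      and z: "vsum n (\<lambda>j. X (i, j) *\<^sub>v x j) {1..r i} = 0\<^sub>v n"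
    have ci: "c i \<in> {1..r i}" and c0: "\<And>j. j \<in> {1..r i} \<Longrightarrow> j \<noteq> c i \<Longrightarrow> d (Source i j) = 0" using c i by auto
    have Xc: "X (i, c i) *\<^sub>v x (c i) \<in> carrier_vec n" using X[of i "c i"] x[OF ci] ci i by auto
    have "vsum n (\<lambda>j. X (i, j) *\<^sub>v x j) {1..r i} = vsum n (\<lambda>j. X (i, j) *\<^sub>v x j) {c i}"
    proof (rule vsum_supported)
      fix j assume "j \<in> {1..r i}" "j \<notin> {c i}"
      then show "X (i, j) *\<^sub>v x j = 0\<^sub>v n"
        using X[of i j] x[of j] c0[of j] i by (intro mult_mat_vec_empty) auto
    qed (use ci in auto)
    also have "\<dots> = X (i, c i) *\<^sub>v x (c i)" using Xc by (rule vsum_singleton)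
    finally have "x (c i) = 0\<^sub>v (d (Source i (c i)))" using z i ci x by (intro inj) auto
    then show "\<forall>j\<in>{1..r i}. x j = 0\<^sub>v (d (Source i j))"
      using x c0 zero_dim_vec by metis
  qed (use X bal i in auto)
  have split2: "\<exists>R. splitting n {1..r i} (\<lambda>j. d (Source i j)) (\<lambda>j. X (i, j)) R"
    if i: "i = a \<or> i = b" and j: "j1 \<in> {1..r i}" "j2 \<in> {1..r i}" "j1 \<noteq> j2"
      and zi: "\<And>j. j \<in> {1..r i} \<Longrightarrow> j \<noteq> j1 \<Longrightarrow> j \<noteq> j2 \<Longrightarrow> d (Source i j) = 0" for i j1 j2
  proof (rule splitting_of_trivial_kernel)
    have im: "i \<in> {1..m}" using i ab by auto
    fix x assume x: "\<And>j. j \<in> {1..r i} \<Longrightarrow> x j \<in> carrier_vec (d (Source i j))"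
      and z: "vsum n (\<lambda>j. X (i, j) *\<^sub>v x j) {1..r i} = 0\<^sub>v n"
    let ?u = "X (i, j1) *\<^sub>v x j1"
    have Xc: "X (i, j) *\<^sub>v x j \<in> carrier_vec n" if "j \<in> {1..r i}" for j using X[OF im that] x[OF that] by auto
    have "vsum n (\<lambda>j. X (i, j) *\<^sub>v x j) {1..r i} = vsum n (\<lambda>j. X (i, j) *\<^sub>v x j) {j1, j2}"
    proof (rule vsum_supported)
      fix j assume "j \<in> {1..r i}" "j \<notin> {j1, j2}"
      then show "X (i, j) *\<^sub>v x j = 0\<^sub>v n" using X[OF im, of j] x[of j] zi[of j] by (intro mult_mat_vec_empty) auto
    qed (use j in auto)
    then have "?u $ p + (X (i, j2) *\<^sub>v x j2) $ p = 0" if "p < n" for p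
      using arg_cong[OF z, of "\<lambda>v. v $ p"] that j(3) by simp
    moreover have "(-1) \<cdot>\<^sub>v y2 = y1" if "y1 \<in> carrier_vec n" "y2 \<in> carrier_vec n" "\<And>p. p < n \<Longrightarrow> y1 $ p + y2 $ p = 0"
      for y1 y2 :: "'k vec"
      using that by (intro eq_vecI) (auto simp: eq_neg_iff_add_eq_0 neg_eq_iff_add_eq_0 add.commute)
    ultimately have "(-1) \<cdot>\<^sub>v (X (i, j2) *\<^sub>v x j2) = ?u" using Xc[OF j(1)] Xc[OF j(2)] by blast
    then have u2: "X (i, j2) *\<^sub>v ((-1) \<cdot>\<^sub>v x j2) = ?u"
      using mult_mat_vec[OF X[OF im j(2)] x[OF j(2)], of "-1"] by simp
    have u0: "?u = 0\<^sub>v n"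
    proof (rule ccontr)
      assume u: "?u \<noteq> 0\<^sub>v n"
      \<comment> \<open>The sources over which \<open>?u\<close> is in the image: two for the group \<open>i\<close>, and one for each group with an
        entry \<open>n\<close>; that makes \<open>m\<close>.\<close>
      let ?P = "{(i, j1), (i, j2)} \<union> (\<lambda>i. (i, c i)) ` ({1..m} - {a, b})"
      have "\<forall>i'\<in>{1..m} - {a, b}. \<exists>y. y \<in> carrier_vec n \<and> X (i', c i') *\<^sub>v y = ?u"
      proof
        fix i' assume i': "i' \<in> {1..m} - {a, b}"
        then obtain R where s: "splitting n {1..r i'} (\<lambda>j. d (Source i' j)) (\<lambda>j. X (i', j)) R"
          using split1 by blast
        have ci: "c i' \<in> {1..r i'}" "d (Source i' (c i')) = n" using c i' by auto
        have "X (i', c i') *\<^sub>v (R (c i') *\<^sub>v ?u) = ?u"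
          using c i' by (intro splitting_one_summand[OF s ci(1) _ Xc[OF j(1)]]) auto
        moreover have "R (c i') *\<^sub>v ?u \<in> carrier_vec n"
          using splittingD(3)[OF s ci(1)] ci(2) Xc[OF j(1)] by auto
        ultimately show "\<exists>y. y \<in> carrier_vec n \<and> X (i', c i') *\<^sub>v y = ?u" by blast
      qed
      from bchoice[OF this] obtain y where
        y: "\<forall>i'\<in>{1..m} - {a, b}. y i' \<in> carrier_vec n \<and> X (i', c i') *\<^sub>v y i' = ?u" ..
      define x' where "x' i' j = (if i' \<noteq> i then y i' else if j = j1 then x j1 else (-1) \<cdot>\<^sub>v x j2)" for i' j
      have "card ?P < m"
      proof (rule stable_common_vector[OF st, where u = ?u and x = x'])
        show "2 \<le> d Sink" "?u \<in> carrier_vec (d Sink)" "?u \<noteq> 0\<^sub>v (d Sink)"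
          using n Xc[OF j(1)] u by (auto simp: n_def)
        show "?P \<subseteq> (SIGMA i:{1..m}. {1..r i})" using im j c by auto
        fix i' j assume P: "(i', j) \<in> ?P"
        show "x' i' j \<in> carrier_vec (d (Source i' j)) \<and> X (i', j) *\<^sub>v x' i' j = ?u"
        proof (cases "i' = i")
          case True
          then have "j = j1 \<or> j = j2" using P i by auto
          then show ?thesis using True u2 x[OF j(1)] x[OF j(2)] j(3) unfolding x'_def by auto
        next
          case False
          then have "i' \<in> {1..m} - {a, b}" "j = c i'" using P by auto
          then show ?thesis using False y c unfolding x'_def by auto
        qed
      qed
      moreover have "card ?P = m"
      proof -
        have "card ({1..m} - {a, b}) = m - 2" "m \<ge> 2"
          using ab card_mono[of "{1..m}" "{a, b}"] by (auto simp: card_Diff_subset)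
        moreover have "card ((\<lambda>i. (i, c i)) ` ({1..m} - {a, b})) = card ({1..m} - {a, b})"
          by (intro card_image) (auto simp: inj_on_def)
        moreover have "card {(i, j1), (i, j2)} = 2" using j(3) by simp
        moreover have "{(i, j1), (i, j2)} \<inter> (\<lambda>i. (i, c i)) ` ({1..m} - {a, b}) = {}" using i by auto
        ultimately show ?thesis by (subst card_Un_disjoint) auto
      qed
      ultimately show False by simp
    qed
    then have x1: "x j1 = 0\<^sub>v (d (Source i j1))" using inj[OF im j(1) x[OF j(1)]] by simp
    have neg: "(-1) \<cdot>\<^sub>v x j2 = 0\<^sub>v (d (Source i j2))" using u0 u2 x[OF j(2)] by (intro inj[OF im j(2)]) auto
    have "x j2 $ q = 0" if "q < d (Source i j2)" for q
      using arg_cong[OF neg, of "\<lambda>v. v $ q"] that smult_vec_nth[OF x[OF j(2)] that, of "-1"] by simp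
    then have "x j2 = 0\<^sub>v (d (Source i j2))" using x[OF j(2)] by (intro eq_vecI) auto
    then show "\<forall>j\<in>{1..r i}. x j = 0\<^sub>v (d (Source i j))" using x1 x zi zero_dim_vec by metis
  qed (use X bal i ab in auto)
  have "\<exists>R. star_splitting m r d X R"
  proof (rule star_splitting_exists)
    fix i assume "i \<in> {1..m}"
    then show "\<exists>R. splitting (d Sink) {1..r i} (\<lambda>j. d (Source i j)) (\<lambda>j. X (i, j)) R"
      using split1[of i] split2[OF _ a za] split2[OF _ b zb] unfolding n_def by blast
  qed
  then obtain R where sR: "star_splitting m r d X R" ..
  have s: "splitting n {1..r i} (\<lambda>j. d (Source i j)) (\<lambda>j. X (i, j)) (\<lambda>j. R (i, j))" if "i \<in> {1..m}" for i
    using star_splittingD[OF sR that] by (simp add: n_def)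
  define k where "k = d (Source a a1)"
  have k: "d (Source b b1) = k" "n = 2 * k" "k \<ge> 1" using half n by (auto simp: k_def n_def)
  have Xa: "X (a, a1) \<in> carrier_mat n k" and Xb: "X (b, b1) \<in> carrier_mat n k" 
    using X[OF ab(1) a(1), folded k_def] X[OF ab(2) b(1), unfolded k(1)] by auto
  have Ra: "R (a, a1) \<in> carrier_mat k n" and Rb: "R (b, b1) \<in> carrier_mat k n"
    using splittingD(3)[OF s[OF ab(1)] a(1), folded k_def] splittingD(3)[OF s[OF ab(2)] b(1), unfolded k(1)]
    by auto
  \<comment> \<open>\<open>T\<close> is \<open>E E'\<close> on the image of \<open>E\<close>, in the coordinates given by \<open>X (a, a1)\<close>.\<close>
  define T where "T = R (a, a1) * (X (b, b1) * (R (b, b1) * X (a, a1)))"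
  have T: "T \<in> carrier_mat k k" using Xa Xb Ra Rb by (simp add: T_def)
  obtain x \<mu> where x: "x \<in> carrier_vec k" "x \<noteq> 0\<^sub>v k" "T *\<^sub>v x = \<mu> \<cdot>\<^sub>v x"
    using eigenvector_exists[OF T k(3)] by blast
  define v where "v = X (a, a1) *\<^sub>v x"
  define w where "w = X (b, b1) *\<^sub>v (R (b, b1) *\<^sub>v v)"
  have v: "v \<in> carrier_vec n" and w: "w \<in> carrier_vec n" using Xa Xb Rb x by (auto simp: v_def w_def)
  have Rbv: "R (b, b1) *\<^sub>v v \<in> carrier_vec k" using Rb v by auto
  have Rav: "R (a, a1) *\<^sub>v v = x"
    using splittingD(4)[OF s[OF ab(1)] a(1) a(1), of x] x by (simp add: v_def k_def)
  have Raw: "R (a, a1) *\<^sub>v w = \<mu> \<cdot>\<^sub>v x"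
  proof -
    have "T *\<^sub>v x = R (a, a1) *\<^sub>v ((X (b, b1) * (R (b, b1) * X (a, a1))) *\<^sub>v x)"
      unfolding T_def using Ra Xb Rb Xa x(1) by (intro assoc_mult_mat_vec) auto
    also have "(X (b, b1) * (R (b, b1) * X (a, a1))) *\<^sub>v x = X (b, b1) *\<^sub>v ((R (b, b1) * X (a, a1)) *\<^sub>v x)"
      using Xb Rb Xa x(1) by (intro assoc_mult_mat_vec) auto
    also have "(R (b, b1) * X (a, a1)) *\<^sub>v x = R (b, b1) *\<^sub>v v"
      unfolding v_def using Rb Xa x(1) by (intro assoc_mult_mat_vec) auto
    finally show ?thesis using x(3) by (simp add: w_def)
  qed
  have Eaw: "X (a, a1) *\<^sub>v (R (a, a1) *\<^sub>v w) = \<mu> \<cdot>\<^sub>v v"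
    unfolding Raw v_def by (rule mult_mat_vec[OF Xa x(1)])
  have Ebw: "X (b, b1) *\<^sub>v (R (b, b1) *\<^sub>v w) = w"
    using splittingD(4)[OF s[OF ab(2)] b(1) b(1), of "R (b, b1) *\<^sub>v v"] Rbv k(1) by (simp add: w_def)
  define W where "W = {\<alpha> \<cdot>\<^sub>v v + \<beta> \<cdot>\<^sub>v w | \<alpha> \<beta>. True}"
  have WI: "\<alpha> \<cdot>\<^sub>v v + \<beta> \<cdot>\<^sub>v w \<in> W" for \<alpha> \<beta> by (auto simp: W_def)
  have "1 \<cdot>\<^sub>v v + 0 \<cdot>\<^sub>v w = v" "0 \<cdot>\<^sub>v v + 1 \<cdot>\<^sub>v w = w"
    using v w by (auto intro!: eq_vecI)
  then have vW: "v \<in> W" and wW: "w \<in> W" using WI[of 1 0] WI[of 0 1] by auto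
  have Ws: "vec_subspace n W"
    unfolding vec_subspace_iff
  proof (intro conjI ballI allI)
    show "W \<subseteq> carrier_vec n" using v w by (auto simp: W_def)
    have "0\<^sub>v n = 0 \<cdot>\<^sub>v v + 0 \<cdot>\<^sub>v w" using v w by (intro eq_vecI) auto
    then show "0\<^sub>v n \<in> W" using WI by metis
    fix y assume "y \<in> W"
    then obtain \<alpha> \<beta> where y: "y = \<alpha> \<cdot>\<^sub>v v + \<beta> \<cdot>\<^sub>v w" by (auto simp: W_def)
    show "e \<cdot>\<^sub>v y \<in> W" for e
    proof -
      have "e \<cdot>\<^sub>v y = (e * \<alpha>) \<cdot>\<^sub>v v + (e * \<beta>) \<cdot>\<^sub>v w" using v w y by (intro eq_vecI) (auto simp: algebra_simps)
      then show ?thesis using WI by metis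
    qed
    fix y' assume "y' \<in> W"
    then obtain \<alpha>' \<beta>' where y': "y' = \<alpha>' \<cdot>\<^sub>v v + \<beta>' \<cdot>\<^sub>v w" by (auto simp: W_def)
    have "y + y' = (\<alpha> + \<alpha>') \<cdot>\<^sub>v v + (\<beta> + \<beta>') \<cdot>\<^sub>v w" using v w y y' by (intro eq_vecI) (auto simp: algebra_simps)
    then show "y + y' \<in> W" using WI by metis
  qed
  have Winv: "X (i, j) *\<^sub>v (R (i, j) *\<^sub>v y) \<in> W"
    if i: "i \<in> {1..m}" and j: "j \<in> {1..r i}" and y: "y \<in> W" and
      base: "X (i, j) *\<^sub>v (R (i, j) *\<^sub>v v) \<in> W" "X (i, j) *\<^sub>v (R (i, j) *\<^sub>v w) \<in> W" for i j y
  proof -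
    obtain \<alpha> \<beta> where y: "y = \<alpha> \<cdot>\<^sub>v v + \<beta> \<cdot>\<^sub>v w" using y by (auto simp: W_def)
    have Xij: "X (i, j) \<in> carrier_mat n (d (Source i j))" and Rij: "R (i, j) \<in> carrier_mat (d (Source i j)) n"
      using X[OF i j] splittingD(3)[OF s[OF i] j] by auto
    have "X (i, j) *\<^sub>v (R (i, j) *\<^sub>v y) =
        \<alpha> \<cdot>\<^sub>v (X (i, j) *\<^sub>v (R (i, j) *\<^sub>v v)) + \<beta> \<cdot>\<^sub>v (X (i, j) *\<^sub>v (R (i, j) *\<^sub>v w))"
      unfolding y using v w Xij Rij
      by (simp add: mult_add_distrib_mat_vec[OF Rij] mult_mat_vec[OF Rij] mult_add_distrib_mat_vec[OF Xij] mult_mat_vec[OF Xij])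
    then show ?thesis using Ws base by (simp add: vec_subspace_iff)
  qed
  have Wdiff: "y - y' \<in> W" if "y \<in> W" "y' \<in> W" for y y'
  proof -
    have "y \<in> carrier_vec n" "y' \<in> carrier_vec n" using that vec_subspace_carrier[OF Ws] by auto
    then have "y - y' = y + (-1) \<cdot>\<^sub>v y'" by (intro eq_vecI) auto
    then show ?thesis using that Ws by (simp add: vec_subspace_iff)
  qed
  have zero: "X (i, j) *\<^sub>v (R (i, j) *\<^sub>v y) \<in> W"
    if "i \<in> {1..m}" "j \<in> {1..r i}" "d (Source i j) = 0" "y \<in> W" for i j y
  proof -
    have "y \<in> carrier_vec n" using that(4) vec_subspace_carrier[OF Ws] by auto
    then have "X (i, j) *\<^sub>v (R (i, j) *\<^sub>v y) = 0\<^sub>v n"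
      using X[OF that(1,2)] splittingD(3)[OF s[OF that(1)] that(2)] that(3) by (intro mult_mat_vec_empty) auto
    then show ?thesis using Ws by (simp add: vec_subspace_iff)
  qed
  have two: "X (i, j) *\<^sub>v (R (i, j) *\<^sub>v y) \<in> W"
    if i: "i \<in> {1..m}" and j12: "j1 \<in> {1..r i}" "j2 \<in> {1..r i}" "j1 \<noteq> j2"
      and zi: "\<And>j. j \<in> {1..r i} \<Longrightarrow> j \<noteq> j1 \<Longrightarrow> j \<noteq> j2 \<Longrightarrow> d (Source i j) = 0"
      and base: "X (i, j1) *\<^sub>v (R (i, j1) *\<^sub>v v) \<in> W" "X (i, j1) *\<^sub>v (R (i, j1) *\<^sub>v w) \<in> W"
      and j: "j \<in> {1..r i}" and y: "y \<in> W" for i j1 j2 j y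
  proof -
    have 1: "X (i, j1) *\<^sub>v (R (i, j1) *\<^sub>v y) \<in> W" by (rule Winv[OF i j12(1) y base])
    have "X (i, j2) *\<^sub>v (R (i, j2) *\<^sub>v y) = y - X (i, j1) *\<^sub>v (R (i, j1) *\<^sub>v y)"
      using splitting_two_summands[OF s[OF i] j12, of y] zi vec_subspace_carrier[OF Ws y] by auto
    then have 2: "X (i, j2) *\<^sub>v (R (i, j2) *\<^sub>v y) \<in> W" using 1 y Wdiff by simp
    show ?thesis using 1 2 zero[OF i j _ y] zi[OF j] by (cases "j = j1"; cases "j = j2") auto
  qed
  have "W = {0\<^sub>v n} \<or> W = carrier_vec n"
  proof -
    have "X (i, j) *\<^sub>v (R (i, j) *\<^sub>v y) \<in> W" if ij: "i \<in> {1..m}" "j \<in> {1..r i}" and y: "y \<in> W" for i j y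
    proof -
      consider "i = a" | "i = b" | "i \<in> {1..m} - {a, b}" using ij by blast
      then show ?thesis
      proof cases
        case 1
        have p1: "X (a, a1) *\<^sub>v (R (a, a1) *\<^sub>v v) \<in> W" using Rav vW by (simp add: v_def)
        have p2: "X (a, a1) *\<^sub>v (R (a, a1) *\<^sub>v w) \<in> W" using Eaw vec_subspace_smult[OF Ws vW] by simp
        show ?thesis unfolding 1 by (rule two[OF ab(1) a _ p1 p2 _ y]) (use za ij 1 in auto)
      next
        case 2
        have p1: "X (b, b1) *\<^sub>v (R (b, b1) *\<^sub>v v) \<in> W" using wW by (simp add: w_def)
        have p2: "X (b, b1) *\<^sub>v (R (b, b1) *\<^sub>v w) \<in> W" using Ebw wW by simp
        show ?thesis unfolding 2 by (rule two[OF ab(2) b _ p1 p2 _ y]) (use zb ij 2 in auto)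
      next
        case 3
        show ?thesis
        proof (cases "j = c i")
          case True
          have "c i \<in> {1..r i}" using c 3 by auto
          have "X (i, c i) *\<^sub>v (R (i, c i) *\<^sub>v y) = y"
            using splitting_one_summand[OF s[OF ij(1)] \<open>c i \<in> {1..r i}\<close>, of y] c 3 vec_subspace_carrier[OF Ws y] by auto
          then show ?thesis using True y by simp
        next
          case False
          then show ?thesis using zero[OF ij _ y] c 3 ij(2) by auto
        qed
      qed
    qed
    then show ?thesis
      using stable_imp_irreducible[OF st sR] Ws unfolding irreducible_star_def n_def by blast
  qed
  moreover have "v \<noteq> 0\<^sub>v n" using inj[OF ab(1) a(1), of x] x by (auto simp: v_def k_def)
  ultimately have "W = carrier_vec n" using vW by auto
  have "vec_subspace_dim n W \<le> card {False, True}"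
  proof (rule dim_le_card_spanning[OF Ws, where v = "\<lambda>t. if t then w else v"])
    fix y assume "y \<in> W"
    then obtain \<alpha> \<beta> where "y = \<alpha> \<cdot>\<^sub>v v + \<beta> \<cdot>\<^sub>v w" by (auto simp: W_def)
    then have "y = vsum n (\<lambda>t. (if t then \<beta> else \<alpha>) \<cdot>\<^sub>v (if t then w else v)) {False, True}"
      using v w by (intro eq_vecI) auto
    then show "\<exists>e. y = vsum n (\<lambda>t. e t \<cdot>\<^sub>v (if t then w else v)) {False, True}"
      by (intro exI[of _ "\<lambda>t. if t then \<beta> else \<alpha>"])
  qed (use v w in auto)
  then have "n \<le> 2" using \<open>W = carrier_vec n\<close> by (simp add: dim_carrier_vec)
  then show ?thesis using n by (simp add: n_def)
qed

section \<open>Polynomial maps from fewer variables\<close>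

text \<open>Over a finite field the polynomial \<open>1 + \<Prod> (x - a)\<close> has no root.\<close>

lemma infinite_UNIV_alg_closed: "infinite (UNIV :: 'k::alg_closed_field set)"
proof
  assume fin: "finite (UNIV :: 'k set)"
  define p :: "'k poly" where "p = (\<Prod>a\<in>UNIV. [:- a, 1:])"
  have dp: "degree p = card (UNIV :: 'k set)" unfolding p_def by (subst degree_prod_eq_sum_degree) auto
  have pos: "0 < card (UNIV :: 'k set)" using fin by (simp add: card_gt_0_iff)
  have "degree (1 + p) = degree p" using dp pos by (intro degree_add_eq_right) simp
  then obtain x where "poly (1 + p) x = 0" using alg_closed_imp_poly_has_root[of "1 + p"] dp pos by auto
  moreover have "poly p x = 0" using fin by (auto simp: p_def poly_prod)
  ultimately show False by simp
qed

text \<open>Polynomial functions in the variables \<open>B\<close>.  Over an infinite field they carry the same information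
  as polynomials.\<close>

inductive_set poly_funs :: "'b set \<Rightarrow> (('b \<Rightarrow> 'k::field) \<Rightarrow> 'k) set" for B where
  const: "(\<lambda>x. c) \<in> poly_funs B"
| coord: "b \<in> B \<Longrightarrow> (\<lambda>x. x b) \<in> poly_funs B"
| add: "\<lbrakk>f \<in> poly_funs B; g \<in> poly_funs B\<rbrakk> \<Longrightarrow> (\<lambda>x. f x + g x) \<in> poly_funs B"
| mult: "\<lbrakk>f \<in> poly_funs B; g \<in> poly_funs B\<rbrakk> \<Longrightarrow> (\<lambda>x. f x * g x) \<in> poly_funs B"

lemma poly_funs_sum: "(\<And>i. i \<in> I \<Longrightarrow> f i \<in> poly_funs B) \<Longrightarrow> (\<lambda>x. \<Sum>i\<in>I. f i x) \<in> poly_funs B"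
  by (induction I rule: infinite_finite_induct) (auto intro: poly_funs.intros)

lemma poly_funs_prod: "(\<And>i. i \<in> I \<Longrightarrow> f i \<in> poly_funs B) \<Longrightarrow> (\<lambda>x. \<Prod>i\<in>I. f i x) \<in> poly_funs B"
  by (induction I rule: infinite_finite_induct) (auto intro: poly_funs.intros)

lemma poly_funs_power: "f \<in> poly_funs B \<Longrightarrow> (\<lambda>x. f x ^ N) \<in> poly_funs B"
  by (induction N) (auto intro: poly_funs.intros)

lemma poly_funs_diff:
  assumes "f \<in> poly_funs B" "g \<in> poly_funs B"
  shows "(\<lambda>x. f x - g x) \<in> poly_funs B"
proof -
  have "(\<lambda>x. f x + (- 1) * g x) \<in> poly_funs B"
    using assms by (intro poly_funs.intros)
  then show ?thesis by simp
qed

text \<open>The functions given by polynomials with all exponents at most \<open>N\<close>.  They are the linear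
  combinations of \<open>(N + 1) ^ card B\<close> monomials, and this number is what is counted below.\<close>

definition bounded_polys :: "'b set \<Rightarrow> nat \<Rightarrow> (('b \<Rightarrow> 'k::field) \<Rightarrow> 'k) set" where
  "bounded_polys B N = {f. \<exists>c. \<forall>x. f x = (\<Sum>\<alpha>\<in>B \<rightarrow>\<^sub>E {..N}. c \<alpha> * (\<Prod>b\<in>B. x b ^ \<alpha> b))}"

lemma bounded_polys_zero: "(\<lambda>x. 0) \<in> bounded_polys B N"
  by (auto simp: bounded_polys_def intro: exI[of _ "\<lambda>_. 0"])

lemma bounded_polys_add:
  assumes "f \<in> bounded_polys B N" "g \<in> bounded_polys B N"
  shows "(\<lambda>x. f x + g x) \<in> bounded_polys B N"
proof -
  obtain c c' where
    "\<forall>x. f x = (\<Sum>\<alpha>\<in>B \<rightarrow>\<^sub>E {..N}. c \<alpha> * (\<Prod>b\<in>B. x b ^ \<alpha> b))"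
    "\<forall>x. g x = (\<Sum>\<alpha>\<in>B \<rightarrow>\<^sub>E {..N}. c' \<alpha> * (\<Prod>b\<in>B. x b ^ \<alpha> b))"
    using assms by (auto simp: bounded_polys_def)
  then show ?thesis unfolding bounded_polys_def
    by (auto intro!: exI[of _ "\<lambda>\<alpha>. c \<alpha> + c' \<alpha>"] simp: distrib_right sum.distrib)
qed

lemma bounded_polys_sum:
  "(\<And>i. i \<in> I \<Longrightarrow> f i \<in> bounded_polys B N) \<Longrightarrow> (\<lambda>x. \<Sum>i\<in>I. f i x) \<in> bounded_polys B N"
  by (induction I rule: infinite_finite_induct) (auto intro: bounded_polys_add bounded_polys_zero)

lemma bounded_polys_monomial:
  assumes "finite B" "\<And>b. b \<in> B \<Longrightarrow> \<alpha> b \<le> N"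
  shows "(\<lambda>x. c * (\<Prod>b\<in>B. x b ^ \<alpha> b)) \<in> bounded_polys B N"
proof -
  let ?\<alpha> = "restrict \<alpha> B"
  have fin: "finite (B \<rightarrow>\<^sub>E {..N})" using assms(1) by (intro finite_PiE) auto
  have "c * (\<Prod>b\<in>B. x b ^ \<alpha> b) =
      (\<Sum>\<beta>\<in>B \<rightarrow>\<^sub>E {..N}. (if \<beta> = ?\<alpha> then c else 0) * (\<Prod>b\<in>B. x b ^ \<beta> b))" for x :: "'a \<Rightarrow> 'b"
  proof -
    have "(\<Sum>\<beta>\<in>B \<rightarrow>\<^sub>E {..N}. (if \<beta> = ?\<alpha> then c else 0) * (\<Prod>b\<in>B. x b ^ \<beta> b))
        = (\<Sum>\<beta>\<in>B \<rightarrow>\<^sub>E {..N}. if \<beta> = ?\<alpha> then c * (\<Prod>b\<in>B. x b ^ \<beta> b) else 0)"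
      by (intro sum.cong) auto
    also have "\<dots> = c * (\<Prod>b\<in>B. x b ^ ?\<alpha> b)"
      using fin assms(2) by (subst sum.delta) auto
    also have "\<dots> = c * (\<Prod>b\<in>B. x b ^ \<alpha> b)" by simp
    finally show ?thesis by simp
  qed
  then show ?thesis unfolding bounded_polys_def
    by (auto intro!: exI[of _ "\<lambda>\<beta>. if \<beta> = ?\<alpha> then c else 0"])
qed

lemma bounded_polys_mult:
  assumes B: "finite B" and f: "f \<in> bounded_polys B N" and g: "g \<in> bounded_polys B N'"
  shows "(\<lambda>x. f x * g x) \<in> bounded_polys B (N + N')"
proof -
  obtain c c' where
    f: "\<And>x. f x = (\<Sum>\<alpha>\<in>B \<rightarrow>\<^sub>E {..N}. c \<alpha> * (\<Prod>b\<in>B. x b ^ \<alpha> b))" and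
    g: "\<And>x. g x = (\<Sum>\<alpha>\<in>B \<rightarrow>\<^sub>E {..N'}. c' \<alpha> * (\<Prod>b\<in>B. x b ^ \<alpha> b))"
    using f g by (auto simp: bounded_polys_def)
  have "(\<lambda>x. f x * g x) = (\<lambda>x. \<Sum>\<alpha>\<in>B \<rightarrow>\<^sub>E {..N}. \<Sum>\<beta>\<in>B \<rightarrow>\<^sub>E {..N'}.
          (c \<alpha> * c' \<beta>) * (\<Prod>b\<in>B. x b ^ (\<alpha> b + \<beta> b)))"
    unfolding f g sum_product by (intro ext sum.cong refl) (simp add: power_add prod.distrib)
  also have "\<dots> \<in> bounded_polys B (N + N')"
    using B by (intro bounded_polys_sum bounded_polys_monomial add_mono) (auto simp: PiE_iff)
  finally show ?thesis .
qed

lemma bounded_polys_mono: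
  assumes "finite B" "f \<in> bounded_polys B N" "N \<le> N'"
  shows "f \<in> bounded_polys B N'"
proof -
  obtain c where f: "\<And>x. f x = (\<Sum>\<alpha>\<in>B \<rightarrow>\<^sub>E {..N}. c \<alpha> * (\<Prod>b\<in>B. x b ^ \<alpha> b))"
    using assms(2) by (auto simp: bounded_polys_def)
  have "(\<lambda>x. \<Sum>\<alpha>\<in>B \<rightarrow>\<^sub>E {..N}. c \<alpha> * (\<Prod>b\<in>B. x b ^ \<alpha> b)) \<in> bounded_polys B N'"
    using assms by (intro bounded_polys_sum bounded_polys_monomial) (auto simp: PiE_iff dest!: bspec)
  moreover have "f = (\<lambda>x. \<Sum>\<alpha>\<in>B \<rightarrow>\<^sub>E {..N}. c \<alpha> * (\<Prod>b\<in>B. x b ^ \<alpha> b))" using f by blast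
  ultimately show ?thesis by simp
qed

lemma bounded_polys_const: "finite B \<Longrightarrow> (\<lambda>x. c) \<in> bounded_polys B N"
  using bounded_polys_monomial[of B "\<lambda>_. 0" N c] by simp

lemma bounded_polys_power:
  assumes "finite B" "f \<in> bounded_polys B N"
  shows "(\<lambda>x. f x ^ k) \<in> bounded_polys B (k * N)"
proof (induction k)
  case (Suc k)
  then show ?case using bounded_polys_mult[OF assms Suc] by simp
qed (use assms bounded_polys_const in auto)

lemma bounded_polys_prod:
  assumes "finite B" "\<And>i. i \<in> I \<Longrightarrow> f i \<in> bounded_polys B (N i)"
  shows "(\<lambda>x. \<Prod>i\<in>I. f i x) \<in> bounded_polys B (\<Sum>i\<in>I. N i)"
  using assms(2)
proof (induction I rule: infinite_finite_induct)
  case (insert i I)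
  then show ?case using bounded_polys_mult[OF assms(1), of "f i" "N i"] by simp
qed (use assms bounded_polys_const in auto)

lemma poly_funs_bounded:
  assumes B: "finite B" and "f \<in> poly_funs B"
  shows "\<exists>N. f \<in> bounded_polys B N"
  using assms(2)
proof (induction rule: poly_funs.induct)
  case (const c)
  then show ?case using bounded_polys_const[OF B] by blast
next
  case (coord b)
  have "(\<Prod>b'\<in>B. x b' ^ (if b' = b then 1 else 0)) = x b" for x :: "'a \<Rightarrow> 'b"
  proof -
    have "(\<Prod>b'\<in>B. x b' ^ (if b' = b then 1 else 0)) = (\<Prod>b'\<in>B. if b' = b then x b' else 1)"
      by (intro prod.cong) auto
    then show ?thesis using B coord by simp
  qed
  then have "(\<lambda>x :: 'a \<Rightarrow> 'b. 1 * (\<Prod>b'\<in>B. x b' ^ (if b' = b then 1 else 0))) = (\<lambda>x. x b)" by simp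
  moreover have "(\<lambda>x :: 'a \<Rightarrow> 'b. 1 * (\<Prod>b'\<in>B. x b' ^ (if b' = b then 1 else 0))) \<in> bounded_polys B 1"
    by (rule bounded_polys_monomial[OF B]) simp
  ultimately show ?case by auto
next
  case (add f g)
  then obtain N N' where fg: "f \<in> bounded_polys B N" "g \<in> bounded_polys B N'" by blast
  have "f \<in> bounded_polys B (max N N')" "g \<in> bounded_polys B (max N N')"
    by (rule bounded_polys_mono[OF B fg(1)] bounded_polys_mono[OF B fg(2)], simp)+
  then show ?case using bounded_polys_add by blast
next
  case (mult f g)
  then show ?case using bounded_polys_mult[OF B] by blast
qed

text \<open>Induction on the variables: after the other variables have been given suitable values, a non-zero
  polynomial in one variable remains.\<close>

lemma nonzero_coeff_imp_nonzero_value: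
  fixes c :: "('b \<Rightarrow> nat) \<Rightarrow> 'k::field"
  assumes "finite B" and inf: "infinite (UNIV :: 'k set)"
    and "\<beta> \<in> B \<rightarrow>\<^sub>E {..N}" "c \<beta> \<noteq> 0"
  shows "\<exists>x. (\<Sum>\<alpha>\<in>B \<rightarrow>\<^sub>E {..N}. c \<alpha> * (\<Prod>b\<in>B. x b ^ \<alpha> b)) \<noteq> 0"
  using assms(1,3,4)
proof (induction B arbitrary: c \<beta> rule: finite_induct)
  case (insert b B)
  define g where "g i x = (\<Sum>\<alpha>\<in>B \<rightarrow>\<^sub>E {..N}. c (\<alpha>(b := i)) * (\<Prod>b\<in>B. x b ^ \<alpha> b))" for i x
  let ?\<beta> = "\<beta>(b := undefined)"
  have b: "?\<beta> \<in> B \<rightarrow>\<^sub>E {..N}" "?\<beta>(b := \<beta> b) = \<beta>" "\<beta> b \<le> N"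
    using insert.prems insert.hyps by (auto simp: PiE_iff extensional_def)
  have "\<exists>x. g (\<beta> b) x \<noteq> 0" unfolding g_def
  proof (rule insert.IH)
    show "?\<beta> \<in> B \<rightarrow>\<^sub>E {..N}" by (fact b(1))
    show "c (?\<beta>(b := \<beta> b)) \<noteq> 0" unfolding b(2) by (fact insert.prems(2))
  qed
  then obtain x where x: "g (\<beta> b) x \<noteq> 0" by blast
  define p where "p = (\<Sum>i\<le>N. Polynomial.monom (g i x) i)"
  have "Polynomial.coeff p (\<beta> b) = g (\<beta> b) x"
    using b(3) by (simp add: p_def coeff_sum)
  then have "p \<noteq> 0" using x by auto
  then have "finite {z. poly p z = 0}" by (rule poly_roots_finite)
  then obtain z where z: "poly p z \<noteq> 0"
    using inf by (metis (mono_tags, lifting) UNIV_I finite_subset mem_Collect_eq subsetI)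
  have "(\<Sum>\<alpha>\<in>insert b B \<rightarrow>\<^sub>E {..N}. c \<alpha> * (\<Prod>b'\<in>insert b B. (x(b := z)) b' ^ \<alpha> b'))
      = (\<Sum>(i, \<alpha>)\<in>{..N} \<times> (B \<rightarrow>\<^sub>E {..N}). c (\<alpha>(b := i)) *
           (\<Prod>b'\<in>insert b B. (x(b := z)) b' ^ (\<alpha>(b := i)) b'))"
    unfolding PiE_insert_eq
    using insert.hyps
    by (subst sum.reindex) (auto simp: case_prod_beta intro!: inj_combinator)
  also have "\<dots> = (\<Sum>i\<le>N. \<Sum>\<alpha>\<in>B \<rightarrow>\<^sub>E {..N}. c (\<alpha>(b := i)) * (z ^ i * (\<Prod>b'\<in>B. x b' ^ \<alpha> b')))"
  proof -
    have *: "(\<Prod>b'\<in>B. (x(b := z)) b' ^ (\<alpha>(b := i)) b') = (\<Prod>b'\<in>B. x b' ^ \<alpha> b')" for \<alpha> :: "'b \<Rightarrow> nat" and i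
      using insert.hyps by (intro prod.cong) auto
    show ?thesis
      unfolding sum.cartesian_product[symmetric] using insert.hyps * by (simp add: fun_upd_def)
  qed
  also have "\<dots> = (\<Sum>i\<le>N. g i x * z ^ i)"
    by (simp add: g_def sum_distrib_right sum_distrib_left mult_ac)
  also have "\<dots> = poly p z" by (simp add: p_def poly_sum poly_monom)
  finally show ?case using z by metis
qed auto

text \<open>A dimension count for monomials.  Composition with \<open>\<phi>\<close> maps polynomials with exponents at most \<open>D\<close>
  in \<open>card B\<close> variables linearly to polynomials with exponents at most \<open>D * s\<close> in \<open>card A\<close> variables.
  For large \<open>D\<close> the source has the larger dimension, so some non-zero \<open>f\<close> is mapped to zero.\<close>

theorem poly_map_from_fewer_variables_not_dominant:
  fixes \<phi> :: "'b \<Rightarrow> ('a \<Rightarrow> 'k::field) \<Rightarrow> 'k"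
  assumes A: "finite A" and B: "finite B" and less: "card A < card B"
    and \<phi>: "\<And>b. b \<in> B \<Longrightarrow> \<phi> b \<in> poly_funs A"
    and inf: "infinite (UNIV :: 'k set)"
  shows "\<exists>f\<in>poly_funs B. (\<exists>x. f x \<noteq> 0) \<and> (\<forall>t. f (\<lambda>b. \<phi> b t) = 0)"
proof -
  have "\<forall>b\<in>B. \<exists>N. \<phi> b \<in> bounded_polys A N" using poly_funs_bounded[OF A] \<phi> by blast
  then obtain N where N: "\<And>b. b \<in> B \<Longrightarrow> \<phi> b \<in> bounded_polys A (N b)" by metis
  define s where "s = (\<Sum>b\<in>B. N b) + 1"
  define D where "D = s ^ card A"
  let ?E = "B \<rightarrow>\<^sub>E {..D}" and ?E' = "A \<rightarrow>\<^sub>E {..D * s}"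
  have "(\<lambda>t. \<Prod>b\<in>B. \<phi> b t ^ \<beta> b) \<in> bounded_polys A (D * s)" if "\<beta> \<in> ?E" for \<beta>
  proof (rule bounded_polys_mono[OF A])
    show "(\<lambda>t. \<Prod>b\<in>B. \<phi> b t ^ \<beta> b) \<in> bounded_polys A (\<Sum>b\<in>B. \<beta> b * N b)"
      by (intro bounded_polys_prod bounded_polys_power A N)
    have "(\<Sum>b\<in>B. \<beta> b * N b) \<le> (\<Sum>b\<in>B. D * N b)"
      using that by (intro sum_mono mult_right_mono) (auto simp: PiE_iff)
    also have "\<dots> \<le> D * s" by (simp add: s_def sum_distrib_left)
    finally show "(\<Sum>b\<in>B. \<beta> b * N b) \<le> D * s" .
  qed
  then have "\<forall>\<beta>\<in>?E. \<exists>c. \<forall>t. (\<Prod>b\<in>B. \<phi> b t ^ \<beta> b) = (\<Sum>\<alpha>\<in>?E'. c \<alpha> * (\<Prod>a\<in>A. t a ^ \<alpha> a))"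
    by (simp add: bounded_polys_def)
  from bchoice[OF this] obtain c where c: "\<forall>\<beta>\<in>?E. \<forall>t.
      (\<Prod>b\<in>B. \<phi> b t ^ \<beta> b) = (\<Sum>\<alpha>\<in>?E'. c \<beta> \<alpha> * (\<Prod>a\<in>A. t a ^ \<alpha> a))" ..
  have fin: "finite ?E" "finite ?E'" using A B by (auto intro: finite_PiE)
  \<comment> \<open>\<open>D = s ^ card A\<close> is chosen such that \<open>(s * (D + 1)) ^ card A = D * (D + 1) ^ card A\<close>, which is less
    than \<open>(D + 1) ^ (card A + 1)\<close>.\<close>
  have "card ?E' = (D * s + 1) ^ card A" using A by (simp add: card_PiE)
  also have "\<dots> \<le> (s * (D + 1)) ^ card A" by (intro power_mono) (auto simp: s_def)
  also have "\<dots> = D * (D + 1) ^ card A" by (simp only: power_mult_distrib D_def)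
  also have "\<dots> < (D + 1) ^ (card A + 1)" by simp
  also have "\<dots> \<le> (D + 1) ^ card B" using less by (intro power_increasing) auto
  also have "\<dots> = card ?E" using B by (simp add: card_PiE)
  \<comment> \<open>\<open>z\<close> is a relation between the images of the monomials \<open>\<beta>\<close>.\<close>
  finally obtain z where z: "\<exists>\<beta>\<in>?E. z \<beta> \<noteq> 0" "\<forall>\<alpha>\<in>?E'. (\<Sum>\<beta>\<in>?E. c \<beta> \<alpha> * z \<beta>) = 0"
    using linear_system_nontrivial_solution[OF fin(2,1), of "\<lambda>\<alpha> \<beta>. c \<beta> \<alpha>"] by blast
  define f where "f x = (\<Sum>\<beta>\<in>?E. z \<beta> * (\<Prod>b\<in>B. x b ^ \<beta> b))" for x
  have "f \<in> poly_funs B" unfolding f_def[abs_def]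
    by (intro poly_funs_sum poly_funs.mult poly_funs_prod poly_funs_power poly_funs.const poly_funs.coord)
  moreover have "\<exists>x. f x \<noteq> 0" unfolding f_def
    using z(1) nonzero_coeff_imp_nonzero_value[OF B inf] by blast
  moreover have "f (\<lambda>b. \<phi> b t) = 0" for t
  proof -
    have "f (\<lambda>b. \<phi> b t) = (\<Sum>\<beta>\<in>?E. \<Sum>\<alpha>\<in>?E'. z \<beta> * (c \<beta> \<alpha> * (\<Prod>a\<in>A. t a ^ \<alpha> a)))"
      by (simp add: f_def c sum_distrib_left cong: sum.cong)
    also have "\<dots> = (\<Sum>\<alpha>\<in>?E'. \<Sum>\<beta>\<in>?E. z \<beta> * (c \<beta> \<alpha> * (\<Prod>a\<in>A. t a ^ \<alpha> a)))"
      by (rule sum.swap)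
    also have "\<dots> = (\<Sum>\<alpha>\<in>?E'. (\<Sum>\<beta>\<in>?E. c \<beta> \<alpha> * z \<beta>) * (\<Prod>a\<in>A. t a ^ \<alpha> a))"
      unfolding sum_distrib_right by (simp add: mult_ac)
    also have "\<dots> = 0" using z(2) by simp
    finally show ?thesis .
  qed
  ultimately show ?thesis by blast
qed

lemma poly_funs_on_line:
  assumes "f \<in> poly_funs B"
  shows "\<exists>p. \<forall>t. f (\<lambda>b. x b + t * y b) = poly p t"
  using assms
proof (induction rule: poly_funs.induct)
  case (const c)
  then show ?case by (intro exI[of _ "[:c:]"]) auto
next
  case (coord b)
  then show ?case by (intro exI[of _ "[:x b, y b:]"]) auto
next
  case (add f g)
  then show ?case by (metis poly_add)
next
  case (mult f g)
  then show ?case by (metis poly_mult)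
qed

text \<open>On the line through a point where \<open>f\<close> does not vanish and a point where \<open>g\<close> does not vanish, both are
  non-zero polynomials in one variable.\<close>

lemma poly_funs_mult_nonzero:
  fixes f g :: "('b \<Rightarrow> 'k::field) \<Rightarrow> 'k"
  assumes inf: "infinite (UNIV :: 'k set)" and f: "f \<in> poly_funs B" "f x \<noteq> 0" 
    and g: "g \<in> poly_funs B" "g y \<noteq> 0"
  shows "\<exists>z. f z * g z \<noteq> 0"
proof -
  obtain p where p: "\<And>t. f (\<lambda>b. x b + t * (y b - x b)) = poly p t"
    using poly_funs_on_line[OF f(1), of x "\<lambda>b. y b - x b"] by blast
  obtain q where q: "\<And>t. g (\<lambda>b. x b + t * (y b - x b)) = poly q t"
    using poly_funs_on_line[OF g(1), of x "\<lambda>b. y b - x b"] by blast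
  have "poly p 0 \<noteq> 0" "poly q 1 \<noteq> 0" using p[of 0] q[of 1] f g by auto
  then have "p * q \<noteq> 0" by auto
  then have "finite {t. poly (p * q) t = 0}" by (rule poly_roots_finite)
  then obtain t where "poly (p * q) t \<noteq> 0"
    using inf by (metis (mono_tags, lifting) UNIV_I finite_subset mem_Collect_eq subsetI)
  then show ?thesis using p q by (metis poly_mult)
qed

section \<open>Generic representations of the star quiver\<close>

text \<open>The matrix entries, which are the coordinates of the affine space \<open>quiver_rep Q d\<close>.\<close>

definition rep_coords :: "('v, 'e) pre_digraph \<Rightarrow> ('v \<Rightarrow> nat) \<Rightarrow> ('e \<times> nat \<times> nat) set" where
  "rep_coords Q d = (SIGMA \<alpha>:arcs Q. {..<d (head Q \<alpha>)} \<times> {..<d (tail Q \<alpha>)})"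

definition rep_of_coords :: "('v, 'e) pre_digraph \<Rightarrow> ('v \<Rightarrow> nat) \<Rightarrow> ('e \<times> nat \<times> nat \<Rightarrow> 'k) \<Rightarrow> 'e \<Rightarrow> 'k mat" where
  "rep_of_coords Q d x = (\<lambda>\<alpha>\<in>arcs Q. mat (d (head Q \<alpha>)) (d (tail Q \<alpha>)) (\<lambda>(p, q). x (\<alpha>, p, q)))"

text \<open>Over an infinite field the condition \<open>F X \<noteq> 0\<close>, for \<open>F\<close> with \<open>nonzero_rep_poly Q d F\<close>, is what "for
  generic \<open>X\<close>" means below.\<close>

definition nonzero_rep_poly :: "('v, 'e) pre_digraph \<Rightarrow> ('v \<Rightarrow> nat) \<Rightarrow> (('e \<Rightarrow> 'k::field mat) \<Rightarrow> 'k) \<Rightarrow> bool" where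
  "nonzero_rep_poly Q d f \<longleftrightarrow> f \<in> rep_polys Q d \<and> (\<exists>X\<in>quiver_rep Q d. f X \<noteq> 0)"

definition coords_of_rep :: "('e \<Rightarrow> 'k mat) \<Rightarrow> 'e \<times> nat \<times> nat \<Rightarrow> 'k" where
  "coords_of_rep X = (\<lambda>(\<alpha>, p, q). X \<alpha> $$ (p, q))"

lemma rep_of_coords_quiver_rep: "rep_of_coords Q d x \<in> quiver_rep Q d"
  by (auto simp: rep_of_coords_def quiver_rep_def)

lemma rep_of_coords_of_rep:
  assumes "X \<in> quiver_rep Q d"
  shows "rep_of_coords Q d (coords_of_rep X) = X"
proof
  fix \<alpha>
  show "rep_of_coords Q d (coords_of_rep X) \<alpha> = X \<alpha>"
  proof (cases "\<alpha> \<in> arcs Q")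
    case True
    then have "X \<alpha> \<in> carrier_mat (d (head Q \<alpha>)) (d (tail Q \<alpha>))"
      using assms by (auto simp: quiver_rep_def PiE_iff)
    then show ?thesis using True by (intro eq_matI) (auto simp: rep_of_coords_def coords_of_rep_def)
  next
    case False
    then show ?thesis using assms by (auto simp: rep_of_coords_def quiver_rep_def PiE_iff extensional_def)
  qed
qed

lemma coords_of_rep_of_coords:
  "b \<in> rep_coords Q d \<Longrightarrow> coords_of_rep (rep_of_coords Q d x) b = x b"
  by (auto simp: rep_coords_def coords_of_rep_def rep_of_coords_def)

lemma rep_polys_of_poly_funs:
  "f \<in> poly_funs (rep_coords Q d) \<Longrightarrow> (\<lambda>X. f (coords_of_rep X)) \<in> rep_polys Q d"
proof (induction rule: poly_funs.induct)
  case (coord b)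
  then show ?case by (auto simp: rep_coords_def coords_of_rep_def intro: rep_polys.coord)
qed (auto intro: rep_polys.intros)

lemma poly_funs_of_rep_polys:
  "f \<in> rep_polys Q d \<Longrightarrow> (\<lambda>x. f (rep_of_coords Q d x)) \<in> poly_funs (rep_coords Q d)"
proof (induction rule: rep_polys.induct)
  case (coord \<alpha> p q)
  then have eq: "(\<lambda>x. rep_of_coords Q d x \<alpha> $$ (p, q)) = (\<lambda>x. x (\<alpha>, p, q))"
    by (auto simp: rep_of_coords_def)
  have "(\<alpha>, p, q) \<in> rep_coords Q d" using coord by (simp add: rep_coords_def)
  then show ?case unfolding eq by (rule poly_funs.coord)
qed (auto intro: poly_funs.intros)

lemma poly_funs_cong:
  assumes "f \<in> poly_funs B" "\<And>b. b \<in> B \<Longrightarrow> x b = y b"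
  shows "f x = f y"
  using assms by (induction rule: poly_funs.induct) auto

lemma nonzero_rep_poly_mult:
  fixes f g :: "('e \<Rightarrow> 'k::field mat) \<Rightarrow> 'k"
  assumes inf: "infinite (UNIV :: 'k set)" and f: "nonzero_rep_poly Q d f" and g: "nonzero_rep_poly Q d g"
  shows "nonzero_rep_poly Q d (\<lambda>X. f X * g X)"
proof -
  obtain X Y where X: "f \<in> rep_polys Q d" "X \<in> quiver_rep Q d" "f X \<noteq> 0"
    and Y: "g \<in> rep_polys Q d" "Y \<in> quiver_rep Q d" "g Y \<noteq> 0"
    using f g by (auto simp: nonzero_rep_poly_def)
  have "\<exists>z. f (rep_of_coords Q d z) * g (rep_of_coords Q d z) \<noteq> 0"
    using poly_funs_mult_nonzero[OF inf poly_funs_of_rep_polys[OF X(1)] _ poly_funs_of_rep_polys[OF Y(1)],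
        of "coords_of_rep X" "coords_of_rep Y"] X Y by (simp add: rep_of_coords_of_rep)
  then have "\<exists>Z\<in>quiver_rep Q d. f Z * g Z \<noteq> 0" using rep_of_coords_quiver_rep by blast
  then show ?thesis using rep_polys.mult[OF X(1) Y(1)] by (simp add: nonzero_rep_poly_def)
qed

lemma nonzero_rep_poly_prod:
  fixes f :: "'i \<Rightarrow> ('e \<Rightarrow> 'k::field mat) \<Rightarrow> 'k"
  assumes inf: "infinite (UNIV :: 'k set)" and "finite I"
    and f: "\<And>i. i \<in> I \<Longrightarrow> nonzero_rep_poly Q d (f i)"
  shows "nonzero_rep_poly Q d (\<lambda>X. \<Prod>i\<in>I. f i X)"
  using assms(2) f
proof (induction I rule: finite_induct)
  case empty
  have "rep_of_coords Q d (\<lambda>_. 0 :: 'k) \<in> quiver_rep Q d" by (rule rep_of_coords_quiver_rep)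
  then show ?case using rep_polys.const[of 1] by (auto simp: nonzero_rep_poly_def)
next
  case (insert i I)
  then show ?case using nonzero_rep_poly_mult[OF inf, of Q d "f i"] by simp
qed

text \<open>The form in which the dimension count is applied: a family of representations with fewer
  parameters than coordinates lies in a hypersurface.\<close>

lemma rep_poly_vanishing_on_image:
  fixes \<phi> :: "'e \<times> nat \<times> nat \<Rightarrow> ('a \<Rightarrow> 'k::field) \<Rightarrow> 'k"
  assumes inf: "infinite (UNIV :: 'k set)" and fin: "finite A" "finite (arcs Q)"
    and less: "card A < card (rep_coords Q d)"
    and \<phi>: "\<And>b. b \<in> rep_coords Q d \<Longrightarrow> \<phi> b \<in> poly_funs A"
  shows "\<exists>f. nonzero_rep_poly Q d f \<and>
     (\<forall>X t. (\<forall>b\<in>rep_coords Q d. coords_of_rep X b = \<phi> b t) \<longrightarrow> f X = 0)"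
proof -
  have "finite (rep_coords Q d)" using fin by (auto simp: rep_coords_def)
  from poly_map_from_fewer_variables_not_dominant[where \<phi> = \<phi>, OF fin(1) this less \<phi> inf]
  obtain f where f: "f \<in> poly_funs (rep_coords Q d)" "\<exists>x. f x \<noteq> 0" "\<forall>t. f (\<lambda>b. \<phi> b t) = 0" by blast
  obtain x where x: "f x \<noteq> 0" using f(2) by blast
  have "f (coords_of_rep (rep_of_coords Q d x)) = f x"
    by (rule poly_funs_cong[OF f(1) coords_of_rep_of_coords])
  then have "\<exists>X\<in>quiver_rep Q d. f (coords_of_rep X) \<noteq> 0" using x rep_of_coords_quiver_rep by metis
  moreover have "f (coords_of_rep X) = 0" if "\<forall>b\<in>rep_coords Q d. coords_of_rep X b = \<phi> b t" for X t
    using poly_funs_cong[OF f(1), of "coords_of_rep X" "\<lambda>b. \<phi> b t"] that f(3) by simp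
  ultimately show ?thesis using rep_polys_of_poly_funs[OF f(1)]
    unfolding nonzero_rep_poly_def by (intro exI[of _ "\<lambda>X. f (coords_of_rep X)"]) blast
qed

lemma card_rep_coords_star:
  assumes bal: "balanced m r d"
  shows "card (rep_coords (star_quiver m r) d) = m * (d Sink * d Sink)"
proof -
  have "card (rep_coords (star_quiver m r) d) = (\<Sum>\<alpha>\<in>(SIGMA i:{1..m}. {1..r i}). d Sink * d (Source (fst \<alpha>) (snd \<alpha>)))"
    unfolding rep_coords_def by (subst card_SigmaI) (auto simp: card_cartesian_product intro!: sum.cong)
  also have "\<dots> = (\<Sum>i=1..m. \<Sum>j=1..r i. d Sink * d (Source i j))"
    by (simp add: sum.Sigma case_prod_unfold)
  also have "\<dots> = (\<Sum>i=1..m. d Sink * d Sink)"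
    using bal by (intro sum.cong) (auto simp: balanced_def sum_distrib_left[symmetric])
  finally show ?thesis by simp
qed

lemma in_rep_coords_star:
  "((i, j), p, q) \<in> rep_coords (star_quiver m r) d \<longleftrightarrow>
     i \<in> {1..m} \<and> j \<in> {1..r i} \<and> p < d Sink \<and> q < d (Source i j)"
  by (auto simp: rep_coords_def)

text \<open>The \<open>q\<close>-th column of \<open>X (i, j)\<close> is a combination of the other columns of the \<open>i\<close>-th group.  Some
  column has this property if and only if the square matrix of all columns of the group is
  singular.\<close>

definition dependent_column ::
  "(nat \<Rightarrow> nat) \<Rightarrow> (star_vertex \<Rightarrow> nat) \<Rightarrow> nat \<times> nat \<Rightarrow> nat \<Rightarrow> (nat \<times> nat \<Rightarrow> 'k::field mat) \<Rightarrow> bool" where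
  "dependent_column r d = (\<lambda>(i, j) q X. \<exists>h. \<forall>p<d Sink. X (i, j) $$ (p, q) =
     (\<Sum>(j', q')\<in>(SIGMA j:{1..r i}. {..<d (Source i j)}) - {(j, q)}. h (j', q') * X (i, j') $$ (p, q')))"

text \<open>This is what an invariant subspace means for the entries of \<open>X\<close>.  Let \<open>W\<close> have the reduced basis
  \<open>w s\<close> with pivots \<open>J0\<close>, and let the preimage of \<open>W\<close> under \<open>X (i, j)\<close> have the reduced basis
  \<open>u c\<close> with pivots \<open>J (i, j)\<close>.  Write \<open>H c c'\<close> for the entries of \<open>u c\<close> outside the pivots and \<open>y c s\<close> for
  the coefficients of \<open>X (i, j) *\<^sub>v u c\<close> in the basis of \<open>W\<close>.  Then the columns with index in
  \<open>J (i, j)\<close> are polynomials in \<open>w\<close>, \<open>y\<close>, \<open>H\<close> and the other columns.\<close>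

definition subspace_with_pivots ::
  "nat \<Rightarrow> (nat \<Rightarrow> nat) \<Rightarrow> (star_vertex \<Rightarrow> nat) \<Rightarrow> nat set \<Rightarrow> (nat \<times> nat \<Rightarrow> nat set) \<Rightarrow> (nat \<times> nat \<Rightarrow> 'k::field mat) \<Rightarrow> bool" where
  "subspace_with_pivots m r d J0 J X \<longleftrightarrow> (\<exists>w y H. (\<forall>s\<in>J0. \<forall>p\<in>J0. w s p = (if s = p then 1 else 0)) \<and>
     (\<forall>i\<in>{1..m}. \<forall>j\<in>{1..r i}. \<forall>c\<in>J (i, j). \<forall>p<d Sink. X (i, j) $$ (p, c) =
        (\<Sum>s\<in>J0. y (i, j) c s * w s p) -
        (\<Sum>c'\<in>{..<d (Source i j)} - J (i, j). H (i, j) c c' * X (i, j) $$ (p, c'))))"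

text \<open>A dependent column of length \<open>n\<close> is determined by \<open>n - 1\<close> coefficients and the other columns.\<close>

lemma generic_column_independent:
  assumes inf: "infinite (UNIV :: 'k::field set)" and bal: "balanced m r d"
    and i: "i \<in> {1..m}" and j: "j \<in> {1..r i}" and q: "q < d (Source i j)"
  shows "\<exists>f. nonzero_rep_poly (star_quiver m r) d f \<and>
    (\<forall>X. dependent_column r d (i, j) q X \<longrightarrow> f X = (0 :: 'k))"
proof -
  define C where "C = (SIGMA j:{1..r i}. {..<d (Source i j)}) - {(j, q)}"
  define n where "n = d Sink"
  let ?Q = "star_quiver m r"
  let ?K = "(\<lambda>p. ((i, j), p, q)) ` {..<n}"
  \<comment> \<open>The parameters: the entries outside the column \<open>q\<close> of \<open>X (i, j)\<close>, and one coefficient for each other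
    column of the group.\<close>
  define A :: "(((nat \<times> nat) \<times> nat \<times> nat) + (nat \<times> nat)) set" where
    "A = Inl ` (rep_coords ?Q d - ?K) \<union> Inr ` C"
  define \<phi> :: "(nat \<times> nat) \<times> nat \<times> nat \<Rightarrow> (((nat \<times> nat) \<times> nat \<times> nat) + (nat \<times> nat) \<Rightarrow> 'k) \<Rightarrow> 'k" where
    "\<phi> b t = (case b of (\<alpha>, p, c) \<Rightarrow> if \<alpha> = (i, j) \<and> c = q
        then \<Sum>(j', q')\<in>C. t (Inr (j', q')) * t (Inl ((i, j'), p, q')) else t (Inl b))" for b t
  have fC: "finite C" by (simp add: C_def)
  have fR: "finite (rep_coords ?Q d)" by (auto simp: rep_coords_def)
  have "card (SIGMA j:{1..r i}. {..<d (Source i j)}) = n" using bal i by (simp add: balanced_def n_def)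
  then have cC: "card C = n - 1" using j q unfolding C_def by (subst card_Diff_singleton) auto
  have n: "n > 0"
  proof -
    have "d (Source i j) \<le> (\<Sum>j=1..r i. d (Source i j))" using j by (intro member_le_sum) auto
    then show ?thesis using q bal i by (simp add: balanced_def n_def)
  qed
  have K: "?K \<subseteq> rep_coords ?Q d" using i j q by (auto simp: in_rep_coords_star n_def)
  have cK: "card ?K = n" by (subst card_image) (auto simp: inj_on_def)
  have "card A = card (rep_coords ?Q d - ?K) + card C"
    unfolding A_def using fC fR by (subst card_Un_disjoint) (auto simp: card_image)
  also have "card (rep_coords ?Q d - ?K) = card (rep_coords ?Q d) - n"
    using K cK fR by (simp add: card_Diff_subset finite_subset)
  also have "card (rep_coords ?Q d) - n + card C < card (rep_coords ?Q d)"
    using cC n card_mono[OF fR K] cK by linarith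
  finally have less: "card A < card (rep_coords ?Q d)" .
  have pol: "\<phi> b \<in> poly_funs A" if b: "b \<in> rep_coords ?Q d" for b
  proof -
    obtain i' j' p c where b': "b = ((i', j'), p, c)" by (metis prod.exhaust)
    show ?thesis
    proof (cases "(i', j') = (i, j) \<and> c = q")
      case True
      have "p < n" using b b' by (simp add: in_rep_coords_star n_def)
      then have "Inl ((i, fst t), p, snd t) \<in> A \<and> Inr t \<in> A" if "t \<in> C" for t
        using that i j by (auto simp: A_def C_def in_rep_coords_star n_def)
      then have "(\<lambda>t. \<Sum>s\<in>C. t (Inr s) * t (Inl ((i, fst s), p, snd s))) \<in> poly_funs A"
        by (intro poly_funs_sum poly_funs.mult poly_funs.coord) auto
      then show ?thesis using True b' by (simp add: \<phi>_def[abs_def] case_prod_unfold)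
    next
      case False
      then have "Inl b \<in> A" using b b' by (auto simp: A_def)
      moreover have "\<phi> b = (\<lambda>t. t (Inl b))" using False b' by (auto simp: \<phi>_def[abs_def])
      ultimately show ?thesis using poly_funs.coord by simp
    qed
  qed
  have fA: "finite A" using fC fR by (simp add: A_def)
  have "finite (arcs ?Q)" by simp
  from rep_poly_vanishing_on_image[where \<phi> = \<phi>, OF inf fA this less pol]
  obtain f where f: "nonzero_rep_poly ?Q d f"
    and van: "\<And>X t. (\<forall>b\<in>rep_coords ?Q d. coords_of_rep X b = \<phi> b t) \<Longrightarrow> f X = 0" by blast
  have "f X = 0" if h: "\<forall>p<n. X (i, j) $$ (p, q) = (\<Sum>(j', q')\<in>C. h (j', q') * X (i, j') $$ (p, q'))" for X h
  proof (rule van[of X "case_sum (coords_of_rep X) h"], rule ballI)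
    fix b assume b: "b \<in> rep_coords ?Q d"
    obtain i' j' p c where b': "b = ((i', j'), p, c)" by (metis prod.exhaust)
    have "p < n" using b b' by (simp add: in_rep_coords_star n_def)
    then show "coords_of_rep X b = \<phi> b (case_sum (coords_of_rep X) h)"
      using h b' by (auto simp: \<phi>_def coords_of_rep_def)
  qed
  then show ?thesis using f unfolding C_def n_def dependent_column_def by (intro exI[of _ f]) auto
qed

text \<open>The parameters are \<open>k (n - k)\<close> entries of the basis of \<open>W\<close>, and for each arrow \<open>e k\<close> coefficients
  \<open>y\<close>, \<open>e (d - e)\<close> coefficients \<open>H\<close> and \<open>n (d - e)\<close> entries of the remaining columns.  As \<open>\<Sum>\<^sub>j e = k\<close> and
  \<open>\<Sum>\<^sub>j d = n\<close> for each \<open>i\<close>, their number is less than \<open>m n\<^sup>2\<close> exactly under the assumption \<open>neg\<close>.\<close>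

lemma generic_no_subspace_with_pivots:
  fixes m r d
  defines "n \<equiv> d Sink"
  assumes inf: "infinite (UNIV :: 'k::field set)" and bal: "balanced m r d"
    and J0: "J0 \<subseteq> {..<n}" 
    and J: "\<And>i j. i \<in> {1..m} \<Longrightarrow> j \<in> {1..r i} \<Longrightarrow> J (i, j) \<subseteq> {..<d (Source i j)}"
    and k: "\<And>i. i \<in> {1..m} \<Longrightarrow> (\<Sum>j=1..r i. card (J (i, j))) = card J0"
    and neg: "(\<Sum>i=1..m. \<Sum>j=1..r i. card (J (i, j)) * (d (Source i j) - card (J (i, j)))) <
       (m - 1) * (card J0 * (n - card J0))"
  shows "\<exists>f. nonzero_rep_poly (star_quiver m r) d f \<and>
    (\<forall>X. subspace_with_pivots m r d J0 J X \<longrightarrow> f X = (0 :: 'k))"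
proof -
  let ?Q = "star_quiver m r"
  let ?D = "SIGMA i:{1..m}. {1..r i}"
  define dd where "dd \<alpha> = d (Source (fst \<alpha>) (snd \<alpha>))" for \<alpha>
  \<comment> \<open>The four kinds of parameters, tagged by \<open>0, \<dots>, 3\<close> in \<open>A\<close>: the entries of the basis \<open>w\<close> outside the
    pivots (the arrow \<open>(0, 0)\<close> is a dummy that makes the types agree), \<open>y\<close>, \<open>H\<close> and the remaining columns.\<close>
  define A0 :: "((nat \<times> nat) \<times> nat \<times> nat) set" where "A0 = {(0, 0)} \<times> ({..<n} - J0) \<times> J0"
  define A1 where "A1 = (SIGMA \<alpha>:?D. J \<alpha> \<times> J0)"
  define A2 where "A2 = (SIGMA \<alpha>:?D. J \<alpha> \<times> ({..<dd \<alpha>} - J \<alpha>))"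
  define A3 where "A3 = (SIGMA \<alpha>:?D. {..<n} \<times> ({..<dd \<alpha>} - J \<alpha>))"
  define A :: "(nat \<times> (nat \<times> nat) \<times> nat \<times> nat) set" where
    "A = {0} \<times> A0 \<union> {1} \<times> A1 \<union> {2} \<times> A2 \<union> {3} \<times> A3"
  define \<phi> :: "(nat \<times> nat) \<times> nat \<times> nat \<Rightarrow> (nat \<times> (nat \<times> nat) \<times> nat \<times> nat \<Rightarrow> 'k) \<Rightarrow> 'k" where
    "\<phi> b t = (case b of (\<alpha>, p, c) \<Rightarrow> if c \<in> J \<alpha>
        then (\<Sum>s\<in>J0. t (1, \<alpha>, c, s) * (if p \<in> J0 then if s = p then 1 else 0 else t (0, (0, 0), p, s)))
           - (\<Sum>c'\<in>{..<dd \<alpha>} - J \<alpha>. t (2, \<alpha>, c, c') * t (3, \<alpha>, p, c'))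
        else t (3, \<alpha>, p, c))" for b t
  have Jd: "J \<alpha> \<subseteq> {..<dd \<alpha>}" if "\<alpha> \<in> ?D" for \<alpha> using J[of "fst \<alpha>" "snd \<alpha>"] that by (cases \<alpha>) (simp add: dd_def)
  have fJ: "finite (J \<alpha>)" if "\<alpha> \<in> ?D" for \<alpha> using finite_subset[OF Jd[OF that]] by simp
  have fJ0: "finite J0" using finite_subset[OF J0] by simp
  define e where "e \<alpha> = card (J \<alpha>)" for \<alpha>
  define kk where "kk = card J0"
  have ed: "e \<alpha> \<le> dd \<alpha>" if "\<alpha> \<in> ?D" for \<alpha> using card_mono[OF _ Jd[OF that]] by (simp add: e_def)
  have cd: "card ({..<dd \<alpha>} - J \<alpha>) = dd \<alpha> - e \<alpha>" if "\<alpha> \<in> ?D" for \<alpha>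
    using Jd[OF that] fJ[OF that] by (simp add: card_Diff_subset e_def)
  have kn: "kk \<le> n" using card_mono[OF _ J0] by (simp add: kk_def)
  have sD: "(\<Sum>\<alpha>\<in>?D. g \<alpha>) = (\<Sum>i=1..m. \<Sum>j=1..r i. g (i, j))" for g :: "nat \<times> nat \<Rightarrow> nat"
    by (simp add: sum.Sigma)
  have se: "(\<Sum>\<alpha>\<in>?D. e \<alpha>) = m * kk" unfolding sD using k by (simp add: e_def kk_def)
  have sd: "(\<Sum>\<alpha>\<in>?D. dd \<alpha>) = m * n" unfolding sD using bal by (simp add: dd_def balanced_def n_def)
  have fin: "finite A0" "finite A1" "finite A2" "finite A3"
    using fJ fJ0 by (auto simp: A0_def A1_def A2_def A3_def)
  have "card A = card A0 + card A1 + card A2 + card A3"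
    unfolding A_def using fin
    by (subst card_Un_disjoint; (auto)?)+ 
  also have "card A0 = (n - kk) * kk"
    using J0 fJ0 by (simp add: A0_def card_cartesian_product card_Diff_subset kk_def)
  also have "card A1 = (\<Sum>\<alpha>\<in>?D. e \<alpha> * kk)"
    unfolding A1_def using fJ fJ0 by (subst card_SigmaI) (auto simp: card_cartesian_product e_def kk_def)
  also have "\<dots> = m * kk * kk" using se by (simp add: sum_distrib_right[symmetric])
  also have "card A2 = (\<Sum>\<alpha>\<in>?D. e \<alpha> * (dd \<alpha> - e \<alpha>))"
    unfolding A2_def using fJ cd by (subst card_SigmaI) (auto simp: card_cartesian_product e_def intro!: sum.cong)
  also have "card A3 = (\<Sum>\<alpha>\<in>?D. n * (dd \<alpha> - e \<alpha>))"
    unfolding A3_def using fJ cd by (subst card_SigmaI) (auto simp: card_cartesian_product intro!: sum.cong)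
  also have "\<dots> = n * (m * (n - kk))"
  proof -
    have "(\<Sum>\<alpha>\<in>?D. dd \<alpha> - e \<alpha>) = m * n - m * kk" using sum_subtractf_nat[of ?D e dd] ed se sd by simp
    then show ?thesis unfolding sum_distrib_left[symmetric] by (simp only: diff_mult_distrib2)
  qed
  finally have cA: "card A = (n - kk) * kk + m * kk * kk + (\<Sum>\<alpha>\<in>?D. e \<alpha> * (dd \<alpha> - e \<alpha>)) + n * (m * (n - kk))" .
  have "(\<Sum>\<alpha>\<in>?D. e \<alpha> * (dd \<alpha> - e \<alpha>)) < (m - 1) * (kk * (n - kk))"
    using neg unfolding sD by (simp add: e_def dd_def kk_def)
  moreover have "(n - kk) * kk + m * kk * kk + (m - 1) * (kk * (n - kk)) + n * (m * (n - kk)) = m * (n * n)"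
  proof -
    obtain l where l: "n = kk + l" using kn by (metis le_add_diff_inverse)
    have "m > 0" using neg by (cases m) auto
    then obtain m' where "m = Suc m'" by (cases m) auto
    then show ?thesis using l by (simp add: algebra_simps)
  qed
  ultimately have less: "card A < card (rep_coords ?Q d)"
    unfolding cA card_rep_coords_star[OF bal] n_def[symmetric] by linarith
  have pol: "\<phi> b \<in> poly_funs A" if b: "b \<in> rep_coords ?Q d" for b
  proof -
    obtain \<alpha> p c where b': "b = (\<alpha>, p, c)" by (metis prod.exhaust)
    have \<alpha>: "\<alpha> \<in> ?D" "p < n" "c < dd \<alpha>"
      using b b' by (auto simp: rep_coords_def n_def dd_def)
    show ?thesis
    proof (cases "c \<in> J \<alpha>")
      case True
      have 1: "(\<lambda>t :: _ \<Rightarrow> 'k. if p \<in> J0 then if s = p then 1 else 0 else t (0, (0, 0), p, s)) \<in> poly_funs A" if "s \<in> J0" for s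
        using that \<alpha> by (cases "p \<in> J0") (auto simp: A_def A0_def intro: poly_funs.const poly_funs.coord)
      have "(\<lambda>t :: _ \<Rightarrow> 'k. (\<Sum>s\<in>J0. t (1, \<alpha>, c, s) * (if p \<in> J0 then if s = p then 1 else 0 else t (0, (0, 0), p, s)))
           - (\<Sum>c'\<in>{..<dd \<alpha>} - J \<alpha>. t (2, \<alpha>, c, c') * t (3, \<alpha>, p, c'))) \<in> poly_funs A"
        using \<alpha> True
        by (intro poly_funs_diff poly_funs_sum poly_funs.mult 1 poly_funs.coord) (auto simp: A_def A1_def A2_def A3_def)
      then show ?thesis using True b' by (simp add: \<phi>_def[abs_def])
    next
      case False
      then have "(3, \<alpha>, p, c) \<in> A" using \<alpha> by (auto simp: A_def A3_def)
      moreover have "\<phi> b = (\<lambda>t. t (3, \<alpha>, p, c))" using False b' by (auto simp: \<phi>_def[abs_def])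
      ultimately show ?thesis using poly_funs.coord by simp
    qed
  qed
  have fA: "finite A" using fin by (simp add: A_def)
  have "finite (arcs ?Q)" by simp
  from rep_poly_vanishing_on_image[where \<phi> = \<phi>, OF inf fA this less pol]
  obtain f where f: "nonzero_rep_poly ?Q d f"
    and van: "\<And>X t. (\<forall>b\<in>rep_coords ?Q d. coords_of_rep X b = \<phi> b t) \<Longrightarrow> f X = 0" by blast
  have "f X = 0" if w: "\<forall>s\<in>J0. \<forall>p\<in>J0. w s p = (if s = p then 1 else 0)" and
    eq: "\<forall>i\<in>{1..m}. \<forall>j\<in>{1..r i}. \<forall>c\<in>J (i, j). \<forall>p<n. X (i, j) $$ (p, c) =
          (\<Sum>s\<in>J0. y (i, j) c s * w s p) - (\<Sum>c'\<in>{..<d (Source i j)} - J (i, j). H (i, j) c c' * X (i, j) $$ (p, c'))"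
    for X w y H
  proof -
    define t where "t = (\<lambda>(tag :: nat, \<alpha> :: nat \<times> nat, a, b). if tag = 0 then w b a else if tag = 1 then y \<alpha> a b
       else if tag = 2 then H \<alpha> a b else X \<alpha> $$ (a, b))"
    have "coords_of_rep X b = \<phi> b t" if b: "b \<in> rep_coords ?Q d" for b
    proof -
      obtain i j p c where b': "b = ((i, j), p, c)" by (metis prod.exhaust)
      have ij: "i \<in> {1..m}" "j \<in> {1..r i}" "p < n" using b b' by (auto simp: in_rep_coords_star n_def)
      show ?thesis
      proof (cases "c \<in> J (i, j)")
        case True
        have S: "(\<Sum>s\<in>J0. y (i, j) c s * w s p) =
            (\<Sum>s\<in>J0. y (i, j) c s * (if p \<in> J0 then if s = p then 1 else 0 else w s p))"
          using w by (intro sum.cong) auto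
        have "X (i, j) $$ (p, c) = (\<Sum>s\<in>J0. y (i, j) c s * w s p) -
            (\<Sum>c'\<in>{..<d (Source i j)} - J (i, j). H (i, j) c c' * X (i, j) $$ (p, c'))"
          using eq ij True by blast
        moreover have "\<phi> b t = (\<Sum>s\<in>J0. y (i, j) c s * (if p \<in> J0 then if s = p then 1 else 0 else w s p)) -
            (\<Sum>c'\<in>{..<d (Source i j)} - J (i, j). H (i, j) c c' * X (i, j) $$ (p, c'))"
          using True b' by (simp add: \<phi>_def t_def dd_def cong: if_cong)
        moreover have "coords_of_rep X b = X (i, j) $$ (p, c)" using b' by (simp add: coords_of_rep_def)
        ultimately show ?thesis using S by (simp only:)
      next
        case False
        then show ?thesis using b' by (simp add: coords_of_rep_def \<phi>_def t_def)
      qed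
    qed
    then show ?thesis using van by blast
  qed
  then have "\<forall>X. subspace_with_pivots m r d J0 J X \<longrightarrow> f X = 0"
    unfolding subspace_with_pivots_def n_def by blast
  then show ?thesis using f by blast
qed

text \<open>There are only finitely many choices of pivots, so \<open>F\<close> can be the product of the polynomials of
  the previous two lemmas.\<close>

theorem generic_rep_irreducible:
  fixes m r d
  defines "n \<equiv> d Sink"
  assumes inf: "infinite (UNIV :: 'k::field set)" and bal: "balanced m r d"
    and num: "\<And>k e. \<lbrakk>0 < k; k < n; \<And>i. i \<in> {1..m} \<Longrightarrow> (\<Sum>j=1..r i. e i j) = k;
        \<And>i j. i \<in> {1..m} \<Longrightarrow> j \<in> {1..r i} \<Longrightarrow> e i j \<le> d (Source i j)\<rbrakk> \<Longrightarrow>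
      (\<Sum>i=1..m. \<Sum>j=1..r i. e i j * (d (Source i j) - e i j)) < (m - 1) * (k * (n - k))"
  shows "\<exists>F. nonzero_rep_poly (star_quiver m r) d F \<and>
    (\<forall>X\<in>quiver_rep (star_quiver m r) d. F X \<noteq> (0 :: 'k) \<longrightarrow>
       (\<exists>R. star_splitting m r d X R \<and> irreducible_star m r d X R))"
proof -
  let ?Q = "star_quiver m r"
  let ?D = "SIGMA i:{1..m}. {1..r i}"
  define dd where "dd \<alpha> = d (Source (fst \<alpha>) (snd \<alpha>))" for \<alpha>
  define P1 where "P1 = (SIGMA \<alpha>:?D. {..<dd \<alpha>})"
  \<comment> \<open>The possible pivots of an invariant subspace and of its preimages.\<close>
  define P2 where "P2 = {(J0, J). J0 \<in> Pow {..<n} \<and> J \<in> (\<Pi>\<^sub>E \<alpha>\<in>?D. Pow {..<dd \<alpha>}) \<and> 0 < card J0 \<and> card J0 < n \<and>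
      (\<forall>i\<in>{1..m}. (\<Sum>j=1..r i. card (J (i, j))) = card J0)}"
  have fin1: "finite P1" by (auto simp: P1_def)
  have "finite (Pow {..<n} \<times> (\<Pi>\<^sub>E \<alpha>\<in>?D. Pow {..<dd \<alpha>}))"
    by (intro finite_cartesian_product finite_PiE) auto
  then have fin2: "finite P2" by (rule finite_subset[rotated]) (auto simp: P2_def)
  have "\<forall>b\<in>P1. \<exists>f. nonzero_rep_poly ?Q d f \<and> (\<forall>X. dependent_column r d (fst b) (snd b) X \<longrightarrow> f X = (0 :: 'k))"
  proof
    fix b assume "b \<in> P1"
    then obtain i j q where b: "b = ((i, j), q)" "i \<in> {1..m}" "j \<in> {1..r i}" "q < d (Source i j)"
      by (auto simp: P1_def dd_def)
    show "\<exists>f. nonzero_rep_poly ?Q d f \<and> (\<forall>X. dependent_column r d (fst b) (snd b) X \<longrightarrow> f X = (0 :: 'k))"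
      using generic_column_independent[OF inf bal b(2-4)] unfolding b(1) fst_conv snd_conv .
  qed
  from bchoice[OF this] obtain f1 where f1: "\<forall>b\<in>P1. nonzero_rep_poly ?Q d (f1 b) \<and>
      (\<forall>X. dependent_column r d (fst b) (snd b) X \<longrightarrow> f1 b X = (0 :: 'k))" ..
  have "\<forall>b\<in>P2. \<exists>f. nonzero_rep_poly ?Q d f \<and> (\<forall>X. subspace_with_pivots m r d (fst b) (snd b) X \<longrightarrow> f X = (0 :: 'k))"
  proof
    fix b assume b: "b \<in> P2"
    have b': "fst b \<subseteq> {..<n}" "snd b \<in> (\<Pi>\<^sub>E \<alpha>\<in>?D. Pow {..<dd \<alpha>})" "0 < card (fst b)" "card (fst b) < n"
      "\<forall>i\<in>{1..m}. (\<Sum>j=1..r i. card (snd b (i, j))) = card (fst b)"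
      using b by (simp_all add: P2_def case_prod_unfold)
    have J: "snd b (i, j) \<subseteq> {..<d (Source i j)}" if "i \<in> {1..m}" "j \<in> {1..r i}" for i j
      using PiE_mem[OF b'(2), of "(i, j)"] that by (simp add: dd_def)
    show "\<exists>f. nonzero_rep_poly ?Q d f \<and> (\<forall>X. subspace_with_pivots m r d (fst b) (snd b) X \<longrightarrow> f X = (0 :: 'k))"
    proof (rule generic_no_subspace_with_pivots[OF inf bal])
      show "(\<Sum>i=1..m. \<Sum>j=1..r i. card (snd b (i, j)) * (d (Source i j) - card (snd b (i, j)))) <
         (m - 1) * (card (fst b) * (d Sink - card (fst b)))"
      proof (rule num[of "card (fst b)" "\<lambda>i j. card (snd b (i, j))", unfolded n_def])
        show "card (snd b (i, j)) \<le> d (Source i j)" if "i \<in> {1..m}" "j \<in> {1..r i}" for i j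
          using card_mono[OF _ J[OF that]] by simp
      qed (use b' in \<open>auto simp: n_def\<close>)
    qed (use b' J in \<open>auto simp: n_def\<close>)
  qed
  from bchoice[OF this] obtain f2 where f2: "\<forall>b\<in>P2. nonzero_rep_poly ?Q d (f2 b) \<and>
      (\<forall>X. subspace_with_pivots m r d (fst b) (snd b) X \<longrightarrow> f2 b X = (0 :: 'k))" ..
  define F where "F X = (\<Prod>b\<in>P1. f1 b X) * (\<Prod>b\<in>P2. f2 b X)" for X
  have F: "nonzero_rep_poly ?Q d F"
    unfolding F_def[abs_def] using f1 f2
    by (intro nonzero_rep_poly_mult[OF inf] nonzero_rep_poly_prod[OF inf] fin1 fin2) auto
  have "\<exists>R. star_splitting m r d X R \<and> irreducible_star m r d X R"
    if X: "X \<in> quiver_rep ?Q d" and FX: "F X \<noteq> 0" for X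
  proof -
    have n1: "\<not> dependent_column r d \<alpha> q X" if "(\<alpha>, q) \<in> P1" for \<alpha> q
    proof -
      have "f1 (\<alpha>, q) X \<noteq> 0" using FX that fin1 by (auto simp: F_def)
      then show ?thesis using bspec[OF f1 that] by auto
    qed
    have n2: "\<not> subspace_with_pivots m r d J0 J X" if "(J0, J) \<in> P2" for J0 J
    proof -
      have "f2 (J0, J) X \<noteq> 0" using FX that fin2 by (auto simp: F_def)
      then show ?thesis using bspec[OF f2 that] by auto
    qed
    have Xc: "X (i, j) \<in> carrier_mat n (d (Source i j))" if "i \<in> {1..m}" "j \<in> {1..r i}" for i j
      using quiver_rep_star_carrier[OF X that] by (simp add: n_def)
    have "\<exists>R. star_splitting m r d X R"
    proof (rule star_splitting_exists)
      fix i assume i: "i \<in> {1..m}"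
      show "\<exists>R. splitting (d Sink) {1..r i} (\<lambda>j. d (Source i j)) (\<lambda>j. X (i, j)) R"
      proof (rule splitting_of_independent_columns)
        show "(\<Sum>j=1..r i. d (Source i j)) = d Sink" using bal i by (simp add: balanced_def)
        fix c assume c: "\<And>p. p < d Sink \<Longrightarrow> (\<Sum>j=1..r i. \<Sum>q<d (Source i j). c j q * X (i, j) $$ (p, q)) = 0"
        show "\<forall>j\<in>{1..r i}. \<forall>q<d (Source i j). c j q = 0"
        proof (rule ccontr)
          assume "\<not> ?thesis"
          then obtain j q where j: "j \<in> {1..r i}" "q < d (Source i j)" "c j q \<noteq> 0" by blast
          let ?C = "SIGMA j:{1..r i}. {..<d (Source i j)}"
          have "dependent_column r d (i, j) q X"
            unfolding dependent_column_def prod.case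
          proof (intro exI[of _ "\<lambda>(j', q'). - c j' q' / c j q"] allI impI)
            fix p assume p: "p < d Sink"
            have "0 = (\<Sum>(j', q')\<in>?C. c j' q' * X (i, j') $$ (p, q'))"
              using c[OF p] by (simp add: sum.Sigma)
            also have "\<dots> = c j q * X (i, j) $$ (p, q) + (\<Sum>(j', q')\<in>?C - {(j, q)}. c j' q' * X (i, j') $$ (p, q'))"
              using j by (subst sum.remove[of _ "(j, q)"]) auto
            finally have "X (i, j) $$ (p, q) = - (\<Sum>(j', q')\<in>?C - {(j, q)}. c j' q' * X (i, j') $$ (p, q')) / c j q"
              using j(3) by (simp add: field_simps eq_neg_iff_add_eq_0)
            also have "\<dots> = (\<Sum>(j', q')\<in>?C - {(j, q)}. (case (j', q') of (j', q') \<Rightarrow> - c j' q' / c j q) * X (i, j') $$ (p, q'))"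
              by (simp add: sum_divide_distrib sum_negf[symmetric] case_prod_unfold)
            finally show "X (i, j) $$ (p, q) = (\<Sum>(j', q')\<in>?C - {(j, q)}.
                (case (j', q') of (j', q') \<Rightarrow> - c j' q' / c j q) * X (i, j') $$ (p, q'))" .
          qed
          then show False using n1[of "(i, j)" q] i j by (simp add: P1_def dd_def)
        qed
      qed (use Xc i in \<open>auto simp: n_def\<close>)
    qed
    then obtain R where R: "star_splitting m r d X R" ..
    have s: "splitting n {1..r i} (\<lambda>j. d (Source i j)) (\<lambda>j. X (i, j)) (\<lambda>j. R (i, j))" if "i \<in> {1..m}" for i
      using star_splittingD[OF R that] by (simp add: n_def)
    have "irreducible_star m r d X R"
      unfolding irreducible_star_def n_def[symmetric]
    proof (intro allI impI, elim conjE)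
      fix W assume W: "vec_subspace n W"
        and inv: "\<forall>i\<in>{1..m}. \<forall>j\<in>{1..r i}. \<forall>w\<in>W. X (i, j) *\<^sub>v (R (i, j) *\<^sub>v w) \<in> W"
      show "W = {0\<^sub>v n} \<or> W = carrier_vec n"
      proof (rule ccontr)
        assume no: "\<not> ?thesis"
        obtain J0 w where J0: "pivot_basis n W J0 w" using pivot_basis_exists[OF W] by blast
        have dW: "vec_subspace_dim n W = card J0" by (rule vec_subspace_dim_eq_card[OF W J0])
        have k: "0 < card J0" "card J0 < n"
          using no dim_eq_0_iff[OF W] dim_eq_n_iff[OF W] dim_le[OF W] dW by auto
        define U where "U \<alpha> = {x \<in> carrier_vec (dd \<alpha>). X \<alpha> *\<^sub>v x \<in> W}" for \<alpha>
        have U: "vec_subspace (dd \<alpha>) (U \<alpha>)" if "\<alpha> \<in> ?D" for \<alpha>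
          unfolding U_def using that Xc[of "fst \<alpha>" "snd \<alpha>"] 
          by (intro vec_subspace_preimage[OF _ W]) (auto simp: dd_def)
        have "\<forall>\<alpha>\<in>?D. \<exists>B. pivot_basis (dd \<alpha>) (U \<alpha>) (fst B) (snd B)"
          using pivot_basis_exists[OF U] by fastforce
        from bchoice[OF this] obtain B where B: "\<forall>\<alpha>\<in>?D. pivot_basis (dd \<alpha>) (U \<alpha>) (fst (B \<alpha>)) (snd (B \<alpha>))" ..
        define J where "J = restrict (\<lambda>\<alpha>. fst (B \<alpha>)) ?D"
        define u where "u \<alpha> = snd (B \<alpha>)" for \<alpha>
        have J: "pivot_basis (dd \<alpha>) (U \<alpha>) (J \<alpha>) (u \<alpha>)" if "\<alpha> \<in> ?D" for \<alpha>
          using bspec[OF B that] that by (simp only: J_def u_def restrict_apply if_True)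
        have sum: "(\<Sum>j=1..r i. card (J (i, j))) = card J0" if i: "i \<in> {1..m}" for i
        proof -
          have "(\<Sum>j=1..r i. card (J (i, j))) = (\<Sum>j=1..r i. vec_subspace_dim (d (Source i j)) {x \<in> carrier_vec (d (Source i j)). X (i, j) *\<^sub>v x \<in> W})"
          proof (rule sum.cong)
            fix j assume "j \<in> {1..r i}"
            then have "(i, j) \<in> ?D" using i by simp
            from vec_subspace_dim_eq_card[OF U[OF this] J[OF this]]
            show "card (J (i, j)) = vec_subspace_dim (d (Source i j)) {x \<in> carrier_vec (d (Source i j)). X (i, j) *\<^sub>v x \<in> W}"
              by (simp add: U_def dd_def)
          qed simp
          also have "\<dots> = card J0" unfolding dW[symmetric] using inv i by (intro sum_dim_preimages_of_invariant[OF s[OF i] W]) auto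
          finally show ?thesis .
        qed
        have Jsub: "J \<alpha> \<subseteq> {..<dd \<alpha>}" if "\<alpha> \<in> ?D" for \<alpha> using J[OF that] by (simp add: pivot_basis_def)
        have J0sub: "J0 \<subseteq> {..<n}" using J0 by (simp add: pivot_basis_def)
        have P: "(J0, J) \<in> P2"
        proof -
          have "J \<in> (\<Pi>\<^sub>E \<alpha>\<in>?D. Pow {..<dd \<alpha>})" using Jsub by (auto simp: J_def PiE_iff restrict_def extensional_def)
          then show ?thesis using J0sub k sum by (simp add: P2_def)
        qed
        have "subspace_with_pivots m r d J0 J X"
          unfolding subspace_with_pivots_def
        proof (rule exI[of _ "\<lambda>s p. w s $ p"], rule exI[of _ "\<lambda>\<alpha> c s. (X \<alpha> *\<^sub>v u \<alpha> c) $ s"],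
            rule exI[of _ "\<lambda>\<alpha> c c'. u \<alpha> c $ c'"], rule conjI)
          show "\<forall>s\<in>J0. \<forall>p\<in>J0. w s $ p = (if s = p then 1 else 0)" using J0 by (simp add: pivot_basis_def)
          show "\<forall>i\<in>{1..m}. \<forall>j\<in>{1..r i}. \<forall>c\<in>J (i, j). \<forall>p<d Sink. X (i, j) $$ (p, c) =
            (\<Sum>s\<in>J0. (X (i, j) *\<^sub>v u (i, j) c) $ s * w s $ p) -
            (\<Sum>c'\<in>{..<d (Source i j)} - J (i, j). u (i, j) c $ c' * X (i, j) $$ (p, c'))"
          proof (intro ballI allI impI)
            fix i j c p assume i: "i \<in> {1..m}" and j: "j \<in> {1..r i}" and c: "c \<in> J (i, j)" and "p < d Sink"
            then have p: "p < n" by (simp add: n_def)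
            have D: "(i, j) \<in> ?D" using i j by simp
            let ?d = "d (Source i j)"
            have uU: "u (i, j) c \<in> U (i, j)" and uJ: "\<forall>c'\<in>J (i, j). u (i, j) c $ c' = (if c = c' then 1 else 0)"
              using J[OF D] c by (auto simp: pivot_basis_def)
            have uc: "u (i, j) c \<in> carrier_vec ?d" and XW: "X (i, j) *\<^sub>v u (i, j) c \<in> W"
              using uU by (auto simp: U_def dd_def)
            have Js: "J (i, j) \<subseteq> {..<?d}" using Jsub[OF D] by (simp add: dd_def)
            have "(X (i, j) *\<^sub>v u (i, j) c) $ p = (\<Sum>c'<?d. u (i, j) c $ c' * X (i, j) $$ (p, c'))"
              by (rule mult_mat_vec_cols[OF Xc[OF i j] uc p])
            also have "\<dots> = (\<Sum>c'\<in>{..<?d} - J (i, j). u (i, j) c $ c' * X (i, j) $$ (p, c')) +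
                (\<Sum>c'\<in>J (i, j). u (i, j) c $ c' * X (i, j) $$ (p, c'))"
              using Js by (intro sum.subset_diff) auto
            also have "(\<Sum>c'\<in>J (i, j). u (i, j) c $ c' * X (i, j) $$ (p, c')) = (\<Sum>c'\<in>J (i, j). if c' = c then X (i, j) $$ (p, c) else 0)"
              using uJ by (intro sum.cong) auto
            also have "\<dots> = X (i, j) $$ (p, c)" using c finite_subset[OF Js] by simp
            finally have 1: "(X (i, j) *\<^sub>v u (i, j) c) $ p =
                (\<Sum>c'\<in>{..<?d} - J (i, j). u (i, j) c $ c' * X (i, j) $$ (p, c')) + X (i, j) $$ (p, c)" .
            have "w s \<in> carrier_vec n" if "s \<in> J0" for s
              using J0 that vec_subspace_carrier[OF W] by (auto simp: pivot_basis_def)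
            then have "vsum n (\<lambda>s. (X (i, j) *\<^sub>v u (i, j) c) $ s \<cdot>\<^sub>v w s) J0 $ p =
                (\<Sum>s\<in>J0. (X (i, j) *\<^sub>v u (i, j) c) $ s * w s $ p)"
              using p by (intro vsum_smult_index) auto
            then have 2: "(X (i, j) *\<^sub>v u (i, j) c) $ p = (\<Sum>s\<in>J0. (X (i, j) *\<^sub>v u (i, j) c) $ s * w s $ p)"
              using pivot_basis_expand[OF W J0 XW] by simp
            show "X (i, j) $$ (p, c) = (\<Sum>s\<in>J0. (X (i, j) *\<^sub>v u (i, j) c) $ s * w s $ p) -
               (\<Sum>c'\<in>{..<?d} - J (i, j). u (i, j) c $ c' * X (i, j) $$ (p, c'))"
              unfolding eq_diff_eq using trans[OF 1[symmetric] 2] by (simp only: add.commute)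
          qed
        qed
        then show False using n2[OF P] by simp
      qed
    qed
    then show ?thesis using R by blast
  qed
  then show ?thesis using F by blast
qed

section \<open>Eigenspaces of matrices of finite order\<close>

text \<open>Multiplication by a root \<open>\<zeta>\<close> permutes the roots, so the sum is invariant under multiplication by
  \<open>\<zeta> ^ t\<close>; and \<open>\<zeta> ^ t \<noteq> 1\<close> for some \<open>\<zeta>\<close>, because \<open>x ^ t - 1\<close> has at most \<open>t\<close> roots.\<close>

lemma sum_powers_of_roots_of_unity:
  fixes r :: nat
  assumes card: "card {z :: 'k::field. z ^ r = 1} = r" and t: "0 < t" "t < r"
  shows "(\<Sum>z\<in>{z :: 'k. z ^ r = 1}. z ^ t) = 0"
proof -
  let ?Z = "{z :: 'k. z ^ r = 1}"
  have "\<not> ?Z \<subseteq> {z. z ^ t = 1}"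
  proof
    assume sub: "?Z \<subseteq> {z. z ^ t = 1}"
    define p :: "'k poly" where "p = Polynomial.monom 1 t - 1"
    have "Polynomial.coeff p t = 1" using t by (simp add: p_def coeff_1)
    then have "p \<noteq> 0" by auto
    have "degree p \<le> t" unfolding p_def by (intro degree_diff_le) (auto simp: degree_monom_le)
    have eq: "{z. poly p z = 0} = {z. z ^ t = 1}" by (auto simp: p_def poly_monom)
    have "card ?Z \<le> card {z. poly p z = 0}" unfolding eq[symmetric]
      using sub eq poly_roots_finite[OF \<open>p \<noteq> 0\<close>] by (intro card_mono) auto
    also have "\<dots> \<le> degree p" by (rule card_poly_roots_bound[OF \<open>p \<noteq> 0\<close>])
    finally show False using \<open>degree p \<le> t\<close> t card by linarith
  qed
  then obtain \<zeta> :: 'k where \<zeta>: "\<zeta> ^ r = 1" "\<zeta> ^ t \<noteq> 1" by blast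
  have "\<zeta> \<noteq> 0" using \<zeta>(1) t by (cases "\<zeta> = 0") (auto simp: power_0_left)
  have bij: "bij_betw (\<lambda>z. \<zeta> * z) ?Z ?Z"
    by (rule bij_betw_byWitness[where f' = "\<lambda>z. z / \<zeta>"])
      (use \<zeta>(1) \<open>\<zeta> \<noteq> 0\<close> in \<open>auto simp: power_mult_distrib power_divide\<close>)
  have "(\<Sum>z\<in>?Z. z ^ t) = (\<Sum>z\<in>?Z. (\<zeta> * z) ^ t)"
    using sum.reindex_bij_betw[OF bij, of "\<lambda>z. z ^ t"] by simp
  also have "\<dots> = \<zeta> ^ t * (\<Sum>z\<in>?Z. z ^ t)" by (simp add: power_mult_distrib sum_distrib_left)
  finally have "(1 - \<zeta> ^ t) * (\<Sum>z\<in>?Z. z ^ t) = 0" by (simp add: left_diff_distrib)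
  then show ?thesis using \<zeta>(2) by simp
qed

lemma sum_inverse_powers_of_roots_of_unity:
  fixes r :: nat and \<rho> :: "nat \<Rightarrow> 'k::field"
  assumes bij: "bij_betw \<rho> {1..r} {z. z ^ r = 1}" and t: "t < r"
  shows "(\<Sum>j=1..r. inverse (\<rho> j) ^ t) = (if t = 0 then of_nat r else 0)"
proof (cases "t = 0")
  case False
  let ?Z = "{z :: 'k. z ^ r = 1}"
  have card: "card ?Z = r" using bij_betw_same_card[OF bij] by simp
  have binv: "bij_betw inverse ?Z ?Z"
    by (rule bij_betw_byWitness[where f' = inverse]) (auto simp: power_inverse)
  have "(\<Sum>j=1..r. inverse (\<rho> j) ^ t) = (\<Sum>z\<in>?Z. inverse z ^ t)"
    by (rule sum.reindex_bij_betw[OF bij])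
  also have "\<dots> = (\<Sum>z\<in>?Z. z ^ t)" by (rule sum.reindex_bij_betw[OF binv])
  also have "\<dots> = 0" using sum_powers_of_roots_of_unity[OF card _ t] False by simp
  finally show ?thesis using False by simp
qed simp

text \<open>For \<open>f ^^ r = id\<close> and \<open>\<rho> ^ r = 1\<close> this is the projection \<open>(1 / r) \<Sum> \<rho>\<^sup>-\<^sup>t f\<^sup>t\<close> onto the \<open>\<rho>\<close>-eigenspace of \<open>f\<close>.
  It is a polynomial in \<open>f\<close>, hence preserves every \<open>f\<close>-invariant subspace.\<close>

definition eigen_proj :: "nat \<Rightarrow> nat \<Rightarrow> ('k::field vec \<Rightarrow> 'k vec) \<Rightarrow> 'k \<Rightarrow> 'k vec \<Rightarrow> 'k vec" where
  "eigen_proj n r f \<rho> v = vsum n (\<lambda>t. (inverse \<rho> ^ t / of_nat r) \<cdot>\<^sub>v (f ^^ t) v) {..<r}"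

lemma iter_mat_carrier: "A \<in> carrier_mat n n \<Longrightarrow> v \<in> carrier_vec n \<Longrightarrow> (((*\<^sub>v) A) ^^ t) v \<in> carrier_vec n"
  by (induction t) auto

lemma iter_mat_vsum:
  assumes A: "A \<in> carrier_mat n n" and f: "\<And>s. s \<in> S \<Longrightarrow> f s \<in> carrier_vec n"
  shows "(((*\<^sub>v) A) ^^ t) (vsum n f S) = vsum n (\<lambda>s. (((*\<^sub>v) A) ^^ t) (f s)) S"
proof (induction t)
  case (Suc t)
  then show ?case using iter_mat_carrier[OF A f] by (simp add: mult_mat_vec_vsum[OF A])
qed simp

lemma eigen_proj_index:
  assumes A: "A \<in> carrier_mat n n" and v: "v \<in> carrier_vec n" and p: "p < n"
  shows "eigen_proj n r ((*\<^sub>v) A) c v $ p = (\<Sum>t<r. inverse c ^ t / of_nat r * (((*\<^sub>v) A) ^^ t) v $ p)"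
  unfolding eigen_proj_def by (rule vsum_smult_index[OF iter_mat_carrier[OF A v] p])

lemma iter_mat_eigenvector:
  fixes A :: "'k::field mat"
  assumes A: "A \<in> carrier_mat n n" and v: "v \<in> carrier_vec n" and e: "A *\<^sub>v v = c \<cdot>\<^sub>v v"
  shows "(((*\<^sub>v) A) ^^ t) v = c ^ t \<cdot>\<^sub>v v"
proof (induction t)
  case (Suc t)
  then show ?case using mult_mat_vec[OF A v] e by (simp add: smult_smult_assoc mult.commute)
qed simp

lemma eigen_proj_in_eigen_space:
  fixes A :: "'k::field mat"
  assumes A: "A \<in> carrier_mat n n" and v: "v \<in> carrier_vec n" and Av: "(((*\<^sub>v) A) ^^ r) v = v" and c: "c ^ r = 1"
    and r: "r > 0"
  shows "eigen_proj n r ((*\<^sub>v) A) c v \<in> eigen_space n A c"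
proof -
  let ?f = "(*\<^sub>v) A"
  have c0: "c \<noteq> 0" using c r by (auto simp: power_0_left)
  have it: "(?f ^^ t) v \<in> carrier_vec n" for t by (rule iter_mat_carrier[OF A v])
  have "A *\<^sub>v eigen_proj n r ?f c v = vsum n (\<lambda>t. (inverse c ^ t / of_nat r) \<cdot>\<^sub>v (?f ^^ Suc t) v) {..<r}"
    unfolding eigen_proj_def using it by (subst mult_mat_vec_lincomb[OF A]) auto
  also have "\<dots> = c \<cdot>\<^sub>v eigen_proj n r ?f c v"
  proof (rule eq_vecI)
    fix p assume "p < dim_vec (c \<cdot>\<^sub>v eigen_proj n r ?f c v)"
    then have p: "p < n" by (simp add: eigen_proj_def)
    \<comment> \<open>Applying \<open>A\<close> shifts the summation index by one; the boundary terms \<open>g 0\<close> and \<open>g r\<close> agree.\<close>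
    define g where "g t = c * (inverse c ^ t / of_nat r * (?f ^^ t) v $ p)" for t
    have "vsum n (\<lambda>t. (inverse c ^ t / of_nat r) \<cdot>\<^sub>v (?f ^^ Suc t) v) {..<r} $ p =
        (\<Sum>t<r. inverse c ^ t / of_nat r * (?f ^^ Suc t) v $ p)"
      by (rule vsum_smult_index[OF it p])
    also have "\<dots> = (\<Sum>t<r. g (Suc t))" using c0 by (intro sum.cong) (auto simp: g_def)
    also have "\<dots> = (\<Sum>t<Suc r. g t) - g 0" by (subst sum.lessThan_Suc_shift) simp
    also have "\<dots> = (\<Sum>t<r. g t) + (g r - g 0)" by simp
    also have "g r = g 0" using Av c by (simp add: g_def power_inverse)
    also have "(\<Sum>t<r. g t) + (g 0 - g 0) = c * (\<Sum>t<r. inverse c ^ t / of_nat r * (?f ^^ t) v $ p)"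
      by (simp add: g_def sum_distrib_left)
    also have "\<dots> = c * eigen_proj n r ?f c v $ p"
      by (simp only: eigen_proj_index[OF A v p])
    also have "\<dots> = (c \<cdot>\<^sub>v eigen_proj n r ?f c v) $ p" using p by (simp add: eigen_proj_def)
    finally show "vsum n (\<lambda>t. (inverse c ^ t / of_nat r) \<cdot>\<^sub>v (?f ^^ Suc t) v) {..<r} $ p =
        (c \<cdot>\<^sub>v eigen_proj n r ?f c v) $ p" .
  qed (simp add: eigen_proj_def)
  finally show ?thesis by (simp add: eigen_space_def eigen_proj_def)
qed

lemma eigen_proj_eigenvector:
  fixes A :: "'k::field mat"
  assumes A: "A \<in> carrier_mat n n" and v: "v \<in> eigen_space n A c'" and c: "c ^ r = 1" "c' ^ r = 1"
    and r: "(of_nat r :: 'k) \<noteq> 0"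
  shows "eigen_proj n r ((*\<^sub>v) A) c v = (if c = c' then v else 0\<^sub>v n)"
proof -
  let ?f = "(*\<^sub>v) A"
  have vc: "v \<in> carrier_vec n" and e: "A *\<^sub>v v = c' \<cdot>\<^sub>v v" using v by (auto simp: eigen_space_def)
  have r0: "r > 0" using r by (cases r) auto
  have c0: "c \<noteq> 0" using c r0 by (auto simp: power_0_left)
  have s: "(\<Sum>t<r. (c' / c) ^ t) = (if c = c' then of_nat r else 0)"
  proof (cases "c = c'")
    case True
    then show ?thesis using c0 by simp
  next
    case False
    then have "c' / c \<noteq> 1" using c0 by auto
    from geometric_sum[OF this, of r] have "(\<Sum>t<r. (c' / c) ^ t) = ((c' / c) ^ r - 1) / (c' / c - 1)" .
    also have "(c' / c) ^ r = 1" using c by (simp add: power_divide)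
    finally show ?thesis using False by simp
  qed
  show ?thesis
  proof (rule eq_vecI)
    fix p assume "p < dim_vec (if c = c' then v else 0\<^sub>v n)"
    then have p: "p < n" using vc by (auto split: if_splits)
    have "eigen_proj n r ?f c v $ p = (\<Sum>t<r. inverse c ^ t / of_nat r * (?f ^^ t) v $ p)"
      by (rule eigen_proj_index[OF A vc p])
    also have "\<dots> = (\<Sum>t<r. (c' / c) ^ t * (v $ p / of_nat r))"
      using p vc by (intro sum.cong) (auto simp: iter_mat_eigenvector[OF A vc e] power_divide power_inverse field_simps)
    also have "\<dots> = (if c = c' then of_nat r else 0) * (v $ p / of_nat r)"
      unfolding s[symmetric] by (simp only: sum_distrib_right)
    also have "\<dots> = (if c = c' then v else 0\<^sub>v n) $ p" using r p by simp
    finally show "eigen_proj n r ?f c v $ p = (if c = c' then v else 0\<^sub>v n) $ p" .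
  qed (use vc in \<open>auto simp: eigen_proj_def\<close>)
qed

lemma eigen_proj_vsum:
  fixes A :: "'k::field mat"
  assumes A: "A \<in> carrier_mat n n" and y: "\<And>s. s \<in> S \<Longrightarrow> y s \<in> carrier_vec n"
  shows "eigen_proj n r ((*\<^sub>v) A) c (vsum n y S) = vsum n (\<lambda>s. eigen_proj n r ((*\<^sub>v) A) c (y s)) S"
proof (rule eq_vecI)
  let ?f = "(*\<^sub>v) A"
  fix p assume "p < dim_vec (vsum n (\<lambda>s. eigen_proj n r ?f c (y s)) S)"
  then have p: "p < n" by simp
  have "eigen_proj n r ?f c (vsum n y S) $ p = (\<Sum>t<r. inverse c ^ t / of_nat r * (?f ^^ t) (vsum n y S) $ p)"
    by (rule eigen_proj_index[OF A _ p]) simp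
  also have "\<dots> = (\<Sum>t<r. \<Sum>s\<in>S. inverse c ^ t / of_nat r * (?f ^^ t) (y s) $ p)"
    using p by (simp add: iter_mat_vsum[OF A y] sum_distrib_left)
  also have "\<dots> = (\<Sum>s\<in>S. \<Sum>t<r. inverse c ^ t / of_nat r * (?f ^^ t) (y s) $ p)" by (rule sum.swap)
  also have "\<dots> = (\<Sum>s\<in>S. eigen_proj n r ?f c (y s) $ p)"
  proof (rule sum.cong)
    fix s assume "s \<in> S"
    then show "(\<Sum>t<r. inverse c ^ t / of_nat r * (?f ^^ t) (y s) $ p) = eigen_proj n r ?f c (y s) $ p"
      by (simp only: eigen_proj_index[OF A y p])
  qed simp
  also have "\<dots> = vsum n (\<lambda>s. eigen_proj n r ?f c (y s)) S $ p" using p by simp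
  finally show "eigen_proj n r ?f c (vsum n y S) $ p = vsum n (\<lambda>s. eigen_proj n r ?f c (y s)) S $ p" .
qed (simp add: eigen_proj_def)

lemma eigen_proj_of_decomposition:
  fixes A :: "'k::field mat"
  assumes A: "A \<in> carrier_mat n n" and \<rho>: "bij_betw \<rho> {1..r} {z. z ^ r = 1}" and r: "(of_nat r :: 'k) \<noteq> 0"
    and y: "\<And>j. j \<in> {1..r} \<Longrightarrow> y j \<in> eigen_space n A (\<rho> j)" and j: "j \<in> {1..r}"
  shows "eigen_proj n r ((*\<^sub>v) A) (\<rho> j) (vsum n y {1..r}) = y j"
proof -
  have root: "\<rho> i ^ r = 1" if "i \<in> {1..r}" for i using bij_betwE[OF \<rho>] that by auto
  have inj: "\<rho> j = \<rho> i \<longleftrightarrow> i = j" if "i \<in> {1..r}" for i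
    using inj_on_eq_iff[OF bij_betw_imp_inj_on[OF \<rho>] j that] by blast
  have yc: "y i \<in> carrier_vec n" if "i \<in> {1..r}" for i using y[OF that] by (simp add: eigen_space_def)
  have "eigen_proj n r ((*\<^sub>v) A) (\<rho> j) (vsum n y {1..r}) = vsum n (\<lambda>i. eigen_proj n r ((*\<^sub>v) A) (\<rho> j) (y i)) {1..r}"
    by (rule eigen_proj_vsum[OF A yc])
  also have "\<dots> = vsum n (\<lambda>i. if i = j then y i else 0\<^sub>v n) {1..r}"
    using eigen_proj_eigenvector[OF A y root[OF j] root r] inj by (intro vsum_cong) auto
  also have "\<dots> = vsum n (\<lambda>i. if i = j then y i else 0\<^sub>v n) {j}"
    using j by (intro vsum_supported) auto
  also have "\<dots> = y j" using vsum_singleton[of "\<lambda>i. if i = j then y i else 0\<^sub>v n" j n] yc[OF j] by simp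
  finally show ?thesis .
qed

lemma sum_eigen_proj:
  fixes A :: "'k::field mat"
  assumes A: "A \<in> carrier_mat n n" and \<rho>: "bij_betw \<rho> {1..r} {z. z ^ r = 1}" and r: "(of_nat r :: 'k) \<noteq> 0"
    and v: "v \<in> carrier_vec n"
  shows "vsum n (\<lambda>j. eigen_proj n r ((*\<^sub>v) A) (\<rho> j) v) {1..r} = v"
proof (rule eq_vecI)
  let ?f = "(*\<^sub>v) A"
  fix p assume "p < dim_vec v"
  then have p: "p < n" using v by simp
  have r0: "r > 0" using r by (cases r) auto
  have "vsum n (\<lambda>j. eigen_proj n r ?f (\<rho> j) v) {1..r} $ p =
      (\<Sum>j=1..r. \<Sum>t<r. inverse (\<rho> j) ^ t / of_nat r * (?f ^^ t) v $ p)"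
    by (simp only: vsum_index[OF p] eigen_proj_index[OF A v p])
  also have "\<dots> = (\<Sum>t<r. \<Sum>j=1..r. inverse (\<rho> j) ^ t / of_nat r * (?f ^^ t) v $ p)" by (rule sum.swap)
  also have "\<dots> = (\<Sum>t<r. (\<Sum>j=1..r. inverse (\<rho> j) ^ t) * ((?f ^^ t) v $ p / of_nat r))"
    by (intro sum.cong refl) (simp add: sum_distrib_right sum_divide_distrib)
  also have "\<dots> = (\<Sum>t<r. if t = 0 then v $ p else 0)"
    using sum_inverse_powers_of_roots_of_unity[OF \<rho>] r by (intro sum.cong) auto
  also have "\<dots> = v $ p" using r0 by simp
  finally show "vsum n (\<lambda>j. eigen_proj n r ?f (\<rho> j) v) {1..r} $ p = v $ p" .
qed (use v in simp)

text \<open>The projections \<^const>\<open>eigen_proj\<close> sum up to the identity, and they recover the summands of a sum of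
  eigenvectors.\<close>

lemma splitting_of_eigenspaces:
  fixes A :: "'k::field mat"
  assumes A: "A \<in> carrier_mat n n" and Ar: "\<And>v. v \<in> carrier_vec n \<Longrightarrow> (((*\<^sub>v) A) ^^ r) v = v"
    and \<rho>: "bij_betw \<rho> {1..r} {z. z ^ r = 1}" and r: "(of_nat r :: 'k) \<noteq> 0"
    and X: "\<And>j. j \<in> {1..r} \<Longrightarrow> X j \<in> carrier_mat n (d j)"
    and Xb: "\<And>j. j \<in> {1..r} \<Longrightarrow> bij_betw (\<lambda>v. X j *\<^sub>v v) (carrier_vec (d j)) (eigen_space n A (\<rho> j))"
  shows "\<exists>R. splitting n {1..r} d X R"
proof (rule splitting_exists[OF _ X])
  have r0: "r > 0" using r by (cases r) auto
  have root: "\<rho> i ^ r = 1" if "i \<in> {1..r}" for i using bij_betwE[OF \<rho>] that by auto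
  fix p assume "p < n"
  let ?E = "\<lambda>j. eigen_proj n r ((*\<^sub>v) A) (\<rho> j) (unit_vec n p)"
  have "\<forall>j\<in>{1..r}. \<exists>x. x \<in> carrier_vec (d j) \<and> X j *\<^sub>v x = ?E j"
  proof
    fix j assume j: "j \<in> {1..r}"
    have "?E j \<in> eigen_space n A (\<rho> j)"
      by (rule eigen_proj_in_eigen_space[OF A _ Ar root[OF j] r0]) auto
    then have "?E j \<in> (\<lambda>v. X j *\<^sub>v v) ` carrier_vec (d j)" using Xb[OF j] by (simp add: bij_betw_def)
    then show "\<exists>x. x \<in> carrier_vec (d j) \<and> X j *\<^sub>v x = ?E j" by (metis imageE)
  qed
  from bchoice[OF this] obtain x where x: "\<forall>j\<in>{1..r}. x j \<in> carrier_vec (d j) \<and> X j *\<^sub>v x j = ?E j" ..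
  then have "vsum n (\<lambda>j. X j *\<^sub>v x j) {1..r} = vsum n ?E {1..r}" by (intro vsum_cong) auto
  then show "\<exists>x. (\<forall>j\<in>{1..r}. x j \<in> carrier_vec (d j)) \<and> vsum n (\<lambda>j. X j *\<^sub>v x j) {1..r} = unit_vec n p"
    using x sum_eigen_proj[OF A \<rho> r, of "unit_vec n p"] by (intro exI[of _ x]) auto
next
  fix x x' j
  assume x: "\<forall>j\<in>{1..r}. x j \<in> carrier_vec (d j)" "\<forall>j\<in>{1..r}. x' j \<in> carrier_vec (d j)"
    and e: "vsum n (\<lambda>j. X j *\<^sub>v x j) {1..r} = vsum n (\<lambda>j. X j *\<^sub>v x' j) {1..r}" and j: "j \<in> {1..r}"
  have m: "X j *\<^sub>v x j \<in> eigen_space n A (\<rho> j)" "X j *\<^sub>v x' j \<in> eigen_space n A (\<rho> j)" if "j \<in> {1..r}" for j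
    using bij_betwE[OF Xb[OF that]] x that by auto
  have "X j *\<^sub>v x j = X j *\<^sub>v x' j"
    using eigen_proj_of_decomposition[OF A \<rho> r m(1) j] eigen_proj_of_decomposition[OF A \<rho> r m(2) j] e by simp
  then show "x j = x' j" using Xb[OF j] x j by (auto simp: bij_betw_def inj_on_def)
qed simp

text \<open>The columns of \<open>X\<close> are a basis of \<open>W\<close>; the inverse map reads off the pivot entries.\<close>

lemma subspace_parametrization:
  fixes W :: "'k::field vec set"
  assumes W: "vec_subspace n W"
  shows "\<exists>X. X \<in> carrier_mat n (vec_subspace_dim n W) \<and>
     bij_betw (\<lambda>v. X *\<^sub>v v) (carrier_vec (vec_subspace_dim n W)) W"
proof -
  obtain J u where p: "pivot_basis n W J u" using pivot_basis_exists[OF W] by blast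
  have fin: "finite J" by (rule pivot_basis_finite[OF p])
  have dim: "vec_subspace_dim n W = card J" by (rule vec_subspace_dim_eq_card[OF W p])
  obtain h where h: "bij_betw h {..<card J} J"
    using ex_bij_betw_nat_finite[OF fin] by (auto simp: atLeast0LessThan)
  define g where "g = inv_into {..<card J} h"
  have g: "bij_betw g J {..<card J}" unfolding g_def by (rule bij_betw_inv_into[OF h])
  have hg: "h (g s) = s" if "s \<in> J" for s using h that by (simp add: g_def bij_betw_inv_into_right)
  have gh: "g (h q) = q" if "q < card J" for q using h that by (simp add: g_def bij_betw_inv_into_left)
  have gJ: "g s < card J" if "s \<in> J" for s using bij_betwE[OF g] that by auto
  have hJ: "h q \<in> J" if "q < card J" for q using bij_betwE[OF h] that by auto
  define X where "X = mat n (card J) (\<lambda>(p, q). u (h q) $ p)"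
  have X: "X \<in> carrier_mat n (card J)" by (simp add: X_def)
  have uc: "u s \<in> carrier_vec n" "u s \<in> W" if "s \<in> J" for s
    using p that vec_subspace_carrier[OF W] by (auto simp: pivot_basis_def)
  have Xv: "X *\<^sub>v v = vsum n (\<lambda>s. v $ g s \<cdot>\<^sub>v u s) J" if v: "v \<in> carrier_vec (card J)" for v
  proof (rule eq_vecI)
    fix b assume "b < dim_vec (vsum n (\<lambda>s. v $ g s \<cdot>\<^sub>v u s) J)"
    then have b: "b < n" by simp
    have "(X *\<^sub>v v) $ b = (\<Sum>q<card J. v $ q * X $$ (b, q))" by (rule mult_mat_vec_cols[OF X v b])
    also have "\<dots> = (\<Sum>s\<in>J. v $ g s * X $$ (b, g s))"
      using sum.reindex_bij_betw[OF g, of "\<lambda>q. v $ q * X $$ (b, q)"] by simp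
    also have "\<dots> = (\<Sum>s\<in>J. v $ g s * u s $ b)" using b gJ hg by (intro sum.cong) (auto simp: X_def)
    also have "\<dots> = vsum n (\<lambda>s. v $ g s \<cdot>\<^sub>v u s) J $ b" using b uc by (subst vsum_smult_index) auto
    finally show "(X *\<^sub>v v) $ b = vsum n (\<lambda>s. v $ g s \<cdot>\<^sub>v u s) J $ b" .
  qed (simp add: X_def)
  have "bij_betw (\<lambda>v. X *\<^sub>v v) (carrier_vec (card J)) W"
  proof (rule bij_betw_byWitness[where f' = "\<lambda>w. vec (card J) (\<lambda>q. w $ h q)"])
    show "\<forall>v\<in>carrier_vec (card J). vec (card J) (\<lambda>q. (X *\<^sub>v v) $ h q) = v"
    proof
      fix v :: "'k vec" assume v: "v \<in> carrier_vec (card J)"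
      have "(X *\<^sub>v v) $ h q = v $ q" if "q < card J" for q
        using pivot_basis_coeff[OF p hJ[OF that] W, of "\<lambda>s. v $ g s"] gh[OF that] Xv[OF v] by simp
      then show "vec (card J) (\<lambda>q. (X *\<^sub>v v) $ h q) = v" using v by (intro eq_vecI) (auto simp del: index_mult_mat_vec)
    qed
    show "\<forall>w\<in>W. X *\<^sub>v vec (card J) (\<lambda>q. w $ h q) = w"
    proof
      fix w assume w: "w \<in> W"
      have "X *\<^sub>v vec (card J) (\<lambda>q. w $ h q) = vsum n (\<lambda>s. w $ s \<cdot>\<^sub>v u s) J"
        using gJ hg by (subst Xv) (auto intro!: vsum_cong)
      then show "X *\<^sub>v vec (card J) (\<lambda>q. w $ h q) = w" using pivot_basis_expand[OF W p w] by simp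
    qed
    show "(\<lambda>v. X *\<^sub>v v) ` carrier_vec (card J) \<subseteq> W"
      using Xv uc by (auto intro!: vec_subspace_vsum[OF W] vec_subspace_smult[OF W])
  qed auto
  then show ?thesis using X dim by auto
qed

lemma vec_subspace_eigen_space:
  assumes "A \<in> carrier_mat n n"
  shows "vec_subspace n (eigen_space n A c)"
  unfolding vec_subspace_iff eigen_space_def using assms
  by (auto simp: mult_add_distrib_mat_vec mult_mat_vec mult_mat_vec_zero smult_add_distrib_vec smult_smult_assoc mult.commute)

section \<open>Representations of a free product of cyclic groups\<close>

lemma cyclic_carrier_powers:
  fixes G (structure)
  assumes "group G" "Coset.order G = r" "r \<ge> 1" "a \<in> carrier G" "generate G {a} = carrier G"
  shows "carrier G = {a [^]\<^bsub>G\<^esub> t | t :: nat. True}" and "group.ord G a = r" and "a [^]\<^bsub>G\<^esub> r = \<one>\<^bsub>G\<^esub>"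
proof -
  interpret group G by fact
  have "card (carrier G) > 0" using assms(2,3) by (simp add: Coset.order_def)
  then have fin: "finite (carrier G)" by (simp add: card_gt_0_iff)
  show "carrier G = {a [^] t | t :: nat. True}"
    using generate_pow_on_finite_carrier[OF fin assms(4)] assms(5) by simp
  show ord: "ord a = r" using generate_pow_card[OF assms(4)] assms(2,5) by (simp add: Coset.order_def)
  show "a [^] r = \<one>" using pow_order_eq_1[OF assms(4)] assms(2) by simp
qed

lemma pow_mat_add:
  fixes A :: "'k::comm_ring_1 mat"
  assumes A: "A \<in> carrier_mat n n"
  shows "A ^\<^sub>m (s + t) = A ^\<^sub>m s * A ^\<^sub>m t"
proof (induction t)
  case 0
  then show ?case using pow_carrier_mat[OF A, of s] A by simp
next
  case (Suc t)
  then show ?case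
    using assoc_mult_mat[OF pow_carrier_mat[OF A, of s] pow_carrier_mat[OF A, of t] A] by simp
qed

lemma pow_mat_multiple:
  fixes A :: "'k::comm_ring_1 mat"
  assumes A: "A \<in> carrier_mat n n" and r: "A ^\<^sub>m r = 1\<^sub>m n"
  shows "A ^\<^sub>m (r * q) = 1\<^sub>m n"
  using A by (induction q) (auto simp: pow_mat_add[OF A] r)

lemma pow_mat_iter:
  fixes A :: "'k::comm_ring_1 mat"
  assumes A: "A \<in> carrier_mat n n" and v: "v \<in> carrier_vec n"
  shows "A ^\<^sub>m t *\<^sub>v v = (((*\<^sub>v) A) ^^ t) v"
  using v
proof (induction t arbitrary: v)
  case (Suc t)
  have "A ^\<^sub>m Suc t *\<^sub>v v = A ^\<^sub>m t *\<^sub>v (A *\<^sub>v v)"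
    using assoc_mult_mat_vec[OF pow_carrier_mat[OF A] A Suc.prems] by simp
  also have "\<dots> = (((*\<^sub>v) A) ^^ t) (A *\<^sub>v v)" using A Suc.prems by (intro Suc.IH) auto
  finally show ?case by (simp add: funpow_swap1)
qed (use A in simp)

lemma mat_eqI_vec:
  fixes A B :: "'k::comm_ring_1 mat"
  assumes A: "A \<in> carrier_mat n l" and B: "B \<in> carrier_mat n l"
    and eq: "\<And>v. v \<in> carrier_vec l \<Longrightarrow> A *\<^sub>v v = B *\<^sub>v v"
  shows "A = B"
proof (rule eq_matI)
  fix p q assume "p < dim_row B" "q < dim_col B"
  then have pq: "p < n" "q < l" using B by auto
  have "A *\<^sub>v unit_vec l q = B *\<^sub>v unit_vec l q" by (rule eq) simp
  then have "(A *\<^sub>v unit_vec l q) $ p = (B *\<^sub>v unit_vec l q) $ p" by simp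
  then show "A $$ (p, q) = B $$ (p, q)" using A B pq by simp
qed (use A B in auto)

text \<open>The image of \<open>a [^] t\<close> is \<open>A ^\<^sub>m t\<close>; any exponent \<open>t\<close> gives the same matrix if \<open>A\<close> has the right order.\<close>

definition cyclic_rep :: "('g, 'b) monoid_scheme \<Rightarrow> 'g \<Rightarrow> 'k::field mat \<Rightarrow> 'g \<Rightarrow> 'k mat" where
  "cyclic_rep G a A g = A ^\<^sub>m (SOME t. g = a [^]\<^bsub>G\<^esub> (t :: nat))"

lemma cyclic_rep_pow:
  fixes G (structure) and t :: nat
  assumes G: "group G" and a: "a \<in> carrier G" and A: "A \<in> carrier_mat n n" "A ^\<^sub>m group.ord G a = 1\<^sub>m n"
  shows "cyclic_rep G a A (a [^]\<^bsub>G\<^esub> t) = A ^\<^sub>m t"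
proof -
  interpret group G by fact
  have le: "A ^\<^sub>m s = A ^\<^sub>m t" if "s \<le> t" "a [^] s = a [^] t" for s t :: nat
  proof -
    have "a [^] s \<otimes> a [^] (t - s) = a [^] s"
      using that nat_pow_mult[OF a, of s "t - s"] by simp
    then have "a [^] (t - s) = \<one>" using a by simp
    then have "ord a dvd t - s" using pow_eq_id[OF a] by blast
    then obtain q where "t - s = ord a * q" by (auto simp: dvd_def)
    then have t: "t = s + ord a * q" using that by simp
    have "A ^\<^sub>m t = A ^\<^sub>m s * A ^\<^sub>m (ord a * q)" unfolding t by (rule pow_mat_add[OF A(1)])
    also have "\<dots> = A ^\<^sub>m s" using pow_mat_multiple[OF A] right_mult_one_mat[OF pow_carrier_mat[OF A(1)]] by simp
    finally show ?thesis by simp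
  qed
  define s where "s = (SOME s. a [^] t = a [^] (s :: nat))"
  have "a [^] t = a [^] s" unfolding s_def by (rule someI[of _ t]) simp
  then have "A ^\<^sub>m s = A ^\<^sub>m t"
  proof (cases "s \<le> t")
    case True
    then show ?thesis using \<open>a [^] t = a [^] s\<close> by (intro le) auto
  next
    case False
    then show ?thesis using \<open>a [^] t = a [^] s\<close> by (intro le[symmetric]) auto
  qed
  then show ?thesis by (simp add: cyclic_rep_def s_def)
qed

definition word_rep :: "nat \<Rightarrow> ('i \<Rightarrow> 'g \<Rightarrow> 'k::field mat) \<Rightarrow> ('i \<times> 'g) list \<Rightarrow> 'k mat" where
  "word_rep n \<phi> w = foldr (\<lambda>(i, g) B. \<phi> i g * B) w (1\<^sub>m n)"

text \<open>The universal property of the free product: representations of the factors extend to words.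
  Reducing a word only merges neighbouring letters of the same factor, so multiplication by a
  letter is compatible with the matrices, and the general case follows letter by letter.\<close>

lemma group_rep_word_rep:
  fixes \<phi> :: "'i \<Rightarrow> 'g \<Rightarrow> 'k::field mat"
  assumes gr: "\<And>i. i \<in> I \<Longrightarrow> group (Gs i)"
    and c: "\<And>i g. i \<in> I \<Longrightarrow> g \<in> carrier (Gs i) \<Longrightarrow> \<phi> i g \<in> carrier_mat n n"
    and mult: "\<And>i g h. i \<in> I \<Longrightarrow> g \<in> carrier (Gs i) \<Longrightarrow> h \<in> carrier (Gs i) \<Longrightarrow>
       \<phi> i (g \<otimes>\<^bsub>Gs i\<^esub> h) = \<phi> i g * \<phi> i h"
    and one: "\<And>i. i \<in> I \<Longrightarrow> \<phi> i \<one>\<^bsub>Gs i\<^esub> = 1\<^sub>m n"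
  shows "group_rep (free_product I Gs) n (word_rep n \<phi>)"
proof -
  let ?N = "word_rep n \<phi>" and ?F = "free_product I Gs"
  have wc: "?N w \<in> carrier_mat n n" if "\<forall>(i, g)\<in>set w. i \<in> I \<and> g \<in> carrier (Gs i)" for w
    using that by (induction w) (auto simp: word_rep_def intro!: mult_carrier_mat c)
  have rc: "?N w \<in> carrier_mat n n" if "reduced_word I Gs w" for w
    using wc reduced_word_letters[OF that] by blast
  have letter: "?N (letter_mult Gs (i, g) w) = \<phi> i g * ?N w"
    if i: "i \<in> I" and g: "g \<in> carrier (Gs i)" and w: "reduced_word I Gs w" for i g w
  proof (cases w)
    case Nil
    then show ?thesis using one[OF i] c[OF i g] by (auto simp: word_rep_def)
  next
    case (Cons x w')
    obtain j h where x: "x = (j, h)" by (cases x)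
    have jh: "j \<in> I" "h \<in> carrier (Gs j)" "reduced_word I Gs w'"
      using w Cons x by (auto simp: reduced_word_Cons)
    have N: "?N w = \<phi> j h * ?N w'" by (simp add: word_rep_def Cons x)
    have N': "?N ((j, y) # w') = \<phi> j y * ?N w'" for y by (simp add: word_rep_def)
    have assoc: "\<phi> i g * (\<phi> j h * ?N w') = (\<phi> i g * \<phi> j h) * ?N w'"
      using assoc_mult_mat[OF c[OF i g] c[OF jh(1,2)] rc[OF jh(3)]] by simp
    show ?thesis
    proof (cases "g = \<one>\<^bsub>Gs i\<^esub>")
      case True
      then show ?thesis using one[OF i] rc[OF w] by (simp add: letter_mult_one)
    next
      case g1: False
      show ?thesis
      proof (cases "i = j")
        case False
        then show ?thesis using g1 Cons x by (simp add: word_rep_def)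
      next
        case True
        have "\<phi> i g * ?N w = \<phi> i (g \<otimes>\<^bsub>Gs i\<^esub> h) * ?N w'"
          using N assoc mult[OF i g] jh(2) True by simp
        then show ?thesis using g1 True Cons x N' one[OF i] rc[OF jh(3)] by auto
      qed
    qed
  qed
  have hom: "?N (foldr (letter_mult Gs) u w) = ?N u * ?N w"
    if u: "\<forall>(i, g)\<in>set u. i \<in> I \<and> g \<in> carrier (Gs i)" and w: "reduced_word I Gs w" for u w
    using u
  proof (induction u)
    case Nil
    then show ?case using rc[OF w] by (simp add: word_rep_def)
  next
    case (Cons x u)
    obtain i g where x: "x = (i, g)" by (cases x)
    have i: "i \<in> I" "g \<in> carrier (Gs i)" and u: "\<forall>(i, g)\<in>set u. i \<in> I \<and> g \<in> carrier (Gs i)"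
      using Cons.prems x by auto
    have red: "reduced_word I Gs (foldr (letter_mult Gs) u w)"
      by (rule reduced_word_foldr[OF gr u w])
    have "?N (foldr (letter_mult Gs) (x # u) w) = \<phi> i g * (?N u * ?N w)"
      using letter[OF i red] Cons.IH[OF u] x by simp
    also have "\<dots> = (\<phi> i g * ?N u) * ?N w"
      using assoc_mult_mat[OF c[OF i] wc[OF u] rc[OF w]] by simp
    finally show ?case by (simp add: word_rep_def x)
  qed
  interpret F: group ?F by (rule free_product_group[OF gr])
  have car: "w \<in> carrier ?F \<longleftrightarrow> reduced_word I Gs w" for w by (simp add: free_product_def)
  have hom': "?N (u \<otimes>\<^bsub>?F\<^esub> w) = ?N u * ?N w" if "u \<in> carrier ?F" "w \<in> carrier ?F" for u w
    using hom[of u w] that reduced_word_letters[of I Gs u] unfolding car by (simp add: free_product_def)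
  have N1: "?N \<one>\<^bsub>?F\<^esub> = 1\<^sub>m n" by (simp add: free_product_def word_rep_def)
  have "?N w \<in> Units (ring_mat TYPE('k) n ())" if w: "w \<in> carrier ?F" for w
  proof -
    have iw: "inv\<^bsub>?F\<^esub> w \<in> carrier ?F" using w by simp
    have "?N (inv\<^bsub>?F\<^esub> w) * ?N w = 1\<^sub>m n" "?N w * ?N (inv\<^bsub>?F\<^esub> w) = 1\<^sub>m n"
      using hom'[OF iw w] hom'[OF w iw] N1 w by auto
    moreover have "?N w \<in> carrier_mat n n" "?N (inv\<^bsub>?F\<^esub> w) \<in> carrier_mat n n"
      using w iw rc unfolding car by auto
    ultimately show ?thesis by (auto simp: Units_def ring_mat_simps)
  qed
  then show ?thesis
    unfolding group_rep_def hom_def using hom' by (auto simp: units_of_def ring_mat_simps)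
qed

lemma group_rep_carrier: "group_rep G n M \<Longrightarrow> g \<in> carrier G \<Longrightarrow> M g \<in> carrier_mat n n"
  by (auto simp: group_rep_def hom_def units_of_def Units_def ring_mat_simps)

lemma group_rep_mult: "group_rep G n M \<Longrightarrow> g \<in> carrier G \<Longrightarrow> h \<in> carrier G \<Longrightarrow> M (g \<otimes>\<^bsub>G\<^esub> h) = M g * M h"
  by (auto simp: group_rep_def hom_def units_of_def ring_mat_simps)

lemma group_rep_one:
  fixes M :: "'g \<Rightarrow> 'k::field mat"
  assumes "group_rep G n M" "group G"
  shows "M \<one>\<^bsub>G\<^esub> = 1\<^sub>m n"
proof -
  interpret R: ring "ring_mat TYPE('k) n ()" by (rule ring_mat)
  have "M \<one>\<^bsub>G\<^esub> = \<one>\<^bsub>units_of (ring_mat TYPE('k) n ())\<^esub>"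
    using hom_one[OF _ assms(2) R.units_group] assms(1) unfolding group_rep_def by blast
  then show ?thesis by (simp add: units_of_one ring_mat_simps)
qed

lemma free_product_incl_carrier:
  assumes "i \<in> I" "group (Gs i)" "g \<in> carrier (Gs i)"
  shows "free_product_incl Gs i g \<in> carrier (free_product I Gs)"
  using free_product_incl_hom[of i I Gs] assms by (auto simp: hom_def)

lemma group_rep_generator_pow:
  fixes t :: nat
  assumes M: "group_rep (free_product I Gs) n M" and gr: "\<And>i. i \<in> I \<Longrightarrow> group (Gs i)"
    and i: "i \<in> I" and a: "a i \<in> carrier (Gs i)"
  shows "M (free_product_incl Gs i (a i [^]\<^bsub>Gs i\<^esub> t)) = gen_images Gs a M i ^\<^sub>m t"
proof (induction t)
  case 0
  have "M \<one>\<^bsub>free_product I Gs\<^esub> = 1\<^sub>m n"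
    by (rule group_rep_one[OF M free_product_group[OF gr]])
  moreover have "gen_images Gs a M i \<in> carrier_mat n n"
    unfolding gen_images_def by (rule group_rep_carrier[OF M free_product_incl_carrier[where I = I and Gs = Gs, OF i gr[OF i] a]])
  ultimately show ?case by (simp add: free_product_incl_def free_product_def)
next
  case (Suc t)
  interpret G: group "Gs i" by (rule gr[OF i])
  have p: "a i [^]\<^bsub>Gs i\<^esub> t \<in> carrier (Gs i)" using a by simp
  have "free_product_incl Gs i (a i [^]\<^bsub>Gs i\<^esub> t \<otimes>\<^bsub>Gs i\<^esub> a i) =
      free_product_incl Gs i (a i [^]\<^bsub>Gs i\<^esub> t) \<otimes>\<^bsub>free_product I Gs\<^esub> free_product_incl Gs i (a i)"
    by (rule hom_mult[OF free_product_incl_hom[where I = I and Gs = Gs, OF i gr[OF i]] p a])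
  then show ?case
    using group_rep_mult[OF M free_product_incl_carrier[where I = I and Gs = Gs, OF i gr[OF i] p] free_product_incl_carrier[where I = I and Gs = Gs, OF i gr[OF i] a]] Suc
    by (simp add: gen_images_def)
qed

text \<open>The generators of the factors generate the free product.\<close>

lemma group_rep_invariant:
  assumes M: "group_rep (free_product I Gs) n M" and gr: "\<And>i. i \<in> I \<Longrightarrow> group (Gs i)"
    and car: "\<And>i. i \<in> I \<Longrightarrow> a i \<in> carrier (Gs i) \<and> carrier (Gs i) = {a i [^]\<^bsub>Gs i\<^esub> t | t :: nat. True}"
    and W: "W \<subseteq> carrier_vec n" and inv: "\<And>i v. i \<in> I \<Longrightarrow> v \<in> W \<Longrightarrow> gen_images Gs a M i *\<^sub>v v \<in> W"
    and w: "w \<in> carrier (free_product I Gs)" and v: "v \<in> W"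
  shows "M w *\<^sub>v v \<in> W"
proof -
  have "reduced_word I Gs w" using w by (simp add: free_product_def)
  then show ?thesis
  proof (induction w)
    case Nil
    have "M \<one>\<^bsub>free_product I Gs\<^esub> = 1\<^sub>m n" by (rule group_rep_one[OF M free_product_group[OF gr]])
    then show ?case using v W by (auto simp: free_product_def)
  next
    case (Cons x w)
    obtain i g where x: "x = (i, g)" by (cases x)
    have i: "i \<in> I" "g \<in> carrier (Gs i)" "g \<noteq> \<one>\<^bsub>Gs i\<^esub>" and w: "reduced_word I Gs w" "w = [] \<or> fst (hd w) \<noteq> i"
      using Cons.prems x by (auto simp: reduced_word_Cons)
    obtain t :: nat where t: "g = a i [^]\<^bsub>Gs i\<^esub> t" using car[OF i(1)] i(2) by blast
    have A: "gen_images Gs a M i \<in> carrier_mat n n"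
      unfolding gen_images_def by (rule group_rep_carrier[OF M free_product_incl_carrier[where I = I and Gs = Gs, OF i(1) gr[OF i(1)]]]) (use car[OF i(1)] in blast)
    have gc: "free_product_incl Gs i g \<in> carrier (free_product I Gs)"
      by (rule free_product_incl_carrier[where Gs = Gs, OF i(1) gr[OF i(1)] i(2)])
    have wc: "w \<in> carrier (free_product I Gs)" using w by (simp add: free_product_def)
    have "free_product_incl Gs i g \<otimes>\<^bsub>free_product I Gs\<^esub> w = x # w"
      using i w x by (cases w) (auto simp: free_product_incl_def free_product_def)
    then have "M (x # w) = M (free_product_incl Gs i g) * M w" using group_rep_mult[OF M gc wc] by simp
    also have "M (free_product_incl Gs i g) = gen_images Gs a M i ^\<^sub>m t"
      unfolding t using car[OF i(1)] by (intro group_rep_generator_pow[where I = I and Gs = Gs and a = a, OF M gr i(1)]) auto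
    finally have "M (x # w) *\<^sub>v v = gen_images Gs a M i ^\<^sub>m t *\<^sub>v (M w *\<^sub>v v)"
      using assoc_mult_mat_vec[OF pow_carrier_mat[OF A] group_rep_carrier[OF M wc], of v t] v W by auto
    also have "\<dots> = (((*\<^sub>v) (gen_images Gs a M i)) ^^ t) (M w *\<^sub>v v)"
      using Cons.IH[OF w(1)] W by (intro pow_mat_iter[OF A]) auto
    also have "\<dots> \<in> W"
      using Cons.IH[OF w(1)] inv[OF i(1)] by (induction t) auto
    finally show ?case .
  qed
qed

text \<open>On the \<open>i\<close>-th decomposition the generator acts by scalars on the summands, so a subspace that is
  invariant under the projections is a subrepresentation.\<close>

lemma simple_rep_imp_irreducible:
  fixes M :: "(nat \<times> 'g) list \<Rightarrow> 'k::field mat"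
  assumes M: "simple_group_rep (free_product {1..m} Gs) n M"
    and gr: "\<And>i. i \<in> {1..m} \<Longrightarrow> group (Gs i)"
    and car: "\<And>i. i \<in> {1..m} \<Longrightarrow> a i \<in> carrier (Gs i) \<and> carrier (Gs i) = {a i [^]\<^bsub>Gs i\<^esub> t | t :: nat. True}"
    and n: "d Sink = n" and s: "star_splitting m r d X R"
    and e: "eigenspace_rep m r d \<rho> (gen_images Gs a M) X"
  shows "irreducible_star m r d X R"
  unfolding irreducible_star_def n
proof (intro allI impI, elim conjE)
  fix W assume W: "vec_subspace n W"
    and inv: "\<forall>i\<in>{1..m}. \<forall>j\<in>{1..r i}. \<forall>w\<in>W. X (i, j) *\<^sub>v (R (i, j) *\<^sub>v w) \<in> W"
  have G: "group_rep (free_product {1..m} Gs) n M" using M by (simp add: simple_group_rep_def)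
  have Wc: "W \<subseteq> carrier_vec n" using W by (simp add: vec_subspace_iff)
  have AW: "gen_images Gs a M i *\<^sub>v v \<in> W" if i: "i \<in> {1..m}" and v: "v \<in> W" for i v
  proof -
    let ?A = "gen_images Gs a M i"
    have A: "?A \<in> carrier_mat n n"
      unfolding gen_images_def using car[OF i]
      by (intro group_rep_carrier[OF G] free_product_incl_carrier[where Gs = Gs, OF i gr[OF i]]) blast
    have sp: "splitting n {1..r i} (\<lambda>j. d (Source i j)) (\<lambda>j. X (i, j)) (\<lambda>j. R (i, j))"
      using star_splittingD[OF s i] n by simp
    have vc: "v \<in> carrier_vec n" using v Wc by blast
    let ?y = "\<lambda>j. X (i, j) *\<^sub>v (R (i, j) *\<^sub>v v)"
    have y: "?y j \<in> eigen_space n ?A (\<rho> i j)" if j: "j \<in> {1..r i}" for j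
    proof -
      have "R (i, j) *\<^sub>v v \<in> carrier_vec (d (Source i j))" using splittingD(3)[OF sp j] vc by auto
      moreover have "bij_betw (\<lambda>v. X (i, j) *\<^sub>v v) (carrier_vec (d (Source i j))) (eigen_space n ?A (\<rho> i j))"
        using e i j n by (simp add: eigenspace_rep_def)
      ultimately show ?thesis by (auto dest: bij_betwE)
    qed
    have "?A *\<^sub>v v = ?A *\<^sub>v vsum n ?y {1..r i}" using splittingD(5)[OF sp vc] by simp
    also have "\<dots> = vsum n (\<lambda>j. ?A *\<^sub>v ?y j) {1..r i}"
      using y by (intro mult_mat_vec_vsum[OF A]) (auto simp: eigen_space_def)
    also have "\<dots> = vsum n (\<lambda>j. \<rho> i j \<cdot>\<^sub>v ?y j) {1..r i}"
      using y by (intro vsum_cong) (auto simp: eigen_space_def)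
    also have "\<dots> \<in> W"
      using inv i v by (intro vec_subspace_vsum[OF W] vec_subspace_smult[OF W]) auto
    finally show ?thesis .
  qed
  have "M g *\<^sub>v v \<in> W" if "g \<in> carrier (free_product {1..m} Gs)" "v \<in> W" for g v
    by (rule group_rep_invariant[where I = "{1..m}" and Gs = Gs and a = a, OF G gr car Wc AW that])
  then show "W = {0\<^sub>v n} \<or> W = carrier_vec n"
    using M W unfolding simple_group_rep_def by blast
qed

text \<open>Let \<open>A i\<close> act by \<open>\<rho> i j\<close> on the \<open>j\<close>-th summand of the \<open>i\<close>-th decomposition.  These matrices satisfy
  \<open>A i ^ r i = 1\<close>, so they define a representation of the free product.  Its subrepresentations are
  invariant under the projections, which are the \<^const>\<open>eigen_proj\<close> of the \<open>A i\<close>.\<close>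

lemma irreducible_imp_simple_rep:
  fixes X :: "nat \<times> nat \<Rightarrow> 'k::field mat" and Gs :: "nat \<Rightarrow> 'g monoid"
  assumes gr: "\<And>i. i \<in> {1..m} \<Longrightarrow> group (Gs i) \<and> Coset.order (Gs i) = r i"
    and r: "\<And>i. i \<in> {1..m} \<Longrightarrow> r i \<ge> 2"
    and a: "\<And>i. i \<in> {1..m} \<Longrightarrow> a i \<in> carrier (Gs i) \<and> generate (Gs i) {a i} = carrier (Gs i)"
    and ch: "\<And>i. i \<in> {1..m} \<Longrightarrow> (of_nat (r i) :: 'k) \<noteq> 0"
    and \<rho>: "\<And>i. i \<in> {1..m} \<Longrightarrow> bij_betw (\<rho> i) {1..r i} {z. z ^ r i = 1}"
    and n: "d Sink = n" "n \<ge> 1" and s: "star_splitting m r d X R" and irr: "irreducible_star m r d X R"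
  shows "\<exists>N :: (nat \<times> 'g) list \<Rightarrow> 'k mat. simple_group_rep (free_product {1..m} Gs) n N \<and>
     eigenspace_rep m r d \<rho> (gen_images Gs a N) X"
proof -
  let ?F = "free_product {1..m} Gs"
  have sp: "splitting n {1..r i} (\<lambda>j. d (Source i j)) (\<lambda>j. X (i, j)) (\<lambda>j. R (i, j))" if "i \<in> {1..m}" for i
    using star_splittingD[OF s that] n by simp
  have X: "X (i, j) \<in> carrier_mat n (d (Source i j))" and R: "R (i, j) \<in> carrier_mat (d (Source i j)) n"
    if "i \<in> {1..m}" "j \<in> {1..r i}" for i j
    using splittingD(2,3)[OF sp[OF that(1)] that(2)] by auto
  have root: "\<rho> i j ^ r i = 1" if "i \<in> {1..m}" "j \<in> {1..r i}" for i j
    using bij_betwE[OF \<rho>[OF that(1)]] that(2) by auto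
  define A where "A i = mat n n (\<lambda>(p, q). \<Sum>j=1..r i. \<rho> i j * (X (i, j) * R (i, j)) $$ (p, q))" for i
  have A: "A i \<in> carrier_mat n n" for i by (simp add: A_def)
  define y where "y i v j = X (i, j) *\<^sub>v (R (i, j) *\<^sub>v v)" for i v j
  have yc: "y i v j \<in> carrier_vec n" if "i \<in> {1..m}" "j \<in> {1..r i}" "v \<in> carrier_vec n" for i j v
    using X[OF that(1,2)] R[OF that(1,2)] that(3) unfolding y_def by auto
  have Av: "A i *\<^sub>v v = vsum n (\<lambda>j. \<rho> i j \<cdot>\<^sub>v y i v j) {1..r i}"
    if i: "i \<in> {1..m}" and v: "v \<in> carrier_vec n" for i v
  proof (rule eq_vecI)
    fix p assume "p < dim_vec (vsum n (\<lambda>j. \<rho> i j \<cdot>\<^sub>v y i v j) {1..r i})"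
    then have p: "p < n" by simp
    have "(A i *\<^sub>v v) $ p = (\<Sum>q<n. v $ q * A i $$ (p, q))" by (rule mult_mat_vec_cols[OF A v p])
    also have "\<dots> = (\<Sum>q<n. \<Sum>j=1..r i. \<rho> i j * (v $ q * (X (i, j) * R (i, j)) $$ (p, q)))"
      using p by (intro sum.cong) (auto simp: A_def sum_distrib_left mult_ac simp del: index_mult_mat)
    also have "\<dots> = (\<Sum>j=1..r i. \<Sum>q<n. \<rho> i j * (v $ q * (X (i, j) * R (i, j)) $$ (p, q)))" by (rule sum.swap)
    also have "\<dots> = (\<Sum>j=1..r i. \<rho> i j * y i v j $ p)"
    proof (rule sum.cong)
      fix j assume j: "j \<in> {1..r i}"
      have "(X (i, j) * R (i, j)) *\<^sub>v v = y i v j"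
        unfolding y_def by (rule assoc_mult_mat_vec[OF X[OF i j] R[OF i j] v])
      then have "y i v j $ p = (\<Sum>q<n. v $ q * (X (i, j) * R (i, j)) $$ (p, q))"
        using mult_mat_vec_cols[OF mult_carrier_mat[OF X[OF i j] R[OF i j]] v p] by simp
      then show "(\<Sum>q<n. \<rho> i j * (v $ q * (X (i, j) * R (i, j)) $$ (p, q))) = \<rho> i j * y i v j $ p"
        by (simp only: sum_distrib_left)
    qed simp
    also have "\<dots> = vsum n (\<lambda>j. \<rho> i j \<cdot>\<^sub>v y i v j) {1..r i} $ p"
      using yc[OF i _ v] p by (subst vsum_smult_index) auto
    finally show "(A i *\<^sub>v v) $ p = vsum n (\<lambda>j. \<rho> i j \<cdot>\<^sub>v y i v j) {1..r i} $ p" .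
  qed (simp add: A_def)
  have vy: "vsum n (y i v) {1..r i} = v" if "i \<in> {1..m}" "v \<in> carrier_vec n" for i v
    using splittingD(5)[OF sp[OF that(1)] that(2)] by (simp add: y_def[abs_def])
  have RA: "R (i, j) *\<^sub>v (A i *\<^sub>v v) = \<rho> i j \<cdot>\<^sub>v (R (i, j) *\<^sub>v v)"
    if i: "i \<in> {1..m}" and j: "j \<in> {1..r i}" and v: "v \<in> carrier_vec n" for i j v
  proof -
    have c: "R (i, k) *\<^sub>v v \<in> carrier_vec (d (Source i k))" if "k \<in> {1..r i}" for k using R[OF i that] v by auto
    have "A i *\<^sub>v v = vsum n (\<lambda>j. X (i, j) *\<^sub>v (\<rho> i j \<cdot>\<^sub>v (R (i, j) *\<^sub>v v))) {1..r i}"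
      unfolding Av[OF i v] y_def using mult_mat_vec[OF X[OF i] c] by (intro vsum_cong) auto
    then show ?thesis
      using splitting_vsum[OF sp[OF i] j, of "\<lambda>j. \<rho> i j \<cdot>\<^sub>v (R (i, j) *\<^sub>v v)"] c by auto
  qed
  have eig: "X (i, j) *\<^sub>v x \<in> eigen_space n (A i) (\<rho> i j)"
    if i: "i \<in> {1..m}" and j: "j \<in> {1..r i}" and x: "x \<in> carrier_vec (d (Source i j))" for i j x
  proof -
    let ?v = "X (i, j) *\<^sub>v x"
    have v: "?v \<in> carrier_vec n" using X[OF i j] x by auto
    have yk: "y i ?v k = (if k = j then ?v else 0\<^sub>v n)" if k: "k \<in> {1..r i}" for k
      using splittingD(4)[OF sp[OF i] k j x] mult_mat_vec_zero[OF X[OF i k]] by (simp add: y_def)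
    have "A i *\<^sub>v ?v = vsum n (\<lambda>k. \<rho> i k \<cdot>\<^sub>v y i ?v k) {j}"
      unfolding Av[OF i v] using j yk by (intro vsum_supported) auto
    also have "\<dots> = \<rho> i j \<cdot>\<^sub>v y i ?v j" using yc[OF i j v] by (intro vsum_singleton) auto
    also have "\<dots> = \<rho> i j \<cdot>\<^sub>v ?v" using yk[OF j] by simp
    finally show ?thesis using v by (simp add: eigen_space_def)
  qed
  have ye: "y i v j \<in> eigen_space n (A i) (\<rho> i j)" if "i \<in> {1..m}" "j \<in> {1..r i}" "v \<in> carrier_vec n" for i j v
    unfolding y_def using R[OF that(1,2)] that(3) by (intro eig[OF that(1,2)]) auto
  have eb: "bij_betw (\<lambda>v. X (i, j) *\<^sub>v v) (carrier_vec (d (Source i j))) (eigen_space n (A i) (\<rho> i j))"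
    if i: "i \<in> {1..m}" and j: "j \<in> {1..r i}" for i j
  proof (rule bij_betw_byWitness[where f' = "\<lambda>v. R (i, j) *\<^sub>v v"])
    show "\<forall>x\<in>carrier_vec (d (Source i j)). R (i, j) *\<^sub>v (X (i, j) *\<^sub>v x) = x"
      using splittingD(4)[OF sp[OF i] j j] by simp
    show "\<forall>v\<in>eigen_space n (A i) (\<rho> i j). X (i, j) *\<^sub>v (R (i, j) *\<^sub>v v) = v"
    proof
      fix v assume "v \<in> eigen_space n (A i) (\<rho> i j)"
      then have v: "v \<in> carrier_vec n" and e: "A i *\<^sub>v v = \<rho> i j \<cdot>\<^sub>v v" by (auto simp: eigen_space_def)
      have "y i v k = 0\<^sub>v n" if k: "k \<in> {1..r i}" "k \<notin> {j}" for k
      proof -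
        have rc: "R (i, k) *\<^sub>v v \<in> carrier_vec (d (Source i k))" using R[OF i k(1)] v by auto
        have "\<rho> i k \<cdot>\<^sub>v (R (i, k) *\<^sub>v v) = \<rho> i j \<cdot>\<^sub>v (R (i, k) *\<^sub>v v)"
          using RA[OF i k(1) v] mult_mat_vec[OF R[OF i k(1)] v] unfolding e by simp
        then have "\<rho> i k * (R (i, k) *\<^sub>v v) $ q = \<rho> i j * (R (i, k) *\<^sub>v v) $ q" if "q < d (Source i k)" for q
          using smult_vec_nth[OF rc that] by metis
        moreover have "\<rho> i k \<noteq> \<rho> i j"
          using inj_on_eq_iff[OF bij_betw_imp_inj_on[OF \<rho>[OF i]] k(1) j] k(2) by simp
        ultimately have "(R (i, k) *\<^sub>v v) $ q = 0" if "q < d (Source i k)" for q using that by (metis mult_cancel_right)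
        moreover have "x = 0\<^sub>v l" if "x \<in> carrier_vec l" "\<And>q. q < l \<Longrightarrow> x $ q = 0" for x :: "'k vec" and l
          using that by (intro eq_vecI) auto
        ultimately have "R (i, k) *\<^sub>v v = 0\<^sub>v (d (Source i k))" using rc by blast
        then show ?thesis using mult_mat_vec_zero[OF X[OF i k(1)]] by (simp add: y_def)
      qed
      then have "v = vsum n (y i v) {j}"
        using vsum_supported[of "{1..r i}" "{j}" "y i v" n] j vy[OF i v] by simp
      also have "\<dots> = y i v j" by (intro vsum_singleton yc[OF i j v])
      finally show "X (i, j) *\<^sub>v (R (i, j) *\<^sub>v v) = v" by (simp add: y_def)
    qed
    show "(\<lambda>v. X (i, j) *\<^sub>v v) ` carrier_vec (d (Source i j)) \<subseteq> eigen_space n (A i) (\<rho> i j)"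
      using eig[OF i j] by blast
    show "(\<lambda>v. R (i, j) *\<^sub>v v) ` eigen_space n (A i) (\<rho> i j) \<subseteq> carrier_vec (d (Source i j))"
      using R[OF i j] by (auto simp: eigen_space_def intro!: mult_mat_vec_carrier)
  qed
  have Ar: "A i ^\<^sub>m r i = 1\<^sub>m n" if i: "i \<in> {1..m}" for i
  proof (rule mat_eqI_vec[OF pow_carrier_mat[OF A] one_carrier_mat])
    fix v :: "'k vec" assume v: "v \<in> carrier_vec n"
    have "A i ^\<^sub>m r i *\<^sub>v v = (((*\<^sub>v) (A i)) ^^ r i) (vsum n (y i v) {1..r i})"
      using pow_mat_iter[OF A v] vy[OF i v] by simp
    also have "\<dots> = vsum n (\<lambda>j. (((*\<^sub>v) (A i)) ^^ r i) (y i v j)) {1..r i}"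
      by (rule iter_mat_vsum[OF A yc[OF i _ v]])
    also have "\<dots> = vsum n (y i v) {1..r i}"
    proof (rule vsum_cong[OF refl])
      fix j assume j: "j \<in> {1..r i}"
      have "A i *\<^sub>v y i v j = \<rho> i j \<cdot>\<^sub>v y i v j" using ye[OF i j v] by (simp add: eigen_space_def)
      from iter_mat_eigenvector[OF A yc[OF i j v] this, of "r i"]
      show "(((*\<^sub>v) (A i)) ^^ r i) (y i v j) = y i v j" using root[OF i j] by simp
    qed
    also have "\<dots> = 1\<^sub>m n *\<^sub>v v" using vy[OF i v] v by simp
    finally show "A i ^\<^sub>m r i *\<^sub>v v = 1\<^sub>m n *\<^sub>v v" .
  qed
  define \<phi> where "\<phi> i = cyclic_rep (Gs i) (a i) (A i)" for i
  have cyc: "carrier (Gs i) = {a i [^]\<^bsub>Gs i\<^esub> t | t :: nat. True}" "A i ^\<^sub>m group.ord (Gs i) (a i) = 1\<^sub>m n"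
    if i: "i \<in> {1..m}" for i
    using cyclic_carrier_powers[of "Gs i" "r i" "a i"] gr[OF i] r[OF i] a[OF i] Ar[OF i] by auto
  have \<phi>p: "\<phi> i (a i [^]\<^bsub>Gs i\<^esub> t) = A i ^\<^sub>m t" if i: "i \<in> {1..m}" for i and t :: nat
    unfolding \<phi>_def using gr[OF i] a[OF i] by (intro cyclic_rep_pow[OF _ _ A cyc(2)[OF i]]) auto
  have N: "group_rep ?F n (word_rep n \<phi>)"
  proof (rule group_rep_word_rep)
    fix i assume i: "i \<in> {1..m}"
    interpret G: group "Gs i" using gr[OF i] by blast
    have ai: "a i \<in> carrier (Gs i)" using a[OF i] by blast
    show "group (Gs i)" by unfold_locales
    show "\<phi> i \<one>\<^bsub>Gs i\<^esub> = 1\<^sub>m n" using \<phi>p[OF i, of 0] A[of i] by simp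
    fix g assume "g \<in> carrier (Gs i)"
    then obtain t :: nat where g: "g = a i [^]\<^bsub>Gs i\<^esub> t" using cyc(1)[OF i] by blast
    show "\<phi> i g \<in> carrier_mat n n" unfolding g \<phi>p[OF i] by (rule pow_carrier_mat[OF A])
    fix h assume "h \<in> carrier (Gs i)"
    then obtain u :: nat where h: "h = a i [^]\<^bsub>Gs i\<^esub> u" using cyc(1)[OF i] by blast
    have "g \<otimes>\<^bsub>Gs i\<^esub> h = a i [^]\<^bsub>Gs i\<^esub> (t + u)" unfolding g h by (rule G.nat_pow_mult[OF ai])
    then show "\<phi> i (g \<otimes>\<^bsub>Gs i\<^esub> h) = \<phi> i g * \<phi> i h"
      unfolding g h by (simp only: \<phi>p[OF i] pow_mat_add[OF A])
  qed
  have gen: "gen_images Gs a (word_rep n \<phi>) i = A i" if i: "i \<in> {1..m}" for i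
  proof -
    interpret G: group "Gs i" using gr[OF i] by blast
    have ai: "a i \<in> carrier (Gs i)" using a[OF i] by blast
    have p: "\<phi> i (a i) = A i" using \<phi>p[OF i, of 1] ai A[of i] by simp
    have "a i = \<one>\<^bsub>Gs i\<^esub> \<Longrightarrow> A i = 1\<^sub>m n" using p \<phi>p[OF i, of 0] A[of i] by simp
    then show ?thesis using p A[of i] by (auto simp: gen_images_def free_product_incl_def word_rep_def)
  qed
  have "simple_group_rep ?F n (word_rep n \<phi>)"
    unfolding simple_group_rep_def
  proof (intro conjI allI impI, rule N)
    show "n \<noteq> 0" using n by simp
    fix W assume "vec_subspace n W \<and> (\<forall>g\<in>carrier ?F. \<forall>v\<in>W. word_rep n \<phi> g *\<^sub>v v \<in> W)"
    then have W: "vec_subspace n W" and inv: "\<And>g v. g \<in> carrier ?F \<Longrightarrow> v \<in> W \<Longrightarrow> word_rep n \<phi> g *\<^sub>v v \<in> W" by auto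
    have AW: "A i *\<^sub>v v \<in> W" if i: "i \<in> {1..m}" and "v \<in> W" for i v
    proof -
      have "free_product_incl Gs i (a i) \<in> carrier ?F"
        using gr[OF i] a[OF i] by (intro free_product_incl_carrier[where Gs = Gs, OF i]) auto
      from inv[OF this that(2)] show ?thesis using gen[OF i] by (simp add: gen_images_def)
    qed
    have it: "(((*\<^sub>v) (A i)) ^^ t) v \<in> W" if "i \<in> {1..m}" "v \<in> W" for i t v
      using that AW by (induction t) auto
    have "X (i, j) *\<^sub>v (R (i, j) *\<^sub>v w) \<in> W" if i: "i \<in> {1..m}" and j: "j \<in> {1..r i}" and w: "w \<in> W" for i j w
    proof -
      have wc: "w \<in> carrier_vec n" by (rule vec_subspace_carrier[OF W w])
      have "y i w j = eigen_proj n (r i) ((*\<^sub>v) (A i)) (\<rho> i j) (vsum n (y i w) {1..r i})"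
        by (rule eigen_proj_of_decomposition[OF A \<rho>[OF i] ch[OF i] ye[OF i _ wc] j, symmetric])
      also have "\<dots> = eigen_proj n (r i) ((*\<^sub>v) (A i)) (\<rho> i j) w" using vy[OF i wc] by simp
      also have "\<dots> \<in> W"
        unfolding eigen_proj_def by (intro vec_subspace_vsum[OF W] vec_subspace_smult[OF W] it[OF i w])
      finally show ?thesis by (simp add: y_def)
    qed
    then show "W = {0\<^sub>v n} \<or> W = carrier_vec n"
      using irr W unfolding irreducible_star_def n(1) by blast
  qed
  moreover have "eigenspace_rep m r d \<rho> (gen_images Gs a (word_rep n \<phi>)) X"
    unfolding eigenspace_rep_def n(1) using eb gen by simp
  ultimately show ?thesis by blast
qed

section \<open>Stable dimension vectors and simple representations\<close>

theorem theorem9p2: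
  fixes m n :: nat and r :: "nat \<Rightarrow> nat"
    and Gs :: "nat \<Rightarrow> 'g monoid" and a :: "nat \<Rightarrow> 'g"
    and \<rho> :: "nat \<Rightarrow> nat \<Rightarrow> 'k::alg_closed_field"
    and M :: "(nat \<times> 'g) list \<Rightarrow> 'k mat"
    and d :: "star_vertex \<Rightarrow> nat"
  assumes "m \<ge> 1"
    and "\<And>i. i \<in> {1..m} \<Longrightarrow> r i \<ge> 2"
    and "\<And>i. i \<in> {1..m} \<Longrightarrow> group (Gs i) \<and> Coset.order (Gs i) = r i"
    and "\<And>i. i \<in> {1..m} \<Longrightarrow> a i \<in> carrier (Gs i) \<and> generate (Gs i) {a i} = carrier (Gs i)"
    and "\<And>i. i \<in> {1..m} \<Longrightarrow> \<not> CHAR('k) dvd r i"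
    and "\<And>i. i \<in> {1..m} \<Longrightarrow> bij_betw (\<rho> i) {1..r i} {z. z ^ r i = 1}"
    and "n \<ge> 1"
    and "group_rep (free_product {1..m} Gs) n M"
    and "d = eigen_dim_vector n \<rho> (gen_images Gs a M)"
  shows
    "(stable_dim_vector TYPE('k) (star_quiver m r) (star_weight m) d \<longleftrightarrow>
        n = 1 \<or>
        special_isotropic m r d \<and> \<not> divisible_dim_vector (star_quiver m r) d \<or>
        \<not> special_isotropic m r d \<and>
          (\<Sum>i=1..m. Max ((\<lambda>j. d (Source i j)) ` {1..r i})) \<le> (m - 1) * n) \<and>
     (special_isotropic m r d \<and> \<not> divisible_dim_vector (star_quiver m r) d \<longrightarrow>
        n = 2 \<and> card {(i, j). i \<in> {1..m} \<and> j \<in> {1..r i} \<and> d (Source i j) = 1} = 4) \<and>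
     (simple_group_rep (free_product {1..m} Gs) n M \<longrightarrow>
        stable_dim_vector TYPE('k) (star_quiver m r) (star_weight m) d \<and>
        (n = 1 \<or>
         special_isotropic m r d \<and> \<not> divisible_dim_vector (star_quiver m r) d \<or>
         \<not> special_isotropic m r d \<and>
           (\<Sum>i=1..m. Max ((\<lambda>j. d (Source i j)) ` {1..r i})) \<le> (m - 1) * n)) \<and>
     (stable_dim_vector TYPE('k) (star_quiver m r) (star_weight m) d \<longrightarrow>
        (\<exists>S. openin (subtopology (zariski (star_quiver m r) d) (invertible_reps m r d)) S \<and>
             subtopology (zariski (star_quiver m r) d) (invertible_reps m r d) closure_of S =
               invertible_reps m r d \<and>
             (\<forall>X\<in>S. \<exists>N :: (nat \<times> 'g) list \<Rightarrow> 'k mat.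
                simple_group_rep (free_product {1..m} Gs) n N \<and>
                eigenspace_rep m r d \<rho> (gen_images Gs a N) X)))"
proof -
  let ?F = "free_product {1..m} Gs" and ?Q = "star_quiver m r"
  define A where "A = gen_images Gs a M"
  have gr: "group (Gs i)" if "i \<in> {1..m}" for i using assms(3)[OF that] by blast
  have car: "a i \<in> carrier (Gs i) \<and> carrier (Gs i) = {a i [^]\<^bsub>Gs i\<^esub> t | t :: nat. True}"
    and apow: "a i [^]\<^bsub>Gs i\<^esub> r i = \<one>\<^bsub>Gs i\<^esub>" if i: "i \<in> {1..m}" for i
    using cyclic_carrier_powers[of "Gs i" "r i" "a i"] assms(2)[OF i] assms(3)[OF i] assms(4)[OF i] by auto
  have ch: "(of_nat (r i) :: 'k) \<noteq> 0" if "i \<in> {1..m}" for i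
    using assms(5)[OF that] by (simp add: of_nat_eq_0_iff_char_dvd)
  have ai: "a i \<in> carrier (Gs i)" if "i \<in> {1..m}" for i using assms(4)[OF that] by blast
  have Ac: "A i \<in> carrier_mat n n" if i: "i \<in> {1..m}" for i
    unfolding A_def gen_images_def
    by (rule group_rep_carrier[OF assms(8) free_product_incl_carrier[where I = "{1..m}" and Gs = Gs, OF i gr[OF i] ai[OF i]]])
  have Ar: "A i ^\<^sub>m r i = 1\<^sub>m n" if i: "i \<in> {1..m}" for i
  proof -
    have "A i ^\<^sub>m r i = M (free_product_incl Gs i (a i [^]\<^bsub>Gs i\<^esub> r i))"
      unfolding A_def
      by (rule group_rep_generator_pow[where I = "{1..m}" and Gs = Gs and a = a, OF assms(8) gr i ai[OF i], symmetric])
    also have "\<dots> = M \<one>\<^bsub>?F\<^esub>" by (simp add: apow[OF i] free_product_incl_def free_product_def)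
    also have "\<dots> = 1\<^sub>m n" by (rule group_rep_one[OF assms(8) free_product_group[OF gr]])
    finally show ?thesis .
  qed
  have Aiter: "(((*\<^sub>v) (A i)) ^^ r i) v = v" if i: "i \<in> {1..m}" and v: "v \<in> carrier_vec n" for i v
    using pow_mat_iter[OF Ac[OF i] v, of "r i"] Ar[OF i] v by simp
  have dS: "d Sink = n" by (simp add: assms(9) eigen_dim_vector_def)
  have dE: "d (Source i j) = vec_subspace_dim n (eigen_space n (A i) (\<rho> i j))" for i j
    by (simp add: assms(9) eigen_dim_vector_def A_def)
  have "\<forall>\<alpha>\<in>arcs ?Q. \<exists>Y. Y \<in> carrier_mat n (d (Source (fst \<alpha>) (snd \<alpha>))) \<and>
      bij_betw (\<lambda>v. Y *\<^sub>v v) (carrier_vec (d (Source (fst \<alpha>) (snd \<alpha>))))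
        (eigen_space n (A (fst \<alpha>)) (\<rho> (fst \<alpha>) (snd \<alpha>)))"
  proof
    fix \<alpha> assume "\<alpha> \<in> arcs ?Q"
    then have i: "fst \<alpha> \<in> {1..m}" by auto
    show "\<exists>Y. Y \<in> carrier_mat n (d (Source (fst \<alpha>) (snd \<alpha>))) \<and>
      bij_betw (\<lambda>v. Y *\<^sub>v v) (carrier_vec (d (Source (fst \<alpha>) (snd \<alpha>))))
        (eigen_space n (A (fst \<alpha>)) (\<rho> (fst \<alpha>) (snd \<alpha>)))"
      unfolding dE by (rule subspace_parametrization[OF vec_subspace_eigen_space[OF Ac[OF i]]])
  qed
  from bchoice[OF this] obtain Y where Y: "\<forall>\<alpha>\<in>arcs ?Q. Y \<alpha> \<in> carrier_mat n (d (Source (fst \<alpha>) (snd \<alpha>))) \<and>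
      bij_betw (\<lambda>v. Y \<alpha> *\<^sub>v v) (carrier_vec (d (Source (fst \<alpha>) (snd \<alpha>))))
        (eigen_space n (A (fst \<alpha>)) (\<rho> (fst \<alpha>) (snd \<alpha>)))" ..
  \<comment> \<open>The inclusions of the eigenspaces of the given representation, in coordinates.\<close>
  define X0 where "X0 = restrict Y (arcs ?Q)"
  have X0: "X0 (i, j) \<in> carrier_mat n (d (Source i j))"
    "bij_betw (\<lambda>v. X0 (i, j) *\<^sub>v v) (carrier_vec (d (Source i j))) (eigen_space n (A i) (\<rho> i j))"
    if "i \<in> {1..m}" "j \<in> {1..r i}" for i j
    using bspec[OF Y, of "(i, j)"] that by (simp_all add: X0_def)
  have X0Q: "X0 \<in> quiver_rep ?Q d"
    unfolding quiver_rep_def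
  proof (rule PiE_I)
    fix \<alpha> assume "\<alpha> \<in> arcs ?Q"
    then show "X0 \<alpha> \<in> carrier_mat (d (head ?Q \<alpha>)) (d (tail ?Q \<alpha>))"
      using X0(1) dS by (cases \<alpha>) auto
  qed (simp add: X0_def)
  have X0e: "eigenspace_rep m r d \<rho> A X0" unfolding eigenspace_rep_def dS using X0(2) by blast
  have "\<exists>R. star_splitting m r d X0 R"
  proof (rule star_splitting_exists)
    fix i assume i: "i \<in> {1..m}"
    show "\<exists>R. splitting (d Sink) {1..r i} (\<lambda>j. d (Source i j)) (\<lambda>j. X0 (i, j)) R"
      unfolding dS
      by (rule splitting_of_eigenspaces[OF Ac[OF i] Aiter[OF i] assms(6)[OF i] ch[OF i] X0[OF i]])
  qed
  then obtain R0 where R0: "star_splitting m r d X0 R0" ..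
  have bal: "balanced m r d" by (rule star_splitting_balanced[OF R0])
  let ?stable = "stable_dim_vector TYPE('k) ?Q (star_weight m) d"
  let ?max = "(\<Sum>i=1..m. Max ((\<lambda>j. d (Source i j)) ` {1..r i})) \<le> (m - 1) * n"
  let ?cond = "n = 1 \<or> special_isotropic m r d \<and> \<not> divisible_dim_vector ?Q d \<or>
    \<not> special_isotropic m r d \<and> ?max"
  have cond_iff: "?cond \<longleftrightarrow> d Sink = 1 \<or> special_isotropic m r d \<and> d Sink = 2 \<or>
      \<not> special_isotropic m r d \<and>
        (\<Sum>i=1..m. Max ((\<lambda>j. d (Source i j)) ` {1..r i})) \<le> (m - 1) * d Sink"
    using special_isotropic_indivisible_iff[of m r d] dS by blast
  have inf: "infinite (UNIV :: 'k set)" by (rule infinite_UNIV_alg_closed)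
  have necessary: "?cond" if st: ?stable
  proof -
    obtain X :: "nat \<times> nat \<Rightarrow> 'k mat" where X: "stable_rep ?Q (star_weight m) d X"
      using st unfolding stable_dim_vector_def by blast
    show ?thesis
    proof (cases "n = 1")
      case False
      then have n2: "d Sink \<ge> 2" using dS assms(7) by simp
      show ?thesis
      proof (cases "special_isotropic m r d")
        case True
        then have "d Sink = 2" by (intro stable_special_isotropic_dim_two[OF X])
        then show ?thesis using True cond_iff by blast
      next
        case False
        have "(\<Sum>i=1..m. Max ((\<lambda>j. d (Source i j)) ` {1..r i})) \<le> (m - 1) * d Sink"
          using assms(2) by (intro stable_imp_sum_Max_le[OF X n2 assms(1)]) force
        then show ?thesis using False cond_iff by blast
      qed
    qed simp
  qed
  have generic: "\<exists>F. nonzero_rep_poly ?Q d F \<and> (\<forall>X\<in>quiver_rep ?Q d. F X \<noteq> (0 :: 'k) \<longrightarrow>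
      (\<exists>R. star_splitting m r d X R \<and> irreducible_star m r d X R))" if c: "?cond"
    using c unfolding cond_iff
    by (intro generic_rep_irreducible[OF inf bal] condition_imp_negative_euler_form[OF bal assms(1)])
  have sufficient: ?stable if c: ?cond
  proof -
    from generic[OF c] obtain F where F: "nonzero_rep_poly ?Q d F"
      "\<forall>X\<in>quiver_rep ?Q d. F X \<noteq> (0 :: 'k) \<longrightarrow> (\<exists>R. star_splitting m r d X R \<and> irreducible_star m r d X R)"
      by blast
    obtain X where X: "X \<in> quiver_rep ?Q d" "F X \<noteq> 0" using F(1) unfolding nonzero_rep_poly_def by blast
    obtain R where "star_splitting m r d X R" "irreducible_star m r d X R" using F(2) X by blast
    then have "stable_rep ?Q (star_weight m) d X"
      using X(1) bal dS assms(1,7) by (intro irreducible_imp_stable) auto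
    then show ?thesis unfolding stable_dim_vector_def by blast
  qed
  have iff: "?stable \<longleftrightarrow> ?cond" using necessary sufficient by blast
  have four: "n = 2 \<and> card {(i, j). i \<in> {1..m} \<and> j \<in> {1..r i} \<and> d (Source i j) = 1} = 4"
    if sp: "special_isotropic m r d" and ind: "\<not> divisible_dim_vector ?Q d"
  proof -
    have n2: "d Sink = 2" using special_isotropic_indivisible_iff[OF sp] ind by blast
    have "{(i, j). i \<in> {1..m} \<and> j \<in> {1..r i} \<and> d (Source i j) = 1} =
        {(i, j). i \<in> {1..m} \<and> j \<in> {1..r i} \<and> 0 < d (Source i j) \<and> d (Source i j) < d Sink}"
      unfolding n2 by (auto simp: less_2_cases_iff)
    then show ?thesis using sp n2 dS by (simp add: special_isotropic_def)
  qed
  have simple: ?stable if M: "simple_group_rep ?F n M"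
  proof -
    have "irreducible_star m r d X0 R0"
      using X0e unfolding A_def
      by (intro simple_rep_imp_irreducible[where Gs = Gs and a = a and \<rho> = \<rho>, OF M gr car dS R0])
    then have "stable_rep ?Q (star_weight m) d X0"
      using X0Q R0 bal dS assms(1,7) by (intro irreducible_imp_stable) auto
    then show ?thesis unfolding stable_dim_vector_def by blast
  qed
  have dense: "\<exists>S. openin (subtopology (zariski ?Q d) (invertible_reps m r d)) S \<and>
             subtopology (zariski ?Q d) (invertible_reps m r d) closure_of S = invertible_reps m r d \<and>
             (\<forall>X\<in>S. \<exists>N :: (nat \<times> 'g) list \<Rightarrow> 'k mat.
                simple_group_rep ?F n N \<and> eigenspace_rep m r d \<rho> (gen_images Gs a N) X)" if st: ?stable
  proof -
    from generic[OF necessary[OF st]] obtain F where F: "nonzero_rep_poly ?Q d F"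
      "\<forall>X\<in>quiver_rep ?Q d. F X \<noteq> (0 :: 'k) \<longrightarrow> (\<exists>R. star_splitting m r d X R \<and> irreducible_star m r d X R)"
      by blast
    let ?I = "invertible_reps m r d :: (nat \<times> nat \<Rightarrow> 'k mat) set"
    let ?T = "subtopology (zariski ?Q d) ?I"
    \<comment> \<open>Non-vanishing of \<open>F\<close> already implies invertibility of the sum maps, so \<open>S\<close> is contained in
      \<open>invertible_reps\<close>.\<close>
    define S where "S = {X \<in> quiver_rep ?Q d. F X \<noteq> 0}"
    have SI: "S \<subseteq> ?I"
    proof
      fix X assume "X \<in> S"
      then have X: "X \<in> quiver_rep ?Q d" "F X \<noteq> 0" by (simp_all add: S_def)
      then obtain R where "star_splitting m r d X R" using F(2) by blast
      then show "X \<in> ?I" using X(1) invertible_reps_iff by blast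
    qed
    have IQ: "?I \<subseteq> quiver_rep ?Q d" by (auto simp: invertible_reps_def)
    have top: "topspace ?T = ?I" using IQ by (auto simp: topspace_zariski)
    have Fp: "F \<in> rep_polys ?Q d" using F(1) by (simp add: nonzero_rep_poly_def)
    have "openin (zariski ?Q d) S"
      unfolding openin_zariski S_def by (rule exI[of _ "{F}"]) (use Fp in auto)
    then have op: "openin ?T S" using SI by (metis inf.absorb_iff1 openin_subtopology)
    have "?T closure_of S = ?I"
    proof
      show "?T closure_of S \<subseteq> ?I" using closure_of_subset_topspace[of ?T S] top by simp
      show "?I \<subseteq> ?T closure_of S"
      proof
        fix X assume X: "X \<in> ?I"
        show "X \<in> ?T closure_of S"
          unfolding in_closure_of top
        proof (intro conjI allI impI, rule X, elim conjE)
          fix U assume XU: "X \<in> U" and U: "openin ?T U"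
          obtain V where V: "openin (zariski ?Q d) V" "U = V \<inter> ?I" using U unfolding openin_subtopology by blast
          obtain Gp where Gp: "Gp \<subseteq> rep_polys ?Q d" "V = {X \<in> quiver_rep ?Q d. \<exists>f\<in>Gp. f X \<noteq> (0 :: 'k)}"
            using V(1) unfolding openin_zariski by blast
          obtain g where g: "g \<in> Gp" "g X \<noteq> 0" using XU V(2) Gp(2) by blast
          have "nonzero_rep_poly ?Q d g"
            using g Gp(1) X IQ unfolding nonzero_rep_poly_def by blast
          from nonzero_rep_poly_mult[OF inf F(1) this] obtain Z where
            Z: "Z \<in> quiver_rep ?Q d" "F Z * g Z \<noteq> 0" unfolding nonzero_rep_poly_def by blast
          then have "Z \<in> S" "g Z \<noteq> 0" by (auto simp: S_def)
          moreover have "Z \<in> U" using Z g(1) SI \<open>Z \<in> S\<close> \<open>g Z \<noteq> 0\<close> unfolding V(2) Gp(2) by blast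
          ultimately show "\<exists>Y. Y \<in> S \<and> Y \<in> U" by blast
        qed
      qed
    qed
    moreover have "\<exists>N :: (nat \<times> 'g) list \<Rightarrow> 'k mat.
        simple_group_rep ?F n N \<and> eigenspace_rep m r d \<rho> (gen_images Gs a N) X" if "X \<in> S" for X
    proof -
      have X: "X \<in> quiver_rep ?Q d" "F X \<noteq> 0" using that by (auto simp: S_def)
      obtain R where R: "star_splitting m r d X R" "irreducible_star m r d X R" using F(2) X by blast
      show ?thesis
        by (rule irreducible_imp_simple_rep[where Gs = Gs and a = a]) (use assms(2-7) ch dS R X in auto)
    qed
    ultimately show ?thesis using op by blast
  qed
  show ?thesis using iff four simple dense by blast
qed

end
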